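(* Let $\mathbb{A}^\circ_{n,\nu}(Q,\mu)$ refer to either of the sets $\mathbb{A}_{n,\nu}(Q,\mu)$ and $\mathbb{A}^*_{n,\nu}(Q,\mu)$ (the statement holds for each of them). For any integer $n\ge 2$ there is a constant $\nu>0$ depending on $n$ only with the following property. For any $\mu$ satisfying $$0<\mu\le \frac{n+1}{3}$$ and any interval $J\subset[-\tfrac12,\tfrac12]$, for all sufficiently large $Q$, $$\lambda\left(\bigcup_{\alpha_1\in\mathbb{A}^\circ_{n,\nu}(Q,\mu)}B\big(\alpha_1,Q^{-n-1+2\mu}\big)\cap J\right)\ \ge\ \tfrac34|J|.$$
   Context: $\lambda$ is Lebesgue measure on $\mathbb{R}$, $|J|$ is the length of an interval $J$, and $B(x,\rho)$ is the interval in $\mathbb{R}$ centred at $x$ of radius $\rho$. The height $H(\alpha)$ of an algebraic number $\alpha$ is the maximum of the absolute values of the coefficients of its minimal polynomial over $\mathbb{Z}$. Algebraic numbers are conjugate if they are roots of the same irreducible (over $\mathbb{Q}$) integer polynomial. Let $n\ge 2$ be an integer, $\mu\ge 0$, $0<\nu<1$ and $Q>1$. $\mathbb{A}_{n,\nu}(Q,\mu)$ is the set of algebraic numbers $\alpha_1\in\mathbb{R}$ of degree $n$ such that $$\nu Q\le H(\alpha_1)\le \nu^{-1}Q$$ and $$\nu Q^{-\mu}\le|\alpha_1-\alpha_2|\le\nu^{-1}Q^{-\mu}\quad\text{for some }\alpha_2\in\mathbb{R}\text{ conjugate to }\alpha_1.$$ $\mathbb{A}^*_{n,\nu}(Q,\mu)$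 is the set of algebraic integers $\alpha_1\in\mathbb{R}$ of degree $n+1$ satisfying the same two conditions. *)

theory Defs
  imports "HOL-Analysis.Analysis" "HOL-Computational_Algebra.Computational_Algebra"
    "HOL-Computational_Algebra.Field_as_Ring"
begin

definition is_min_int_poly :: "int poly \<Rightarrow> real \<Rightarrow> bool" where
  "is_min_int_poly p \<alpha> \<longleftrightarrow>
     irreducible (map_poly rat_of_int p) \<and> Polynomial.content p = 1 \<and> lead_coeff p > 0 \<and>
     poly (map_poly real_of_int p) \<alpha> = 0"

(* The minimal polynomial over the integers, normalised to be primitive with positive leading
   coefficient. Only meaningful for algebraic arguments, see is_min_int_poly_ex1. *)
definition min_int_poly :: "real \<Rightarrow> int poly" where
  "min_int_poly \<alpha> = (THE p. is_min_int_poly p \<alpha>)"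

definition alg_degree :: "real \<Rightarrow> nat" where
  "alg_degree \<alpha> = degree (min_int_poly \<alpha>)"

definition alg_height :: "real \<Rightarrow> int" where
  "alg_height \<alpha> = Max ((\<lambda>i. \<bar>coeff (min_int_poly \<alpha>) i\<bar>) ` {..degree (min_int_poly \<alpha>)})"

definition alg_conjugate :: "real \<Rightarrow> real \<Rightarrow> bool" where
  "alg_conjugate \<alpha> \<beta> \<longleftrightarrow>
     (\<exists>p :: int poly. irreducible (map_poly rat_of_int p) \<and>
        poly (map_poly real_of_int p) \<alpha> = 0 \<and> poly (map_poly real_of_int p) \<beta> = 0)"

definition height_and_conjugate_cond :: "real \<Rightarrow> real \<Rightarrow> real \<Rightarrow> real \<Rightarrow> bool" where
  "height_and_conjugate_cond \<nu> Q \<mu> \<alpha>\<^sub>1 \<longleftrightarrow>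
     \<nu> * Q \<le> real_of_int (alg_height \<alpha>\<^sub>1) \<and> real_of_int (alg_height \<alpha>\<^sub>1) \<le> inverse \<nu> * Q \<and>
     (\<exists>\<alpha>\<^sub>2. alg_conjugate \<alpha>\<^sub>1 \<alpha>\<^sub>2 \<and>
        \<nu> * Q powr (- \<mu>) \<le> \<bar>\<alpha>\<^sub>1 - \<alpha>\<^sub>2\<bar> \<and> \<bar>\<alpha>\<^sub>1 - \<alpha>\<^sub>2\<bar> \<le> inverse \<nu> * Q powr (- \<mu>))"

definition close_conj_numbers :: "nat \<Rightarrow> real \<Rightarrow> real \<Rightarrow> real \<Rightarrow> real set" where
  "close_conj_numbers n \<nu> Q \<mu> =
     {\<alpha>. algebraic \<alpha> \<and> alg_degree \<alpha> = n \<and> height_and_conjugate_cond \<nu> Q \<mu> \<alpha>}"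

definition close_conj_integers :: "nat \<Rightarrow> real \<Rightarrow> real \<Rightarrow> real \<Rightarrow> real set" where
  "close_conj_integers n \<nu> Q \<mu> =
     {\<alpha>. algebraic_int \<alpha> \<and> alg_degree \<alpha> = n + 1 \<and> height_and_conjugate_cond \<nu> Q \<mu> \<alpha>}"


lemma rat_poly_clear_denominators:
  fixes f :: "rat poly"
  obtains d :: int and F :: "int poly"
  where "d \<noteq> 0" "smult (of_int d) f = map_poly of_int F"
proof -
  have "\<exists>(d::int) F. d \<noteq> 0 \<and> smult (of_int d) f = map_poly of_int F"
  proof (induction f)
    case 0
    show ?case by (rule exI[of _ 1], rule exI[of _ 0]) simp
  next
    case (pCons a f)
    then obtain d :: int and F where dF: "d \<noteq> 0" "smult (of_int d) f = map_poly of_int F" by blast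
    obtain u v where uv: "quotient_of a = (u, v)" by force
    have v: "v > 0" "a = of_int u / of_int v"
      using uv by (auto dest: quotient_of_denom_pos quotient_of_div)
    have "smult (of_int (v * d)) (pCons a f) = map_poly of_int (pCons (d * u) (smult v F))"
    proof (rule poly_eqI)
      fix i
      have "of_int d * coeff f j = of_int (coeff F j)" for j
        using arg_cong[OF dF(2), of "\<lambda>p. coeff p j"] by (simp add: coeff_map_poly)
      then show "coeff (smult (of_int (v * d)) (pCons a f)) i =
        coeff (map_poly of_int (pCons (d * u) (smult v F))) i"
        using v by (auto simp: coeff_pCons coeff_map_poly mult.assoc split: nat.splits)
    qed
    then show ?case using dF(1) v(1) by (intro exI[of _ "v * d"]) auto
  qed
  then show ?thesis using that by blast
qed

lemma poly_map_rat_int: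
  "poly (map_poly real_of_rat (map_poly rat_of_int p)) x = poly (map_poly real_of_int p) x"
  by (simp add: map_poly_map_poly o_def)

lemma map_poly_real_of_rat_mult:
  "map_poly real_of_rat (p * q) = map_poly real_of_rat p * map_poly real_of_rat q"
  by (rule poly_eqI) (simp add: coeff_map_poly coeff_mult of_rat_sum of_rat_mult)

lemma map_poly_real_of_rat_add:
  "map_poly real_of_rat (p + q) = map_poly real_of_rat p + map_poly real_of_rat q"
  by (rule poly_eqI) (simp add: coeff_map_poly of_rat_add)

lemma irreducible_rat_dvd:
  fixes p q :: "rat poly"
  assumes "irreducible p" "poly (map_poly real_of_rat p) x = 0" "poly (map_poly real_of_rat q) x = 0"
  shows "p dvd q"
proof (rule ccontr)
  assume "\<not> p dvd q"
  then have "coprime p q"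
    by (rule prime_elem_imp_coprime[OF irreducible_imp_prime_elem[OF assms(1)]])
  then obtain a b where "a * p + b * q = 1"
    by (metis bezout_coefficients_fst_snd coprime_imp_gcd_eq_1)
  then have "map_poly real_of_rat a * map_poly real_of_rat p + map_poly real_of_rat b * map_poly real_of_rat q
      = map_poly real_of_rat 1"
    by (metis map_poly_real_of_rat_mult map_poly_real_of_rat_add)
  from arg_cong[OF this, of "\<lambda>r. poly r x"] show False
    using assms(2,3) by simp
qed

lemma is_min_int_poly_unique:
  assumes "is_min_int_poly p x" "is_min_int_poly q x"
  shows "p = q"
proof -
  let ?P = "map_poly rat_of_int p" and ?Q = "map_poly rat_of_int q"
  have P: "irreducible ?P" "irreducible ?Q" "content p = 1" "content q = 1" "lead_coeff p > 0" "lead_coeff q > 0"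
    "poly (map_poly real_of_rat ?P) x = 0" "poly (map_poly real_of_rat ?Q) x = 0"
    using assms by (auto simp: is_min_int_poly_def poly_map_rat_int)
  have "?P dvd ?Q" "?Q dvd ?P" using irreducible_rat_dvd P by blast+
  then have deg: "degree p = degree q"
    using P(1,2) by (metis degree_map_poly dvd_imp_degree_le dual_order.antisym irreducible_def of_int_eq_0_iff of_int_0)
  obtain c where c: "?Q = ?P * c" using \<open>?P dvd ?Q\<close> by (elim dvdE)
  have nz: "c \<noteq> 0" "?P \<noteq> 0" using c P(1,2) by auto
  have "degree ?Q = degree ?P + degree c" unfolding c using nz by (rule degree_mult_eq[rotated])
  then have "degree c = 0" using deg by (simp add: degree_map_poly)
  then obtain k where k: "c = [:k:]" by (rule degree_eq_zeroE)
  obtain u v where uv: "quotient_of k = (u, v)" by force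
  have v: "v > 0" "k = of_int u / of_int v"
    using uv by (auto dest: quotient_of_denom_pos quotient_of_div)
  have eq: "smult v q = smult u p"
  proof (rule poly_eqI)
    fix i
    have "rat_of_int (coeff q i) = k * of_int (coeff p i)"
      using arg_cong[OF c, of "\<lambda>p. coeff p i"] by (simp add: k coeff_map_poly)
    then have "rat_of_int (v * coeff q i) = of_int (u * coeff p i)"
      using v by simp
    then show "coeff (smult v q) i = coeff (smult u p) i" by (metis coeff_smult of_int_eq_iff)
  qed
  from arg_cong[OF this, of content] have "\<bar>v\<bar> = \<bar>u\<bar>" using P(3,4) by simp
  moreover have "v * lead_coeff q = u * lead_coeff p"
    using arg_cong[OF eq, of "\<lambda>p. coeff p (degree q)"] deg by simp
  then have "u > 0" using v(1) P(5,6) by (metis mult_pos_pos zero_less_mult_pos2)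
  ultimately have "u = v" using v by simp
  then show ?thesis using eq v(1) by (metis less_irrefl smult_eq_iff smult_cancel)
qed

lemma irreducible_int_imp_irreducible_rat:
  fixes p :: "int poly"
  assumes p: "irreducible p" "degree p > 0"
  shows "irreducible (map_poly rat_of_int p)"
proof (rule irreducibleI)
  have dp: "degree (map_poly rat_of_int p) = degree p" by (simp add: degree_map_poly)
  show "map_poly rat_of_int p \<noteq> 0" "\<not> map_poly rat_of_int p dvd 1"
    using dp p(2) by (auto elim!: is_unit_polyE)
  fix f g assume fg: "map_poly rat_of_int p = f * g"
  obtain d F where dF: "d \<noteq> 0" "smult (of_int d) f = map_poly rat_of_int F"
    by (rule rat_poly_clear_denominators)
  obtain e G where eG: "e \<noteq> 0" "smult (of_int e) g = map_poly rat_of_int G"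
    by (rule rat_poly_clear_denominators)
  have nz: "f \<noteq> 0" "g \<noteq> 0" using fg dp p(2) by auto
  have hom: "map_poly rat_of_int (r * s) = map_poly of_int r * map_poly of_int s" for r s
    by (rule poly_eqI) (simp add: coeff_map_poly coeff_mult)
  have "map_poly rat_of_int (smult (d * e) p) = smult (of_int (d * e)) (f * g)"
    unfolding fg[symmetric] by (rule poly_eqI) (simp add: coeff_map_poly)
  also have "\<dots> = map_poly rat_of_int (F * G)"
    unfolding hom dF(2)[symmetric] eG(2)[symmetric] by (simp only: mult_smult_left mult_smult_right smult_smult of_int_mult mult.commute[of "of_int d :: rat"])
  finally have eq': "map_poly rat_of_int (smult (d * e) p) = map_poly rat_of_int (F * G)" .
  have eq: "smult (d * e) p = F * G"
  proof (rule poly_eqI)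
    fix i
    have "rat_of_int (coeff (smult (d * e) p) i) = rat_of_int (coeff (F * G) i)"
      using arg_cong[OF eq', of "\<lambda>r. coeff r i"] by (simp only: coeff_map_poly of_int_0)
    then show "coeff (smult (d * e) p) i = coeff (F * G) i" by (simp only: of_int_eq_iff)
  qed
  have degs: "degree F = degree f" "degree G = degree g"
    using arg_cong[OF dF(2), of degree] arg_cong[OF eG(2), of degree] dF(1) eG(1)
    by (simp_all add: degree_map_poly)
  have sum: "degree p = degree f + degree g"
    using fg nz dp degree_mult_eq by metis
  have "prime_elem p" using p by (simp add: irreducible_imp_prime_elem)
  moreover have "p dvd F * G" unfolding eq[symmetric] by (simp add: dvd_smult)
  ultimately have "p dvd F \<or> p dvd G" by (simp add: prime_elem_dvd_mult_iff)
  moreover have "F \<noteq> 0" "G \<noteq> 0" using eq dF(1) eG(1) p by auto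
  ultimately have "degree p \<le> degree F \<or> degree p \<le> degree G"
    using dvd_imp_degree_le by blast
  then have "degree g = 0 \<or> degree f = 0" using degs sum by linarith
  then show "f dvd 1 \<or> g dvd 1" using nz is_unit_iff_degree by blast
qed

lemma is_min_int_poly_exists:
  assumes "algebraic (x :: real)"
  obtains p where "is_min_int_poly p x"
proof -
  obtain p :: "int poly" where p: "p \<noteq> 0" "poly (map_poly real_of_int p) x = 0"
    using assms by (elim algebraicE') auto
  have hom: "map_poly real_of_int (r * s) = map_poly of_int r * map_poly of_int s" for r s
    by (rule poly_eqI) (simp add: coeff_map_poly coeff_mult)
  have "\<exists>q. prime_elem q \<and> poly (map_poly real_of_int q) x = 0"
    using p
  proof (induction p rule: prime_divisors_induct)
    case zero
    then show ?case by simp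
  next
    case (unit r)
    then obtain c where "r = [:c:]" "c \<noteq> 0"
      by (metis is_unit_polyE not_is_unit_0 pCons_0_0)
    then show ?case using unit by (simp add: map_poly_pCons)
  next
    case (factor q r)
    then show ?case by (auto simp: hom prime_imp_prime_elem)
  qed
  then obtain q where q: "prime_elem q" "poly (map_poly real_of_int q) x = 0" by blast
  have irr: "irreducible q" using q(1) by (rule prime_elem_imp_irreducible)
  have deg: "degree q > 0"
  proof (rule ccontr)
    assume "\<not> degree q > 0"
    then obtain c where "q = [:c:]" by (metis degree_eq_zeroE neq0_conv)
    then show False using q irr by (simp add: map_poly_pCons)
  qed
  have cont: "content q = 1"
    using irr deg nonconst_poly_irreducible_iff by blast
  define r where "r = smult (sgn (lead_coeff q)) q"
  have s: "sgn (lead_coeff q) = 1 \<or> sgn (lead_coeff q) = -1" using irr by (auto simp: sgn_if)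
  then have "r = q \<or> r = - q" by (auto simp: r_def)
  moreover have "lead_coeff q \<noteq> 0" using irr by auto
  then have "lead_coeff r > 0" by (auto simp: r_def sgn_if simp del: leading_coeff_0_iff)
  moreover have neg: "map_poly rat_of_int (- q) = - map_poly rat_of_int q"
    "map_poly real_of_int (- q) = - map_poly real_of_int q"
    by (auto intro!: poly_eqI simp: coeff_map_poly)
  moreover have irrq: "irreducible (map_poly rat_of_int q)"
    using irr deg by (rule irreducible_int_imp_irreducible_rat)
  moreover have "irreducible (- map_poly rat_of_int q)"
    using irreducible_mult_unit_left[of "- 1" "map_poly rat_of_int q"] irrq by simp
  moreover have "content r = 1" using cont s by (auto simp: r_def)
  ultimately have "is_min_int_poly r x"
    using q(2) by (auto simp: is_min_int_poly_def)
  then show ?thesis by (rule that)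
qed

lemma is_min_int_poly_ex1:
  assumes "algebraic (x :: real)"
  shows "\<exists>!p. is_min_int_poly p x"
  using is_min_int_poly_exists[OF assms] is_min_int_poly_unique by blast

end

theory Submission
  imports Defs "Jordan_Normal_Form.Determinant"
begin

text \<open>
  Fix a point \<open>x\<close>, write \<open>N = n + 1\<close>, and identify an integer polynomial of degree at most \<open>n\<close>
  with its vector of Taylor coefficients at \<open>x\<close>, the \<open>i\<close>-th one measured in the unit \<open>\<xi> i\<close>, where
  \<open>\<xi> 0 = Q powr (\<mu> - n)\<close>, \<open>\<xi> 1 = Q powr (1 - \<mu>)\<close> and \<open>\<xi> i = Q\<close> for \<open>2 \<le> i \<le> n\<close>.
  These units have product \<open>1\<close>, so the integer polynomials become a unimodular lattice in \<open>N\<close>-space,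
  depending on \<open>x\<close>. If a polynomial has first and second Taylor coefficient of exact
  order \<open>\<xi> 1\<close> and \<open>\<xi> 2\<close>, and all others at most of the order of their unit, then near \<open>x\<close> it looks, in
  the variable \<open>y = (X - x) Q\<^sup>\<mu>\<close>, like a quadratic with two real roots at distance
  about \<open>1\<close>; one of them lies within \<open>\<xi> 0 / \<xi> 1\<close>, the radius in the theorem, of \<open>x\<close>
  (\<open>two_close_roots\<close>). This is where \<open>\<mu> \<le> (n + 1) / 3\<close> enters: it says that
  \<open>\<xi> 0 * \<xi> 2 \<le> (\<xi> 1)\<^sup>2\<close>, so, with suitable constants, the constant term cannot push the
  discriminant below zero.

  Such polynomials exist, and may moreover be prescribed modulo \<open>p\<^sup>2\<close> for a bounded prime \<open>p\<close>, as soon as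
  the lattice has a basis of bounded vectors, because real coordinates can be rounded in a residue
  class modulo \<open>p\<^sup>2\<close> (\<open>tailored_int_poly\<close>). The residue class of \<open>X\<^sup>m + p\<close> makes Eisenstein's criterion
  apply and fixes the degree, with \<open>m = n\<close> in the case of algebraic numbers and \<open>m = n + 1\<close>, leading
  coefficient \<open>1\<close>, in the case of algebraic integers. A bounded basis exists if the lattice has no short
  nonzero vector: by the pigeonhole principle it has many points in a large cube, too many for
  separated points in a hyperplane (\<open>short_basis_exists\<close>).

  It remains to see that for most \<open>x\<close> the lattice has no short vector (\<open>no_short_vector_mostly\<close>). Changing
  \<open>x\<close> acts on the Taylor coefficients by a unipotent flow, and the claim is the quantitative
  nondivergence of Kleinbock and Margulis. Its input is that covolumes of rational subspaces are
  given by polynomials in \<open>x\<close>, hence rarely much smaller than their maximum on an interval, and that none of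
  them is small on a whole interval, because the Wronskian of
  independent integer polynomials is a nonzero integer polynomial. The combinatorial core
  (\<open>quantitative_nondivergence\<close>) sees the subspaces as an ordered set only.
\<close>

(* below, smult is the scalar multiple of a polynomial *)
hide_const (open) Module.smult

section \<open>Polynomials are rarely small\<close>

text \<open>
  Exceptional sets are carried as Borel sets with a bound on their measure, since the set of good
  points itself need not be obviously measurable. Half-open intervals are used throughout because
  they split into halves without overlap.
\<close>

definition mostly :: "real \<Rightarrow> real \<Rightarrow> real \<Rightarrow> (real \<Rightarrow> bool) \<Rightarrow> bool" where
  "mostly \<eta> a b P \<longleftrightarrow> (\<exists>N\<in>sets lborel. emeasure lborel N \<le> ennreal (\<eta> * (b - a)) \<and>
     (\<forall>x\<in>{a..<b} - N. P x))"

lemma mostly_ex: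
  assumes "mostly \<eta> A B P" "A \<le> a" "b \<le> B" "a < b" "\<eta> * (B - A) < b - a"
  shows "\<exists>x\<in>{a..<b}. P x"
proof -
  obtain N where N: "N \<in> sets lborel" "emeasure lborel N \<le> ennreal (\<eta> * (B - A))"
    "\<forall>x\<in>{A..<B} - N. P x"
    using assms(1) unfolding mostly_def by blast
  have "\<not> {a..<b} \<subseteq> N"
  proof
    assume "{a..<b} \<subseteq> N"
    then have "emeasure lborel {a..<b} \<le> ennreal (\<eta> * (B - A))"
      using emeasure_mono[OF _ N(1)] N(2) order_trans by blast
    then show False using assms(4,5) by (auto simp: ennreal_le_iff2)
  qed
  then show ?thesis using N(3) assms(2,3) by force
qed

text \<open>
  The factor by which a polynomial of degree \<open>D\<close> may drop below its value at one point of an interval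
  outside a part of relative measure \<open>\<eta>\<close>; it does not depend on the interval.
\<close>

definition remez_const :: "nat \<Rightarrow> real \<Rightarrow> real" where
  "remez_const D \<eta> = (\<eta> / (2 * (real D + 1)) / (1 + \<eta> / (2 * (real D + 1)))) ^ D"

lemma remez_const_bounds: "0 < \<eta> \<Longrightarrow> 0 < remez_const D \<eta> \<and> remez_const D \<eta> \<le> 1"
proof -
  assume "0 < \<eta>"
  define h where "h = \<eta> / (2 * (real D + 1))"
  have "0 < h" using \<open>0 < \<eta>\<close> by (simp add: h_def)
  then have "0 < h / (1 + h)" "h / (1 + h) \<le> 1" by simp_all
  then show ?thesis unfolding remez_const_def h_def[symmetric] by (simp add: power_le_one)
qed

text \<open>
  Factor the polynomial over the complex numbers and remove from the interval, of length \<open>L\<close>, the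
  points within \<open>h L\<close> of the real part of some root. At a remaining point \<open>x\<close> each factor
  \<open>\<bar>x - z\<bar>\<close> exceeds \<open>h L\<close>, and moving to any other point \<open>y\<close> changes it by at most \<open>L\<close>, so it is
  at least \<open>h / (1 + h)\<close> times the factor at \<open>y\<close>.
\<close>

lemma poly_relative_lower_bound:
  fixes q :: "real poly" and c d \<eta> y :: real
  assumes deg: "degree q \<le> D" and \<eta>: "0 < \<eta>" and cd: "c < d" and y: "y \<in> {c..<d}"
  shows "mostly \<eta> c d (\<lambda>x. remez_const D \<eta> * \<bar>poly q y\<bar> \<le> \<bar>poly q x\<bar>)"
proof (cases "q = 0")
  case True
  then show ?thesis unfolding mostly_def by (intro bexI[of _ "{}"]) auto
next
  case False
  define h where "h = \<eta> / (2 * (real D + 1))"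
  define L where "L = d - c"
  have L: "L > 0" using cd by (simp add: L_def)
  have h: "h > 0" using \<eta> by (simp add: h_def)
  define \<theta> where "\<theta> = h / (1 + h)"
  have \<theta>: "0 < \<theta>" "\<theta> \<le> 1" using h by (auto simp: \<theta>_def)
  have \<theta>_eq: "\<theta> * (C / h + C) = C" for C
  proof -
    have "C / h + C = C * ((1 + h) / h)" using h by (simp add: add_divide_distrib distrib_left)
    then show ?thesis using h by (simp add: \<theta>_def)
  qed
  let ?cq = "map_poly complex_of_real q"
  have "?cq \<noteq> 0" using False by (simp add: map_poly_eq_0_iff)
  then obtain A where A: "size A = degree ?cq" "?cq = smult (lead_coeff ?cq) (\<Prod>z\<in>#A. [:-z, 1:])"
    using alg_closed_imp_factorization by blast
  have sizeA: "size A \<le> D" using A(1) deg by (simp add: degree_map_poly)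
  have abs_q: "\<bar>poly q x\<bar> = cmod (lead_coeff ?cq) * (\<Prod>z\<in>#A. cmod (of_real x - z))" for x
  proof -
    have "poly ?cq (of_real x) = of_real (poly q x)" by (induction q) (auto simp: map_poly_pCons)
    then have "\<bar>poly q x\<bar> = cmod (poly ?cq (of_real x))" by simp
    also have "\<dots> = cmod (lead_coeff ?cq) * cmod (poly (\<Prod>z\<in>#A. [:-z, 1:]) (of_real x))"
      by (subst A(2)) (simp add: norm_mult)
    also have "cmod (poly (\<Prod>z\<in>#A. [:-z, 1:]) (of_real x)) = (\<Prod>z\<in>#A. cmod (of_real x - z))"
      by (induction A) (simp_all add: norm_mult flip: left_diff_distrib)
    finally show ?thesis .
  qed
  define N where "N = (\<Union>z\<in>set_mset A. {Re z - h * L .. Re z + h * L})"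
  have nonneg: "0 \<le> (\<Prod>z\<in>#B. cmod (of_real w - z))" for B w by (induction B) auto
  have cardA: "card (set_mset A) \<le> D"
  proof -
    have "card (set_mset B) \<le> size B" for B :: "complex multiset"
      by (induction B) (auto simp: card_insert_if)
    then show ?thesis using sizeA order_trans by blast
  qed
  have "emeasure lborel N \<le> (\<Sum>z\<in>set_mset A. emeasure lborel {Re z - h * L .. Re z + h * L})"
    unfolding N_def by (rule emeasure_subadditive_finite) auto
  also have "\<dots> = (\<Sum>z\<in>set_mset A. ennreal (2 * h * L))"
    using h L by (intro sum.cong) (auto simp: algebra_simps)
  also have "\<dots> = ennreal (real (card (set_mset A)) * (2 * h * L))"
    using h L by (simp add: ennreal_mult'' ennreal_of_nat_eq_real_of_nat)
  also have "\<dots> \<le> ennreal (\<eta> * (d - c))"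
  proof (rule ennreal_leI)
    have "real (card (set_mset A)) * (2 * h * L) \<le> (real D + 1) * (2 * h * L)"
      using h L cardA by (intro mult_right_mono) auto
    also have "\<dots> = \<eta> * (d - c)" by (simp add: h_def L_def field_simps)
    finally show "real (card (set_mset A)) * (2 * h * L) \<le> \<eta> * (d - c)" .
  qed
  finally have meas: "emeasure lborel N \<le> ennreal (\<eta> * (d - c))" .
  have "\<theta> ^ D * \<bar>poly q y\<bar> \<le> \<bar>poly q x\<bar>" if x: "x \<in> {c..<d} - N" for x
  proof -
    have factor: "\<theta> * cmod (of_real y - z) \<le> cmod (of_real x - z)" if z: "z \<in># A" for z
    proof -
      have "\<not> \<bar>x - Re z\<bar> \<le> h * L" using x z by (auto simp: N_def abs_le_iff)
      moreover have "\<bar>x - Re z\<bar> \<le> cmod (of_real x - z)"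
        using abs_Re_le_cmod[of "of_real x - z"] by simp
      ultimately have 1: "L \<le> cmod (of_real x - z) / h"
        using h by (simp add: pos_le_divide_eq mult.commute)
      have "cmod (of_real y - z) \<le> cmod (of_real y - of_real x) + cmod (of_real x - z)"
        using norm_triangle_ineq[of "of_real y - of_real x" "of_real x - z :: complex"] by simp
      also have "cmod (of_real y - of_real x) = \<bar>y - x\<bar>" by (metis norm_of_real of_real_diff)
      also have "\<dots> \<le> L" using x y by (auto simp: L_def)
      finally have "cmod (of_real y - z) \<le> cmod (of_real x - z) / h + cmod (of_real x - z)"
        using 1 by linarith
      then have "\<theta> * cmod (of_real y - z) \<le> \<theta> * (cmod (of_real x - z) / h + cmod (of_real x - z))"
        using \<theta> by (intro mult_left_mono) auto
      also have "\<dots> = cmod (of_real x - z)" by (rule \<theta>_eq)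
      finally show ?thesis .
    qed
    have "\<theta> ^ size A * (\<Prod>z\<in>#A. cmod (of_real y - z)) \<le> (\<Prod>z\<in>#A. cmod (of_real x - z))"
      using factor
    proof (induction A)
      case empty then show ?case by simp
    next
      case (add z A)
      have "(\<theta> * cmod (of_real y - z)) * (\<theta> ^ size A * (\<Prod>z\<in>#A. cmod (of_real y - z)))
          \<le> cmod (of_real x - z) * (\<Prod>z\<in>#A. cmod (of_real x - z))"
        using add \<theta> by (intro mult_mono mult_nonneg_nonneg nonneg) auto
      then show ?case by (simp add: algebra_simps)
    qed
    moreover have "\<theta> ^ D \<le> \<theta> ^ size A" using \<theta> sizeA by (intro power_decreasing) auto
    moreover have "0 \<le> (\<Prod>z\<in>#A. cmod (of_real y - z))" by (rule nonneg)
    ultimately have "\<theta> ^ D * (\<Prod>z\<in>#A. cmod (of_real y - z)) \<le> (\<Prod>z\<in>#A. cmod (of_real x - z))"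
      by (meson mult_right_mono order_trans)
    then have "cmod (lead_coeff ?cq) * (\<theta> ^ D * (\<Prod>z\<in>#A. cmod (of_real y - z)))
      \<le> cmod (lead_coeff ?cq) * (\<Prod>z\<in>#A. cmod (of_real x - z))"
      by (intro mult_left_mono) auto
    then show ?thesis unfolding abs_q by (simp add: algebra_simps)
  qed
  moreover have "N \<in> sets lborel" unfolding N_def by auto
  ultimately show ?thesis
    using meas unfolding mostly_def remez_const_def h_def[symmetric] \<theta>_def[symmetric] by blast
qed


section \<open>Quantitative nondivergence for ordered families of functions\<close>

definition relatively_good :: "(real \<Rightarrow> real) \<Rightarrow> (real \<Rightarrow> real) \<Rightarrow> bool" where
  "relatively_good \<kappa> f \<longleftrightarrow> continuous_on UNIV f \<and>
     (\<forall>c d y \<eta>. c < d \<longrightarrow> y \<in> {c..<d} \<longrightarrow> 0 < \<eta> \<longrightarrow> mostly \<eta> c d (\<lambda>x. \<kappa> \<eta> * f y \<le> f x))"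

abbreviation comparable :: "'s::order \<Rightarrow> 's \<Rightarrow> bool" where
  "comparable s t \<equiv> s \<le> t \<or> t \<le> s"

definition is_chain :: "'s::order set \<Rightarrow> bool" where
  "is_chain F \<longleftrightarrow> (\<forall>s\<in>F. \<forall>t\<in>F. comparable s t)"

text \<open>
  Halve the interval repeatedly and stop at the first light dyadic interval. The
  stopped intervals are disjoint, so their exceptional sets add up to at most \<open>\<eta>\<close> times the whole
  length; a point that is never stopped lies in arbitrarily short heavy intervals.
\<close>

lemma stopping_time_cover:
  fixes heavy :: "real \<Rightarrow> real \<Rightarrow> bool"
  assumes ab: "a < b" and root: "heavy a b" and \<eta>: "0 < \<eta>"
    and stop: "\<And>c d c' d'. \<lbrakk>c < d; c' \<le> c; d \<le> d'; d' - c' = 2 * (d - c); \<not> heavy c d; heavy c' d'\<rbrakk> \<Longrightarrow>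
       mostly \<eta> c d G"
    and limit: "\<And>x. x \<in> {a..<b} \<Longrightarrow>
       (\<And>\<delta>. 0 < \<delta> \<Longrightarrow> \<exists>c d. x \<in> {c..<d} \<and> d - c < \<delta> \<and> heavy c d) \<Longrightarrow> G x"
  shows "mostly \<eta> a b G"
proof -
  \<comment> \<open>dyadic interval \<open>j\<close> of level \<open>m\<close> is \<open>J (m, j)\<close>, and \<open>ix x m\<close> is the index of the one containing \<open>x\<close>\<close>
  define lo where "lo = (\<lambda>(m::nat) (j::int). a + (b - a) * of_int j / 2 ^ m)"
  define J where "J = (\<lambda>p. {lo (fst p) (snd p)..<lo (fst p) (snd p + 1)})"
  define hv where "hv = (\<lambda>m j. heavy (lo m j) (lo m (j + 1)))"
  define ix where "ix = (\<lambda>x (m::nat). \<lfloor>(x - a) / (b - a) * 2 ^ m\<rfloor>)"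
  have len: "lo m (j + 1) - lo m j = (b - a) / 2 ^ m" for m j
    by (simp add: lo_def field_simps)
  have mem: "x \<in> J (m, j) \<longleftrightarrow> j = ix x m" for x m j
  proof -
    have "lo m i \<le> x \<longleftrightarrow> of_int i \<le> (x - a) / (b - a) * 2 ^ m" for i
      using ab by (simp add: lo_def field_simps)
    then show ?thesis unfolding J_def ix_def by (auto simp: floor_eq_iff eq_commute[of j] not_le[symmetric])
  qed
  have ix_div: "ix x m = ix x (m + k) div 2 ^ k" for x m k
  proof -
    have "ix x m = \<lfloor>(x - a) / (b - a) * 2 ^ (m + k) / real_of_int (2 ^ k)\<rfloor>"
      by (simp add: ix_def power_add)
    also have "\<dots> = ix x (m + k) div 2 ^ k" unfolding ix_def
      by (rule floor_divide_real_eq_div) simp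
    finally show ?thesis .
  qed
  have ix0: "ix x 0 = 0" if "x \<in> {a..<b}" for x
    using that ab by (auto simp: ix_def floor_eq_iff field_simps)
  have ix_sub: "J (m + k, j) \<subseteq> J (m, j div 2 ^ k)" for m k j
    using ix_div[of _ m k] by (auto simp: mem)
  have hv0: "hv 0 0" using root by (simp add: hv_def lo_def)
  \<comment> \<open>the stopped intervals: light, with all dyadic ancestors heavy\<close>
  define T where "T = {p. (\<exists>x\<in>{a..<b}. ix x (fst p) = snd p) \<and> \<not> hv (fst p) (snd p) \<and>
      (\<forall>m<fst p. hv m (snd p div 2 ^ (fst p - m)))}"
  have sub_ab: "J p \<subseteq> {a..<b}" if pT: "p \<in> T" for p
  proof
    fix y assume y: "y \<in> J p"
    obtain m j where p: "p = (m, j)" by force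
    have "\<exists>x\<in>{a..<b}. ix x m = j" using pT unfolding T_def p by simp
    then obtain x where x: "x \<in> {a..<b}" "ix x m = j" by blast
    have "ix y 0 = j div 2 ^ m" using y ix_div[of y 0 m] by (simp add: p mem)
    also have "\<dots> = ix x 0" using ix_div[of x 0 m] x by simp
    finally have "y \<in> J (0, 0)" using ix0[OF x(1)] by (simp add: mem)
    then show "y \<in> {a..<b}" by (simp add: J_def lo_def)
  qed
  have disj: "disjoint_family_on J T"
  proof -
    have False if "p \<in> T" "p' \<in> T" "y \<in> J p" "y \<in> J p'" "fst p < fst p'" for p p' y
    proof -
      obtain m j m' j' where p: "p = (m, j)" "p' = (m', j')" by force+
      have "j = ix y m" "j' = ix y m'" using that p by (auto simp: mem)
      moreover have "hv m (j' div 2 ^ (m' - m))" using that p by (auto simp: T_def)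
      ultimately have "hv m j" using ix_div[of y m "m' - m"] that p by simp
      then show False using that p by (simp add: T_def)
    qed
    moreover have "p = p'" if "y \<in> J p" "y \<in> J p'" "fst p = fst p'" for p p' y
      using that by (cases p; cases p') (auto simp: mem)
    ultimately show ?thesis unfolding disjoint_family_on_def
      by (metis disjoint_iff linorder_neqE_nat)
  qed
  have "\<exists>N. N \<in> sets lborel \<and> emeasure lborel N \<le> ennreal \<eta> * emeasure lborel (J p) \<and>
      (\<forall>x\<in>J p - N. G x)" if pT: "p \<in> T" for p
  proof -
    obtain m j where p: "p = (m, j)" by force
    have m: "m > 0"
    proof (rule ccontr)
      assume "\<not> m > 0"
      then have "p = (0, 0)" using pT p ix0 by (auto simp: T_def)
      then show False using pT hv0 by (simp add: T_def)
    qed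
    then obtain m1 where m1: "m = Suc m1" by (cases m) auto
    have par: "hv m1 (j div 2)" using pT p m1 by (auto simp: T_def)
    have sub: "J (m, j) \<subseteq> J (m1, j div 2)" using ix_sub[of m1 1 j] m1 by simp
    have lt: "lo m j < lo m (j + 1)" for m j
    proof -
      have "0 < (b - a) / 2 ^ m" using ab by simp
      then show ?thesis using len[of m j] by linarith
    qed
    have ends: "lo m1 (j div 2) \<le> lo m j" "lo m (j + 1) \<le> lo m1 (j div 2 + 1)"
      using sub lt[of m j] by (auto simp: J_def ivl_subset)
    have double: "lo m1 (j div 2 + 1) - lo m1 (j div 2) = 2 * (lo m (j + 1) - lo m j)"
      unfolding len by (simp add: m1 field_simps)
    have light: "\<not> heavy (lo m j) (lo m (j + 1))" using pT p by (simp add: T_def hv_def)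
    have "\<exists>N\<in>sets lborel. emeasure lborel N \<le> ennreal (\<eta> * (lo m (j+1) - lo m j)) \<and>
       (\<forall>x\<in>{lo m j..<lo m (j+1)} - N. G x)"
      unfolding mostly_def[symmetric] by (rule stop[OF lt ends double light par[unfolded hv_def]])
    moreover have "emeasure lborel (J p) = ennreal (lo m (j+1) - lo m j)"
      using lt[of m j] by (simp add: J_def p)
    ultimately show ?thesis using \<eta> lt[of m j] by (auto simp: J_def p ennreal_mult)
  qed
  then obtain N where N: "\<And>p. p \<in> T \<Longrightarrow> N p \<in> sets lborel"
      "\<And>p. p \<in> T \<Longrightarrow> emeasure lborel (N p) \<le> ennreal \<eta> * emeasure lborel (J p)"
      "\<And>p x. p \<in> T \<Longrightarrow> x \<in> J p - N p \<Longrightarrow> G x"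
    by metis
  define M where "M = (\<Union>p\<in>T. N p \<inter> J p)"
  have Jm: "J p \<in> sets lborel" for p by (simp add: J_def)
  have cT: "countable T" by simp
  have disj': "disjoint_family_on (\<lambda>p. N p \<inter> J p) T"
    using disj unfolding disjoint_family_on_def by blast
  have "emeasure lborel M = (\<integral>\<^sup>+p. emeasure lborel (N p \<inter> J p) \<partial>count_space T)"
    unfolding M_def by (intro emeasure_UN_countable cT disj' sets.Int N(1) Jm)
  also have "\<dots> \<le> (\<integral>\<^sup>+p. ennreal \<eta> * emeasure lborel (J p) \<partial>count_space T)"
  proof (intro nn_integral_mono)
    fix p assume "p \<in> space (count_space T)"
    then have "p \<in> T" by simp
    then have "emeasure lborel (N p \<inter> J p) \<le> emeasure lborel (N p)"
      using N(1) by (intro emeasure_mono) auto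
    also have "\<dots> \<le> ennreal \<eta> * emeasure lborel (J p)" using N(2) \<open>p \<in> T\<close> by blast
    finally show "emeasure lborel (N p \<inter> J p) \<le> ennreal \<eta> * emeasure lborel (J p)" .
  qed
  also have "\<dots> = ennreal \<eta> * (\<integral>\<^sup>+p. emeasure lborel (J p) \<partial>count_space T)"
    by (intro nn_integral_cmult) auto
  also have "(\<integral>\<^sup>+p. emeasure lborel (J p) \<partial>count_space T) = emeasure lborel (\<Union>p\<in>T. J p)"
    by (intro emeasure_UN_countable[symmetric] cT disj Jm)
  finally have "emeasure lborel M \<le> ennreal \<eta> * emeasure lborel (\<Union>p\<in>T. J p)" .
  also have "\<dots> \<le> ennreal \<eta> * emeasure lborel {a..<b}"
    using sub_ab by (intro mult_left_mono emeasure_mono) auto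
  also have "\<dots> = ennreal (\<eta> * (b - a))" using ab \<eta> by (simp add: ennreal_mult)
  finally have "emeasure lborel M \<le> ennreal (\<eta> * (b - a))" .
  moreover have "M \<in> sets lborel"
    unfolding M_def using N(1) Jm by (intro sets.countable_UN'' cT) auto
  moreover have "G x" if x: "x \<in> {a..<b} - M" for x
  proof (cases "\<forall>m. hv m (ix x m)")
    case True
    show ?thesis
    proof (rule limit)
      fix \<delta> :: real assume \<delta>: "0 < \<delta>"
      obtain m where "(b - a) / \<delta> < 2 ^ m" using real_arch_pow[of 2] by auto
      then have "(b - a) / 2 ^ m < \<delta>" using \<delta> by (simp add: field_simps)
      moreover have "x \<in> J (m, ix x m)" by (simp add: mem)
      ultimately show "\<exists>c d. x \<in> {c..<d} \<and> d - c < \<delta> \<and> heavy c d"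
        using True len[of m "ix x m"]
        by (intro exI[of _ "lo m (ix x m)"] exI[of _ "lo m (ix x m + 1)"]) (auto simp: J_def hv_def)
    qed (use x in auto)
  next
    case False
    define m where "m = (LEAST m. \<not> hv m (ix x m))"
    have "\<not> hv m (ix x m)" unfolding m_def using False by (rule_tac LeastI_ex) auto
    moreover have below: "hv m' (ix x m')" if "m' < m" for m'
      using not_less_Least[of m'] that unfolding m_def by blast
    moreover have "hv m' (ix x m div 2 ^ (m - m'))" if "m' < m" for m'
      using below[OF that] that ix_div[of x m' "m - m'"] by (metis le_add_diff_inverse less_imp_le)
    ultimately have "(m, ix x m) \<in> T" using x unfolding T_def by auto
    moreover have "x \<in> J (m, ix x m)" by (simp add: mem)
    ultimately have "x \<notin> N (m, ix x m)" using x unfolding M_def by (metis (no_types) DiffD2 IntI UN_I)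
    then show ?thesis using N(3) \<open>(m, ix x m) \<in> T\<close> \<open>x \<in> J (m, ix x m)\<close> by blast
  qed
  ultimately show ?thesis unfolding mostly_def by blast
qed

text \<open>
  For fixed \<open>x\<close>, \<open>w\<close> assigns to each member of \<open>S\<close> its value at \<open>x\<close>. A chain \<open>F\<close> of members that are
  small, but not too small, protects the point: nothing comparable with the whole chain is below \<open>\<epsilon>\<close>.
\<close>

definition flag_protected :: "('s::order \<Rightarrow> real) \<Rightarrow> 's set \<Rightarrow> real \<Rightarrow> real \<Rightarrow> bool" where
  "flag_protected w S \<rho> \<epsilon> \<longleftrightarrow> (\<exists>F\<subseteq>S. finite F \<and> is_chain F \<and> (\<forall>s\<in>F. w s < \<rho>) \<and>
     (\<forall>s\<in>S. (\<forall>t\<in>F. comparable s t) \<longrightarrow> \<epsilon> \<le> w s))"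

lemma flag_protectedE:
  assumes "flag_protected w S \<rho> \<epsilon>"
  obtains F where "F \<subseteq> S" "finite F" "is_chain F" "\<And>s. s \<in> F \<Longrightarrow> w s < \<rho>"
    "\<And>s. s \<in> S \<Longrightarrow> (\<And>t. t \<in> F \<Longrightarrow> comparable s t) \<Longrightarrow> \<epsilon> \<le> w s"
proof -
  from assms obtain F where F: "F \<subseteq> S \<and> finite F \<and> is_chain F \<and> (\<forall>s\<in>F. w s < \<rho>) \<and>
     (\<forall>s\<in>S. (\<forall>t\<in>F. comparable s t) \<longrightarrow> \<epsilon> \<le> w s)"
    unfolding flag_protected_def ..
  show ?thesis by (rule that[of F]) (use F in simp_all)
qed

lemma flag_protectedI:
  assumes "F \<subseteq> S" "finite F" "is_chain F" "\<And>s. s \<in> F \<Longrightarrow> w s < \<rho>"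
    "\<And>s. s \<in> S \<Longrightarrow> (\<forall>t\<in>F. comparable s t) \<Longrightarrow> \<epsilon> \<le> w s"
  shows "flag_protected w S \<rho> \<epsilon>"
  unfolding flag_protected_def by (rule exI[of _ F]) (use assms in simp)

text \<open>
  Induction on the maximal length \<open>k\<close> of chains in \<open>S\<close>. Call an interval heavy if every member of \<open>S\<close>
  reaches \<open>\<rho>\<close> on it. On a first light interval some \<open>t\<close> stays below \<open>\<rho>\<close>, whereas every member
  still reaches \<open>\<rho>' = \<kappa> (1/4) * \<rho>\<close>, since it reached \<open>\<rho>\<close> on the parent interval, half of which
  is the light one. The members comparable with \<open>t\<close> other than \<open>t\<close> have shorter chains, so
  the induction hypothesis protects most points by a chain \<open>F\<close>, and \<open>t\<close> can be added to \<open>F\<close> once the few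
  points where \<open>t\<close> itself is tiny are discarded. Never stopped points are protected by the empty chain. The order
  of quantifiers matters: \<open>\<epsilon>\<close> does not depend on the family.
\<close>

theorem quantitative_nondivergence:
  fixes \<kappa> :: "real \<Rightarrow> real"
  assumes \<kappa>: "\<And>\<eta>. 0 < \<eta> \<Longrightarrow> 0 < \<kappa> \<eta> \<and> \<kappa> \<eta> \<le> 1" and "0 < \<rho>" "0 < \<eta>"
  shows "\<exists>\<epsilon>>0. \<forall>(S::'s::order set) \<psi> a b.
     a < b \<longrightarrow> (\<forall>s\<in>S. relatively_good \<kappa> (\<psi> s)) \<longrightarrow>
     (\<forall>F\<subseteq>S. finite F \<longrightarrow> is_chain F \<longrightarrow> card F \<le> k) \<longrightarrow>
     (\<forall>s\<in>S. \<exists>y\<in>{a..<b}. \<rho> \<le> \<psi> s y) \<longrightarrow>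
     mostly \<eta> a b (\<lambda>x. flag_protected (\<lambda>s. \<psi> s x) S \<rho> \<epsilon>)"
  using assms(2,3)
proof (induction k arbitrary: \<rho> \<eta>)
  case 0
  show ?case
  proof (intro exI[of _ 1] conjI allI impI)
    fix S :: "'s set" and \<psi> :: "'s \<Rightarrow> real \<Rightarrow> real" and a b :: real
    assume chains: "\<forall>F\<subseteq>S. finite F \<longrightarrow> is_chain F \<longrightarrow> card F \<le> 0"
    have "s \<notin> S" for s
    proof
      assume "s \<in> S"
      then have "{s} \<subseteq> S" "finite {s}" "is_chain {s}" by (auto simp: is_chain_def)
      then have "card {s} \<le> 0" using chains by metis
      then show False by simp
    qed
    then have "S = {}" by blast
    then have "flag_protected (\<lambda>s. \<psi> s x) S \<rho> 1" for x
      unfolding flag_protected_def is_chain_def by simp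
    then show "mostly \<eta> a b (\<lambda>x. flag_protected (\<lambda>s. \<psi> s x) S \<rho> 1)"
      unfolding mostly_def by (intro bexI[of _ "{}"]) auto
  qed simp
next
  case (Suc k)
  define \<rho>' where "\<rho>' = \<kappa> (1/4) * \<rho>"
  have \<rho>': "0 < \<rho>'" "\<rho>' \<le> \<rho>"
    using \<kappa>[of "1/4"] Suc.prems by (auto simp: \<rho>'_def mult_le_cancel_right1)
  have \<eta>2: "0 < \<eta> / 2" using Suc.prems by simp
  obtain \<epsilon>' where \<epsilon>': "\<epsilon>' > 0" and IH:
    "\<forall>(S::'s::order set) \<psi> a b.
     a < b \<longrightarrow> (\<forall>s\<in>S. relatively_good \<kappa> (\<psi> s)) \<longrightarrow>
     (\<forall>F\<subseteq>S. finite F \<longrightarrow> is_chain F \<longrightarrow> card F \<le> k) \<longrightarrow>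
     (\<forall>s\<in>S. \<exists>y\<in>{a..<b}. \<rho>' \<le> \<psi> s y) \<longrightarrow>
     mostly (\<eta>/2) a b (\<lambda>x. flag_protected (\<lambda>s. \<psi> s x) S \<rho>' \<epsilon>')"
    using Suc.IH[OF \<rho>'(1) \<eta>2] by (elim exE conjE)
  define \<epsilon> where "\<epsilon> = min \<rho> (min \<epsilon>' (\<kappa> (\<eta>/2) * \<rho>'))"
  have \<epsilon>: "0 < \<epsilon>" "\<epsilon> \<le> \<rho>" "\<epsilon> \<le> \<epsilon>'" "\<epsilon> \<le> \<kappa> (\<eta>/2) * \<rho>'"
    using \<kappa>[OF \<eta>2] \<rho>' \<epsilon>' Suc.prems by (auto simp: \<epsilon>_def)
  show ?case
  proof (intro exI[of _ \<epsilon>] conjI allI impI)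
    fix S :: "'s set" and \<psi> :: "'s \<Rightarrow> real \<Rightarrow> real" and a b :: real
    assume ab: "a < b" and good: "\<forall>s\<in>S. relatively_good \<kappa> (\<psi> s)"
      and chains: "\<forall>F\<subseteq>S. finite F \<longrightarrow> is_chain F \<longrightarrow> card F \<le> Suc k"
      and sup: "\<forall>s\<in>S. \<exists>y\<in>{a..<b}. \<rho> \<le> \<psi> s y"
    have goodD: "mostly \<zeta> c d (\<lambda>x. \<kappa> \<zeta> * \<psi> s y \<le> \<psi> s x)"
      if "s \<in> S" "c < d" "y \<in> {c..<d}" "0 < \<zeta>" for s c d y \<zeta>
      using good that unfolding relatively_good_def by blast
    show "mostly \<eta> a b (\<lambda>x. flag_protected (\<lambda>s. \<psi> s x) S \<rho> \<epsilon>)"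
    proof (rule stopping_time_cover[where heavy = "\<lambda>c d. \<forall>s\<in>S. \<exists>y\<in>{c..<d}. \<rho> \<le> \<psi> s y"])
      fix c d c' d' :: real
      assume cd: "c < d" "c' \<le> c" "d \<le> d'" "d' - c' = 2 * (d - c)"
        and light: "\<not> (\<forall>s\<in>S. \<exists>y\<in>{c..<d}. \<rho> \<le> \<psi> s y)"
        and parent: "\<forall>s\<in>S. \<exists>y\<in>{c'..<d'}. \<rho> \<le> \<psi> s y"
      have heavy': "\<exists>y\<in>{c..<d}. \<rho>' \<le> \<psi> s y" if s: "s \<in> S" for s
      proof -
        obtain y where y: "y \<in> {c'..<d'}" "\<rho> \<le> \<psi> s y" using parent s by blast
        have "mostly (1/4) c' d' (\<lambda>x. \<kappa> (1/4) * \<psi> s y \<le> \<psi> s x)"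
          using goodD[OF s _ y(1), of "1/4"] cd by linarith
        then have "\<exists>x\<in>{c..<d}. \<kappa> (1/4) * \<psi> s y \<le> \<psi> s x"
          by (rule mostly_ex) (use cd in simp_all)
        then obtain x where x: "x \<in> {c..<d}" "\<kappa> (1/4) * \<psi> s y \<le> \<psi> s x" by blast
        moreover have "\<rho>' \<le> \<kappa> (1/4) * \<psi> s y"
          unfolding \<rho>'_def using y(2) \<kappa>[of "1/4"] by (intro mult_left_mono) auto
        ultimately show ?thesis using x by force
      qed
      obtain t where t: "t \<in> S" "\<And>y. y \<in> {c..<d} \<Longrightarrow> \<psi> t y < \<rho>"
        using light by force
      define S' where "S' = {s \<in> S. comparable s t \<and> s \<noteq> t}"
      have chains': "card F \<le> k" if F: "F \<subseteq> S'" "finite F" "is_chain F" for F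
      proof -
        have "is_chain (insert t F)" using F unfolding is_chain_def S'_def by blast
        moreover have "insert t F \<subseteq> S" "t \<notin> F" using F(1) t(1) unfolding S'_def by blast+
        ultimately have "card (insert t F) \<le> Suc k" using chains F(2) by (meson finite_insert)
        then show ?thesis using \<open>t \<notin> F\<close> F(2) by simp
      qed
      have "S' \<subseteq> S" unfolding S'_def by blast
      then have "mostly (\<eta>/2) c d (\<lambda>x. flag_protected (\<lambda>s. \<psi> s x) S' \<rho>' \<epsilon>')"
        using good heavy' chains' cd(1) by (intro IH[rule_format]) blast+
      then obtain N1 where N1: "N1 \<in> sets lborel" "emeasure lborel N1 \<le> ennreal (\<eta>/2 * (d - c))"
       "\<forall>x\<in>{c..<d} - N1. flag_protected (\<lambda>s. \<psi> s x) S' \<rho>' \<epsilon>'"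
        unfolding mostly_def by blast
      obtain y where y: "y \<in> {c..<d}" "\<rho>' \<le> \<psi> t y" using heavy' t(1) by blast
      obtain N2 where N2: "N2 \<in> sets lborel" "emeasure lborel N2 \<le> ennreal (\<eta>/2 * (d - c))"
        "\<forall>x\<in>{c..<d} - N2. \<kappa> (\<eta>/2) * \<psi> t y \<le> \<psi> t x"
        using goodD[OF t(1) cd(1) y(1) \<eta>2] unfolding mostly_def by blast
      have "emeasure lborel (N1 \<union> N2) \<le> emeasure lborel N1 + emeasure lborel N2"
        using N1(1) N2(1) by (rule emeasure_subadditive)
      also have "\<dots> \<le> ennreal (\<eta>/2 * (d - c)) + ennreal (\<eta>/2 * (d - c))"
        using N1(2) N2(2) by (rule add_mono)
      also have "\<dots> = ennreal (\<eta> * (d - c))"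
        using cd Suc.prems by (subst ennreal_plus[symmetric]) (auto simp: field_simps)
      finally have "emeasure lborel (N1 \<union> N2) \<le> ennreal (\<eta> * (d - c))" .
      moreover have "flag_protected (\<lambda>s. \<psi> s x) S \<rho> \<epsilon>"
        if x: "x \<in> {c..<d} - (N1 \<union> N2)" for x
      proof -
        have "flag_protected (\<lambda>s. \<psi> s x) S' \<rho>' \<epsilon>'" using N1(3) x by simp
        then obtain F where F: "F \<subseteq> S'" "finite F" "is_chain F" "\<And>s. s \<in> F \<Longrightarrow> \<psi> s x < \<rho>'"
          "\<And>s. s \<in> S' \<Longrightarrow> (\<And>t. t \<in> F \<Longrightarrow> comparable s t) \<Longrightarrow> \<epsilon>' \<le> \<psi> s x"
          by (rule flag_protectedE) blast
        have "\<epsilon> \<le> \<psi> s x" if s: "s \<in> S" "\<forall>u\<in>insert t F. comparable s u" for s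
        proof (cases "s = t")
          case True
          have "\<epsilon> \<le> \<kappa> (\<eta>/2) * \<psi> t y"
            using \<epsilon>(4) y(2) \<kappa>[OF \<eta>2] by (meson mult_left_mono less_imp_le order_trans)
          also have "\<dots> \<le> \<psi> t x" using N2(3) x by auto
          finally show ?thesis using True by simp
        next
          case False
          then have "s \<in> S'" using s by (simp add: S'_def)
          then have "\<epsilon>' \<le> \<psi> s x" using F(5) s(2) by blast
          then show ?thesis using \<epsilon>(3) by (rule order_trans[rotated])
        qed
        moreover have "is_chain (insert t F)" using F(1,3) unfolding is_chain_def S'_def by blast
        moreover have "insert t F \<subseteq> S" "finite (insert t F)"
          using F(1,2) t(1) unfolding S'_def by blast+
        moreover have "\<psi> s x < \<rho>" if "s \<in> insert t F" for s
          using F(4)[of s] \<rho>'(2) t(2)[of x] x that by auto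
        ultimately show ?thesis by (intro flag_protectedI[of "insert t F"])
      qed
      ultimately show "mostly \<eta> c d (\<lambda>x. flag_protected (\<lambda>s. \<psi> s x) S \<rho> \<epsilon>)"
        using N1(1) N2(1) unfolding mostly_def by blast
    next
      fix x assume x: "x \<in> {a..<b}"
        and small: "\<And>\<delta>. 0 < \<delta> \<Longrightarrow> \<exists>c d. x \<in> {c..<d} \<and> d - c < \<delta> \<and> (\<forall>s\<in>S. \<exists>y\<in>{c..<d}. \<rho> \<le> \<psi> s y)"
      have "\<rho> \<le> \<psi> s x" if s: "s \<in> S" for s
      proof (rule ccontr)
        assume "\<not> \<rho> \<le> \<psi> s x"
        then have gap: "0 < \<rho> - \<psi> s x" by simp
        have "continuous_on UNIV (\<psi> s)" using good s unfolding relatively_good_def by blast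
        then obtain \<delta> where \<delta>: "\<delta> > 0" "\<And>y. dist y x < \<delta> \<Longrightarrow> dist (\<psi> s y) (\<psi> s x) < \<rho> - \<psi> s x"
          using gap unfolding continuous_on_iff by (metis UNIV_I)
        obtain c d y where cdy: "x \<in> {c..<d}" "d - c < \<delta>" "y \<in> {c..<d}" "\<rho> \<le> \<psi> s y"
          using small[OF \<delta>(1)] s by blast
        then have "\<bar>y - x\<bar> < \<delta>" by auto
        then show False using \<delta>(2)[of y] cdy(4) by (simp add: dist_real_def)
      qed
      then have "\<epsilon> \<le> \<psi> s x" if "s \<in> S" for s using \<epsilon>(2) that by (meson order_trans)
      then show "flag_protected (\<lambda>s. \<psi> s x) S \<rho> \<epsilon>"
        by (intro flag_protectedI[of "{}"]) (simp_all add: is_chain_def)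
    qed (use ab sup Suc.prems in auto)
  qed (rule \<epsilon>(1))
qed


section \<open>Taylor coefficients of polynomials\<close>

abbreviation real_poly :: "int poly \<Rightarrow> real poly" where
  "real_poly \<equiv> map_poly real_of_int"

definition taylor_coeff :: "real poly \<Rightarrow> real \<Rightarrow> nat \<Rightarrow> real" where
  "taylor_coeff p x i = coeff (pcompose p [:x, 1:]) i"

lemma taylor_coeff_add: "taylor_coeff (p + q) x i = taylor_coeff p x i + taylor_coeff q x i"
  and taylor_coeff_diff: "taylor_coeff (p - q) x i = taylor_coeff p x i - taylor_coeff q x i"
  and taylor_coeff_smult: "taylor_coeff (smult c p) x i = c * taylor_coeff p x i"
  and taylor_coeff_sum: "taylor_coeff (sum f A) x i = (\<Sum>a\<in>A. taylor_coeff (f a) x i)"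
  and taylor_coeff_0 [simp]: "taylor_coeff 0 x i = 0"
  by (simp_all add: taylor_coeff_def pcompose_add pcompose_diff pcompose_smult pcompose_sum coeff_sum)

lemma poly_eq_sum_atMost:
  fixes p :: "'a::comm_semiring_1 poly"
  assumes "degree p \<le> m" shows "poly p x = (\<Sum>j\<le>m. coeff p j * x ^ j)"
proof -
  have "(\<Sum>j\<le>degree p. coeff p j * x ^ j) = (\<Sum>j\<le>m. coeff p j * x ^ j)"
    using assms by (intro sum.mono_neutral_left) (auto simp: coeff_eq_0)
  then show ?thesis by (simp add: poly_altdef)
qed

lemma taylor_coeff_eq:
  assumes "degree p \<le> m"
  shows "taylor_coeff p x i = (\<Sum>j\<le>m. coeff p j * (real (j choose i) * x ^ (j - i)))"
proof -
  let ?q = "map_poly (\<lambda>c. [:c:]) p"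
  have "degree ?q \<le> m" using assms by (simp add: degree_map_poly)
  then have "pcompose p [:x, 1:] = (\<Sum>j\<le>m. [:coeff p j:] * [:x, 1:] ^ j)"
    unfolding pcompose_altdef by (subst poly_eq_sum_atMost) (simp_all add: coeff_map_poly)
  moreover have "coeff ([:x, 1:] ^ j) i = real (j choose i) * x ^ (j - i)" for j
  proof (cases "i \<le> j")
    case False
    then have "degree ([:x, 1:] ^ j) < i" by (simp add: degree_linear_power)
    then show ?thesis using False by (simp add: coeff_eq_0)
  qed (simp add: coeff_linear_poly_power)
  ultimately show ?thesis by (simp add: taylor_coeff_def coeff_sum)
qed

lemma degree_pcompose_shift [simp]: "degree (pcompose p [:x::real, 1:]) = degree p"
  by (simp add: degree_pcompose)

lemma poly_taylor:
  assumes "degree p \<le> m"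
  shows "poly p (x + y) = (\<Sum>i\<le>m. taylor_coeff p x i * y ^ i)"
proof -
  have "poly p (x + y) = poly (pcompose p [:x, 1:]) y" by (simp add: poly_pcompose)
  also have "\<dots> = (\<Sum>i\<le>m. taylor_coeff p x i * y ^ i)"
    unfolding taylor_coeff_def using assms by (intro poly_eq_sum_atMost) simp
  finally show ?thesis .
qed

lemma coeff_eq_taylor:
  assumes "degree p \<le> m"
  shows "coeff p j = (\<Sum>i\<le>m. taylor_coeff p x i * (real (i choose j) * (- x) ^ (i - j)))"
proof -
  have "coeff p j = taylor_coeff (pcompose p [:x, 1:]) (- x) j"
    by (simp add: taylor_coeff_def pcompose_assoc[symmetric] pcompose_pCons)
  also have "\<dots> = (\<Sum>i\<le>m. taylor_coeff p x i * (real (i choose j) * (- x) ^ (i - j)))"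
    using assms by (subst taylor_coeff_eq[of _ m]) (simp_all add: taylor_coeff_def)
  finally show ?thesis .
qed

abbreviation int_taylor :: "int poly \<Rightarrow> real \<Rightarrow> nat \<Rightarrow> real" where
  "int_taylor P \<equiv> taylor_coeff (real_poly P)"

text \<open>
  The Hasse derivative, that is the \<open>i\<close>-th derivative divided by \<open>i!\<close>: its values are the \<open>i\<close>-th Taylor
  coefficients, and it keeps integer coefficients.
\<close>

definition hasse :: "nat \<Rightarrow> int poly \<Rightarrow> int poly" where
  "hasse i p = (\<Sum>j\<le>degree p. monom (coeff p j * int (j choose i)) (j - i))"

lemma degree_hasse_le: "degree (hasse i p) \<le> degree p"
  unfolding hasse_def
  by (intro degree_sum_le) (auto intro: order_trans[OF degree_monom_le])

lemma real_poly_0 [simp]: "real_poly 0 = 0"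
  and real_poly_add: "real_poly (p + q) = real_poly p + real_poly q"
  and real_poly_diff: "real_poly (p - q) = real_poly p - real_poly q"
  and real_poly_smult: "real_poly (smult c p) = smult (of_int c) (real_poly p)"
  and real_poly_mult: "real_poly (p * q) = real_poly p * real_poly q"
  by (auto intro!: poly_eqI simp: coeff_map_poly coeff_mult)

lemma real_poly_sum: "real_poly (sum f A) = (\<Sum>a\<in>A. real_poly (f a))"
  by (induction A rule: infinite_finite_induct) (auto simp: real_poly_add)

lemma degree_real_poly [simp]: "degree (real_poly p) = degree p"
  by (simp add: degree_map_poly)

lemma coeff_real_poly [simp]: "coeff (real_poly p) i = of_int (coeff p i)"
  by (simp add: coeff_map_poly)

lemma real_poly_eq_0_iff [simp]: "real_poly p = 0 \<longleftrightarrow> p = 0"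
  by (simp add: map_poly_eq_0_iff)

lemma real_poly_eq_iff [simp]: "real_poly p = real_poly q \<longleftrightarrow> p = q"
  by (metis real_poly_diff real_poly_eq_0_iff right_minus_eq)

lemma poly_hasse: "poly (real_poly (hasse i p)) x = int_taylor p x i"
proof -
  have "real_poly (monom c k) = monom (of_int c) k" for c k
    by (rule poly_eqI) auto
  then show ?thesis
    by (simp add: hasse_def real_poly_sum poly_sum poly_monom taylor_coeff_eq[OF order_refl] mult.assoc)
qed

lemma eval_int_poly_hom: "comm_ring_hom (\<lambda>q::int poly. poly (real_poly q) x)"
  by unfold_locales (simp_all add: real_poly_add real_poly_mult map_poly_1)

section \<open>Minors of Taylor coefficients\<close>

text \<open>
  Rows are Taylor coefficients with indices listed in \<open>r\<close>, columns are polynomials. The minors are the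
  coordinates of the wedge product of the polynomials, seen from the point \<open>x\<close>.
\<close>

definition taylor_mat :: "nat list \<Rightarrow> real poly list \<Rightarrow> real \<Rightarrow> real mat" where
  "taylor_mat r ps x = mat (length ps) (length ps) (\<lambda>(a, b). taylor_coeff (ps ! b) x (r ! a))"

definition taylor_minor :: "nat list \<Rightarrow> real poly list \<Rightarrow> real \<Rightarrow> real" where
  "taylor_minor r ps x = det (taylor_mat r ps x)"

abbreviation int_minor :: "nat list \<Rightarrow> int poly list \<Rightarrow> real \<Rightarrow> real" where
  "int_minor r ps \<equiv> taylor_minor r (map real_poly ps)"

lemma taylor_mat_carrier [simp]: "taylor_mat r ps x \<in> carrier_mat (length ps) (length ps)"
  by (simp add: taylor_mat_def)

lemma taylor_minor_int_poly:
  assumes "\<And>p. p \<in> set ps \<Longrightarrow> degree p \<le> n"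
  shows "\<exists>q. degree q \<le> n * length ps \<and> (\<forall>x. int_minor r ps x = poly (real_poly q) x)"
proof -
  let ?k = "length ps"
  define A where "A = mat ?k ?k (\<lambda>(a, b). hasse (r ! a) (ps ! b))"
  have A: "A \<in> carrier_mat ?k ?k" by (simp add: A_def)
  have "degree (det A) \<le> n * ?k"
    using A assms by (intro degree_det_le) (auto simp: A_def intro: order_trans[OF degree_hasse_le])
  moreover have "int_minor r ps x = poly (real_poly (det A)) x" for x
  proof -
    interpret comm_ring_hom "\<lambda>q::int poly. poly (real_poly q) x" by (rule eval_int_poly_hom)
    have "taylor_mat r (map real_poly ps) x = map_mat (\<lambda>q. poly (real_poly q) x) A"
      by (rule eq_matI) (auto simp: taylor_mat_def A_def poly_hasse)
    then show ?thesis by (simp add: taylor_minor_def)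
  qed
  ultimately show ?thesis by blast
qed

lemma taylor_minor_change_basis:
  assumes len: "length qs = length ps"
    and qs: "\<And>b. b < length ps \<Longrightarrow> qs ! b = (\<Sum>a<length ps. smult (A $$ (a, b)) (ps ! a))"
    and A: "A \<in> carrier_mat (length ps) (length ps)"
  shows "taylor_minor r qs x = taylor_minor r ps x * det A"
proof -
  have "taylor_mat r qs x = taylor_mat r ps x * A"
  proof (rule eq_matI)
    fix i j assume "i < dim_row (taylor_mat r ps x * A)" "j < dim_col (taylor_mat r ps x * A)"
    then have ij: "i < length ps" "j < length ps" using A by (auto simp: taylor_mat_def)
    have "taylor_mat r qs x $$ (i, j) = taylor_coeff (qs ! j) x (r ! i)"
      using ij len by (simp add: taylor_mat_def)
    also have "\<dots> = (\<Sum>a<length ps. A $$ (a, j) * taylor_coeff (ps ! a) x (r ! i))"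
      using ij by (simp add: qs taylor_coeff_sum taylor_coeff_smult)
    also have "\<dots> = (taylor_mat r ps x * A) $$ (i, j)"
      using ij A by (auto simp: taylor_mat_def scalar_prod_def mult.commute lessThan_atLeast0 intro!: sum.cong)
    finally show "taylor_mat r qs x $$ (i, j) = (taylor_mat r ps x * A) $$ (i, j)" .
  qed (use A len in \<open>auto simp: taylor_mat_def\<close>)
  then show ?thesis
    unfolding taylor_minor_def using det_mult[OF taylor_mat_carrier A] by simp
qed

definition drop_nth :: "nat \<Rightarrow> 'a list \<Rightarrow> 'a list" where
  "drop_nth a r = take a r @ drop (Suc a) r"

lemma length_drop_nth [simp]: "a < length r \<Longrightarrow> length (drop_nth a r) = length r - 1"
  by (simp add: drop_nth_def)

lemma set_drop_nth_subset: "set (drop_nth a r) \<subseteq> set r"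
  by (auto simp: drop_nth_def dest: in_set_takeD in_set_dropD)

lemma nth_drop_nth:
  "a < length r \<Longrightarrow> i < length r - 1 \<Longrightarrow> drop_nth a r ! i = r ! (if i < a then i else Suc i)"
  by (auto simp: drop_nth_def nth_append)

text \<open>
  Laplace expansion along the last column, which belongs to the new polynomial.
\<close>

lemma taylor_minor_snoc_le:
  assumes r: "length r = Suc (length ps)"
  shows "\<bar>taylor_minor r (ps @ [v]) x\<bar> \<le>
    (\<Sum>a<length r. \<bar>taylor_coeff v x (r ! a)\<bar> * \<bar>taylor_minor (drop_nth a r) ps x\<bar>)"
proof -
  let ?k = "length ps"
  let ?M = "taylor_mat r (ps @ [v]) x"
  have M: "?M \<in> carrier_mat (Suc ?k) (Suc ?k)" by (simp add: taylor_mat_def)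
  have del: "mat_delete ?M a ?k = taylor_mat (drop_nth a r) ps x" if a: "a < Suc ?k" for a
    using that r by (intro eq_matI) (auto simp: mat_delete_def taylor_mat_def nth_drop_nth nth_append)
  have ent: "?M $$ (a, ?k) = taylor_coeff v x (r ! a)" if "a < Suc ?k" for a
    using that by (simp add: taylor_mat_def)
  have "taylor_minor r (ps @ [v]) x = (\<Sum>a<Suc ?k. ?M $$ (a, ?k) * cofactor ?M a ?k)"
    unfolding taylor_minor_def by (rule laplace_expansion_column[OF M]) simp
  also have "\<dots> = (\<Sum>a<length r. taylor_coeff v x (r ! a) *
      ((-1) ^ (a + ?k) * taylor_minor (drop_nth a r) ps x))"
    using r by (intro sum.cong) (simp_all add: cofactor_def del ent taylor_minor_def)
  also have "\<bar>\<dots>\<bar> \<le> (\<Sum>a<length r. \<bar>taylor_coeff v x (r ! a) *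
      ((-1) ^ (a + ?k) * taylor_minor (drop_nth a r) ps x)\<bar>)"
    by (rule sum_abs)
  also have "\<dots> = (\<Sum>a<length r. \<bar>taylor_coeff v x (r ! a)\<bar> * \<bar>taylor_minor (drop_nth a r) ps x\<bar>)"
    by (simp add: abs_mult power_abs)
  finally show ?thesis .
qed

unbundle no vec_syntax
no_notation fps_nth (infixl "$" 75)

section \<open>Wronskians of independent polynomials do not vanish\<close>

interpretation rp: vector_space "smult :: real \<Rightarrow> real poly \<Rightarrow> real poly"
  by unfold_locales (simp_all add: smult_add_right smult_add_left)

lemma span_list_iff:
  assumes "distinct ps"
  shows "v \<in> rp.span (set ps) \<longleftrightarrow> (\<exists>c. v = (\<Sum>a<length ps. smult (c a) (ps ! a)))"
proof
  assume "v \<in> rp.span (set ps)"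
  then obtain u where "v = (\<Sum>p\<in>set ps. smult (u p) p)"
    by (auto simp: rp.span_finite)
  also have "\<dots> = (\<Sum>a<length ps. smult (u (ps ! a)) (ps ! a))"
    by (rule sum.reindex_bij_betw[OF bij_betw_nth, symmetric]) (use assms in auto)
  finally show "\<exists>c. v = (\<Sum>a<length ps. smult (c a) (ps ! a))"
    by (intro exI[of _ "\<lambda>a. u (ps ! a)"])
next
  assume "\<exists>c. v = (\<Sum>a<length ps. smult (c a) (ps ! a))"
  then obtain c where "v = (\<Sum>a<length ps. smult (c a) (ps ! a))" ..
  then show "v \<in> rp.span (set ps)"
    by (simp only:) (intro rp.span_sum rp.span_scale rp.span_base nth_mem, simp)
qed

lemma change_of_basis_matrix:
  assumes "distinct ps" "length qs = length ps" "set qs \<subseteq> rp.span (set ps)"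
  obtains A where "A \<in> carrier_mat (length ps) (length ps)"
    "\<And>b. b < length ps \<Longrightarrow> qs ! b = (\<Sum>a<length ps. smult (A $$ (a, b)) (ps ! a))"
proof -
  have "\<exists>c. qs ! b = (\<Sum>a<length ps. smult (c a) (ps ! a))" if "b < length ps" for b
    using that assms nth_mem[of b qs] by (subst span_list_iff[symmetric]) auto
  then obtain c where c: "\<And>b. b < length ps \<Longrightarrow> qs ! b = (\<Sum>a<length ps. smult (c b a) (ps ! a))"
    by metis
  show ?thesis
    by (rule that[of "mat (length ps) (length ps) (\<lambda>(a, b). c b a)"]) (auto simp: c)
qed

text \<open>
  One polynomial of each occurring degree suffices to span, by cancelling leading terms. Hence a
  space of polynomials contains as many different degrees as its dimension.
\<close>

lemma card_degrees_ge:
  assumes B: "finite B" "rp.independent B" and bound: "\<And>p. p \<in> B \<Longrightarrow> degree p \<le> n"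
  shows "card B \<le> card (degree ` (rp.span B - {0}))" "finite (degree ` (rp.span B - {0}))"
proof -
  let ?V = "rp.span B" let ?D = "degree ` (rp.span B - {0})"
  have deg: "degree p \<le> n" if "p \<in> ?V" for p
    using that
  proof (induction rule: rp.span_induct_alt)
    case (step c x y)
    then show ?case using bound[of x]
      by (intro degree_add_le order_trans[OF degree_smult_le])
  qed simp
  have "?D \<subseteq> {..n}" using deg by (simp add: image_subset_iff)
  then show fin: "finite ?D" by (rule finite_subset) simp
  have "\<forall>d\<in>?D. \<exists>p. p \<in> ?V \<and> p \<noteq> 0 \<and> degree p = d" by auto
  then obtain q where q: "\<And>d. d \<in> ?D \<Longrightarrow> q d \<in> ?V \<and> q d \<noteq> 0 \<and> degree (q d) = d" by metis
  have "p \<in> rp.span (q ` ?D)" if "p \<in> ?V" for p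
    using that
  proof (induction "degree p" arbitrary: p rule: less_induct)
    case less
    show ?case
    proof (cases "p = 0")
      case True then show ?thesis by (simp add: rp.span_zero)
    next
      case False
      define d where "d = degree p"
      have dD: "d \<in> ?D" using False less.prems by (auto simp: d_def)
      define c where "c = coeff p d / coeff (q d) d"
      have "coeff (q d) d \<noteq> 0" using q[OF dD] by (metis leading_coeff_0_iff)
      let ?r = "p - smult c (q d)"
      have rV: "?r \<in> ?V" using less.prems q[OF dD] by (intro rp.span_diff rp.span_scale) auto
      have coeffd: "coeff ?r d = 0" using \<open>coeff (q d) d \<noteq> 0\<close> by (simp add: c_def)
      have degr: "degree ?r \<le> d"
        using q[OF dD] by (intro degree_diff_le order_trans[OF degree_smult_le]) (auto simp: d_def)
      have "?r \<in> rp.span (q ` ?D)"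
      proof (cases "?r = 0")
        case True then show ?thesis by (simp only: rp.span_zero)
      next
        case False
        then have "degree ?r < d" using degr coeffd by (metis le_neq_implies_less leading_coeff_0_iff)
        then show ?thesis using less.hyps[of ?r] rV by (simp add: d_def)
      qed
      moreover have "smult c (q d) \<in> rp.span (q ` ?D)"
        using dD by (intro rp.span_scale rp.span_base) auto
      ultimately have "?r + smult c (q d) \<in> rp.span (q ` ?D)" by (rule rp.span_add)
      then show ?thesis by simp
    qed
  qed
  then have "B \<subseteq> rp.span (q ` ?D)" using rp.span_base by blast
  then have "card B \<le> card (q ` ?D)"
    using rp.independent_span_bound[of "q ` ?D" B] B fin by simp
  also have "\<dots> \<le> card ?D" using fin by (rule card_image_le)
  finally show "card B \<le> card ?D" .
qed

lemma taylor_coeff_tendsto: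
  assumes "degree p = d"
  shows "((\<lambda>x. taylor_coeff p x i * x ^ i / x ^ d) \<longlongrightarrow> lead_coeff p * real (d choose i)) at_top"
proof -
  have "((\<lambda>x::real. coeff p j * (real (j choose i) * x ^ (j - i)) * x ^ i / x ^ d)
      \<longlongrightarrow> (if j = d then coeff p j * real (j choose i) else 0)) at_top" if "j \<le> d" for j
  proof -
    have eq: "\<forall>\<^sub>F x::real in at_top. coeff p j * real (j choose i) * (1 / x ^ (d - j)) =
      coeff p j * (real (j choose i) * x ^ (j - i)) * x ^ i / x ^ d"
      using eventually_gt_at_top[of 0]
    proof eventually_elim
      case (elim x)
      have "x ^ d = x ^ (d - j) * x ^ j" using that by (simp flip: power_add)
      moreover have "x ^ (j - i) * x ^ i = x ^ j" if "i \<le> j" using that by (simp flip: power_add)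
      ultimately show ?case using elim by (cases "i \<le> j") (auto simp: field_simps binomial_eq_0)
    qed
    have "((\<lambda>x::real. 1 / x ^ (d - j)) \<longlongrightarrow> (if j = d then 1 else 0)) at_top"
    proof (cases "j = d")
      case False
      then have "0 < d - j" using that by simp
      then have "filterlim (\<lambda>x::real. x ^ (d - j)) at_infinity at_top"
        by (intro filterlim_at_top_imp_at_infinity filterlim_pow_at_top filterlim_ident)
      then show ?thesis using False by (auto intro!: tendsto_divide_0 tendsto_const)
    qed simp
    then have "((\<lambda>x::real. coeff p j * real (j choose i) * (1 / x ^ (d - j))) \<longlongrightarrow>
       coeff p j * real (j choose i) * (if j = d then 1 else 0)) at_top"
      by (intro tendsto_mult tendsto_const)
    then show ?thesis using eq by (subst tendsto_cong[OF eq, symmetric]) (auto split: if_splits)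
  qed
  then have "((\<lambda>x::real. \<Sum>j\<le>d. coeff p j * (real (j choose i) * x ^ (j - i)) * x ^ i / x ^ d)
      \<longlongrightarrow> (\<Sum>j\<le>d. if j = d then coeff p j * real (j choose i) else 0)) at_top"
    by (intro tendsto_sum) auto
  then show ?thesis
    using assms by (simp add: taylor_coeff_eq[OF order_refl] sum_distrib_right sum_divide_distrib)
qed

text \<open>
  A linear relation between the rows is a polynomial \<open>f\<close> of degree below \<open>k\<close>, written in the binomial basis,
  that vanishes at the \<open>k\<close> distinct numbers \<open>d b\<close>; so it is zero, and its values at \<open>0, 1, 2, ...\<close> show one
  after another that all coefficients of the relation vanish.
\<close>

lemma det_binomial_nonzero:
  fixes d :: "nat \<Rightarrow> nat" and l :: "nat \<Rightarrow> real"
  assumes inj: "inj_on d {..<k}" and l: "\<And>b. b < k \<Longrightarrow> l b \<noteq> 0"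
  shows "det (mat k k (\<lambda>(a, b). l b * real (d b choose a))) \<noteq> 0"
proof
  let ?M = "mat k k (\<lambda>(a, b). l b * real (d b choose a))"
  have M: "?M \<in> carrier_mat k k" by simp
  assume "det ?M = 0"
  then have "det (transpose_mat ?M) = 0" by (simp add: det_transpose[OF M])
  then obtain v where v: "v \<in> carrier_vec k" "v \<noteq> 0\<^sub>v k" "transpose_mat ?M *\<^sub>v v = 0\<^sub>v k"
    using det_0_iff_vec_prod_zero_field[of "transpose_mat ?M" k] by auto
  define f where "f = (\<Sum>a<k. smult (v $ a / fact a) (\<Prod>j<a. [:- real j, 1:]))"
  have f_nat: "poly f (real m) = (\<Sum>a<k. v $ a * real (m choose a))" for m
  proof -
    have "real (m choose a) = (\<Prod>j<a. real m - real j) / fact a" for a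
      by (simp add: binomial_gbinomial gbinomial_prod_rev lessThan_atLeast0)
    then show ?thesis by (simp add: f_def poly_sum poly_prod)
  qed
  have root: "poly f (real (d b)) = 0" if b: "b < k" for b
  proof -
    have "(transpose_mat ?M *\<^sub>v v) $ b = (\<Sum>a<k. l b * real (d b choose a) * v $ a)"
      using b v(1) by (auto simp: scalar_prod_def lessThan_atLeast0 intro!: sum.cong)
    also have "\<dots> = l b * poly f (real (d b))" by (simp add: f_nat sum_distrib_left mult_ac)
    finally show ?thesis using v(3) l[OF b] b by simp
  qed
  have "f = 0"
  proof (rule ccontr)
    assume f: "f \<noteq> 0"
    then have "k > 0" by (cases "k = 0") (auto simp: f_def)
    have "degree f \<le> k - 1" unfolding f_def
    proof (rule degree_sum_le)
      fix a assume a: "a \<in> {..<k}"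
      have "degree (\<Prod>j<a. [:- real j, 1:]) \<le> (\<Sum>j<a. degree [:- real j, 1:])"
        by (rule degree_prod_sum_le[unfolded o_def]) simp
      then show "degree (smult (v $ a / fact a) (\<Prod>j<a. [:- real j, 1:])) \<le> k - 1"
        using a by (intro order_trans[OF degree_smult_le]) simp
    qed simp
    moreover have "(\<lambda>b. real (d b)) ` {..<k} \<subseteq> {x. poly f x = 0}" using root by auto
    then have "card ((\<lambda>b. real (d b)) ` {..<k}) \<le> card {x. poly f x = 0}"
      using f by (intro card_mono poly_roots_finite)
    moreover have "card ((\<lambda>b. real (d b)) ` {..<k}) = k"
      using inj by (subst card_image) (auto simp: inj_on_def)
    ultimately show False using card_poly_roots_bound[OF f] \<open>k > 0\<close> by linarith
  qed
  have "v $ m = 0" if "m < k" for m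
    using that
  proof (induction m rule: less_induct)
    case (less m)
    have "0 = (\<Sum>a<k. v $ a * real (m choose a))" using f_nat[of m] \<open>f = 0\<close> by simp
    also have "\<dots> = (\<Sum>a<k. if a = m then v $ m else 0)"
      using less by (intro sum.cong) (auto simp: binomial_eq_0 not_less_iff_gr_or_eq)
    also have "\<dots> = v $ m" using less.prems by simp
    finally show ?case by simp
  qed
  then have "v = 0\<^sub>v k" using v(1) by (intro eq_vecI) auto
  then show False using v(2) by simp
qed

text \<open>
  As \<open>x\<close> tends to infinity, the Wronskian divided by the expected power of \<open>x\<close> (this is \<open>1 / g x\<close>) tends to the
  determinant formed by the leading terms, which is a binomial determinant.
\<close>

lemma wronskian_nonzero_distinct_degrees:
  assumes "distinct (map degree qs)" "\<And>q. q \<in> set qs \<Longrightarrow> q \<noteq> 0"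
  shows "\<exists>x. taylor_minor [0..<length qs] qs x \<noteq> 0"
proof -
  let ?k = "length qs"
  let ?L = "mat ?k ?k (\<lambda>(a, b). lead_coeff (qs ! b) * real (degree (qs ! b) choose a))"
  define g where "g = (\<lambda>x::real. x ^ (\<Sum>i<?k. i) / x ^ (\<Sum>b<?k. degree (qs ! b)))"
  have "inj_on (\<lambda>b. degree (qs ! b)) {..<?k}"
    using assms(1) by (auto simp: inj_on_def distinct_conv_nth)
  then have nz: "det ?L \<noteq> 0"
    by (rule det_binomial_nonzero) (use assms(2) in auto)
  have term_eq: "(\<Prod>i = 0..<?k. taylor_coeff (qs ! \<pi> i) x i * x ^ i / x ^ degree (qs ! \<pi> i)) =
      (\<Prod>i = 0..<?k. taylor_coeff (qs ! \<pi> i) x i) * g x" if \<pi>: "\<pi> permutes {0..<?k}" for \<pi> x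
  proof -
    have "(\<Prod>i = 0..<?k. x ^ degree (qs ! \<pi> i)) = (\<Prod>i = 0..<?k. x ^ degree (qs ! i))"
      by (rule prod.permute[OF \<pi>, symmetric, unfolded o_def])
    then show ?thesis
      by (simp add: prod.distrib prod_dividef g_def power_sum lessThan_atLeast0)
  qed
  have "((\<lambda>x. \<Sum>\<pi>\<in>{\<pi>. \<pi> permutes {0..<?k}}. signof \<pi> *
        (\<Prod>i = 0..<?k. taylor_coeff (qs ! \<pi> i) x i * x ^ i / x ^ degree (qs ! \<pi> i)))
      \<longlongrightarrow> (\<Sum>\<pi>\<in>{\<pi>. \<pi> permutes {0..<?k}}. signof \<pi> *
        (\<Prod>i = 0..<?k. lead_coeff (qs ! \<pi> i) * real (degree (qs ! \<pi> i) choose i)))) at_top"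
    by (intro tendsto_sum tendsto_mult tendsto_const tendsto_prod taylor_coeff_tendsto refl)
  also have "(\<Sum>\<pi>\<in>{\<pi>. \<pi> permutes {0..<?k}}. signof \<pi> *
        (\<Prod>i = 0..<?k. lead_coeff (qs ! \<pi> i) * real (degree (qs ! \<pi> i) choose i))) = det ?L"
    by (subst det_def'[of _ ?k]) (auto intro!: sum.cong prod.cong simp: permutes_in_image)
  also have "(\<lambda>x. \<Sum>\<pi>\<in>{\<pi>. \<pi> permutes {0..<?k}}. signof \<pi> *
        (\<Prod>i = 0..<?k. taylor_coeff (qs ! \<pi> i) x i * x ^ i / x ^ degree (qs ! \<pi> i))) =
      (\<lambda>x. taylor_minor [0..<?k] qs x * g x)"
    unfolding taylor_minor_def
    by (subst det_def'[of _ ?k])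
      (auto intro!: sum.cong prod.cong simp: taylor_mat_def term_eq permutes_in_image sum_distrib_right mult.assoc)
  finally have lim: "((\<lambda>x. taylor_minor [0..<?k] qs x * g x) \<longlongrightarrow> det ?L) at_top" .
  show ?thesis
  proof (rule ccontr)
    assume "\<not> ?thesis"
    then have "((\<lambda>x::real. 0) \<longlongrightarrow> det ?L) at_top" using lim by simp
    then show False using nz by (simp add: tendsto_const_iff)
  qed
qed

text \<open>
  A change of basis multiplies the Wronskian by a constant, so the previous case applies after
  passing to polynomials of distinct degrees in the same span.
\<close>

theorem wronskian_nonzero:
  assumes "distinct ps" "rp.independent (set ps)"
  shows "\<exists>x. taylor_minor [0..<length ps] ps x \<noteq> 0"
proof -
  let ?V = "rp.span (set ps)" let ?D = "degree ` (rp.span (set ps) - {0})"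
  obtain n where n: "\<And>p. p \<in> set ps \<Longrightarrow> degree p \<le> n"
    using that[of "Max (degree ` set ps)"] by auto
  have "length ps \<le> card ?D" using card_degrees_ge(1)[OF _ assms(2) n] assms(1) by (simp add: distinct_card)
  then obtain D' where D': "D' \<subseteq> ?D" "card D' = length ps" "finite D'"
    by (rule obtain_subset_with_card_n)
  define ds where "ds = sorted_list_of_set D'"
  have ds: "set ds = D'" "distinct ds" "length ds = length ps"
    using D' by (auto simp: ds_def)
  have "\<forall>d\<in>?D. \<exists>p. p \<in> ?V \<and> p \<noteq> 0 \<and> degree p = d" by auto
  then obtain q where q: "\<And>d. d \<in> ?D \<Longrightarrow> q d \<in> ?V \<and> q d \<noteq> 0 \<and> degree (q d) = d" by metis
  define qs where "qs = map q ds"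
  have q': "q d \<in> ?V" "q d \<noteq> 0" "degree (q d) = d" if "d \<in> set ds" for d
    using q[of d] that ds(1) D'(1) by blast+
  have "map degree qs = ds" using q'(3) by (simp add: qs_def o_def map_idI)
  moreover have qs: "p \<in> ?V" "p \<noteq> 0" if "p \<in> set qs" for p
    using that q'(1,2) by (auto simp only: qs_def set_map)
  ultimately obtain x where x: "taylor_minor [0..<length qs] qs x \<noteq> 0"
    using wronskian_nonzero_distinct_degrees[of qs] ds(2) by auto
  have len: "length qs = length ps" using ds by (simp add: qs_def)
  obtain A where A: "A \<in> carrier_mat (length ps) (length ps)"
    "\<And>b. b < length ps \<Longrightarrow> qs ! b = (\<Sum>a<length ps. smult (A $$ (a, b)) (ps ! a))"
    using change_of_basis_matrix[OF assms(1) len] qs(1) by blast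
  have "taylor_minor [0..<length ps] ps x * det A \<noteq> 0"
    using x taylor_minor_change_basis[OF len A(2,1)] len by metis
  then show ?thesis by auto
qed


section \<open>Rational subspaces and their minimal bases\<close>

lemma degree_le_in_span_monom:
  assumes "degree p \<le> n" shows "p \<in> rp.span ((\<lambda>i. monom 1 i) ` {..n})"
proof -
  have "p = (\<Sum>i\<le>n. smult (coeff p i) (monom 1 i))"
    using poly_as_sum_of_monoms'[OF assms] by (simp add: smult_monom)
  also have "\<dots> \<in> rp.span ((\<lambda>i. monom 1 i) ` {..n})"
    by (intro rp.span_sum rp.span_scale rp.span_base) simp
  finally show ?thesis .
qed

lemma independent_degree_le:
  assumes "rp.independent B" "\<And>p. p \<in> B \<Longrightarrow> degree p \<le> n"
  shows "finite B" "card B \<le> n + 1"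
proof -
  have "finite B \<and> card B \<le> card ((\<lambda>i. monom (1::real) i) ` {..n})"
    using assms degree_le_in_span_monom by (intro rp.independent_span_bound) auto
  moreover have "card ((\<lambda>i. monom (1::real) i) ` {..n}) \<le> n + 1"
    using card_image_le[of "{..n}" "\<lambda>i. monom (1::real) i"] by simp
  ultimately show "finite B" "card B \<le> n + 1" by auto
qed

definition int_basis :: "nat \<Rightarrow> int poly list \<Rightarrow> real poly set \<Rightarrow> bool" where
  "int_basis n ps W \<longleftrightarrow> distinct ps \<and> (\<forall>p\<in>set ps. degree p \<le> n) \<and>
     rp.independent (real_poly ` set ps) \<and> rp.span (real_poly ` set ps) = W"

lemma inj_real_poly: "inj real_poly"
  by (simp add: inj_def)

lemma int_basis_real:
  assumes "int_basis n ps W"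
  shows "distinct (map real_poly ps)" "rp.independent (set (map real_poly ps))"
    "rp.span (set (map real_poly ps)) = W" "\<And>p. p \<in> set ps \<Longrightarrow> degree p \<le> n"
    "card (real_poly ` set ps) = length ps"
  using assms
  by (auto simp: int_basis_def distinct_map card_image distinct_card inj_on_subset[OF inj_real_poly])

lemma int_basis_exists:
  assumes "\<And>p. p \<in> A \<Longrightarrow> degree p \<le> n"
  obtains ps where "int_basis n ps (rp.span (real_poly ` A))" "set ps \<subseteq> A"
proof -
  obtain B where B: "B \<subseteq> real_poly ` A" "rp.independent B" "real_poly ` A \<subseteq> rp.span B"
    using rp.maximal_independent_subset[of "real_poly ` A"] by blast
  have "degree p \<le> n" if "p \<in> B" for p using that B(1) assms by auto
  then have "finite B" using B(2) independent_degree_le by blast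
  then obtain C where C: "C \<subseteq> A" "finite C" "B = real_poly ` C"
    using finite_subset_image[OF _ B(1)] by blast
  obtain ps where ps: "set ps = C" "distinct ps" using finite_distinct_list[OF C(2)] by blast
  have "rp.span B = rp.span (real_poly ` A)"
    using B(1,3) by (intro rp.span_eq[THEN iffD2] conjI subset_trans[OF B(1) rp.span_superset])
  then have "int_basis n ps (rp.span (real_poly ` A))"
    using ps B(2) C assms unfolding int_basis_def by auto
  then show ?thesis using that ps C by blast
qed

lemma int_basis_length_le: "int_basis n ps W \<Longrightarrow> length ps \<le> n + 1"
proof -
  assume b: "int_basis n ps W"
  have "degree p \<le> n" if "p \<in> real_poly ` set ps" for p
    using that int_basis_real(4)[OF b] by auto
  then have "card (real_poly ` set ps) \<le> n + 1"
    using b unfolding int_basis_def by (intro independent_degree_le(2)) auto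
  then show ?thesis using int_basis_real(5)[OF b] by simp
qed

lemma int_basis_snoc:
  assumes "int_basis n ps W" "degree v \<le> n" "real_poly v \<notin> W"
  shows "int_basis n (ps @ [v]) (rp.span (insert (real_poly v) W))"
proof -
  let ?B = "real_poly ` set ps"
  have W: "W = rp.span ?B" and ind: "rp.independent ?B" using assms(1) by (auto simp: int_basis_def)
  have "v \<notin> set ps" using assms(3) rp.span_base[of "real_poly v" ?B] unfolding W by blast
  moreover have "rp.independent (insert (real_poly v) ?B)"
    using ind assms(3) unfolding W by (intro rp.independent_insertI)
  moreover have "rp.span (insert (real_poly v) W) = rp.span (insert (real_poly v) ?B)"
  proof
    have "insert (real_poly v) W \<subseteq> rp.span (insert (real_poly v) ?B)"
      unfolding W using rp.span_mono[of ?B "insert (real_poly v) ?B"] rp.span_base by blast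
    then show "rp.span (insert (real_poly v) W) \<subseteq> rp.span (insert (real_poly v) ?B)"
      by (intro rp.span_minimal) auto
    show "rp.span (insert (real_poly v) ?B) \<subseteq> rp.span (insert (real_poly v) W)"
      unfolding W by (intro rp.span_mono insert_mono rp.span_superset)
  qed
  ultimately show ?thesis using assms(1,2) by (auto simp: int_basis_def)
qed

lemma int_basis_strict_subset:
  assumes "int_basis n ps W" "int_basis n qs W'" "W \<subset> W'"
  shows "length ps < length qs"
proof -
  let ?B = "real_poly ` set ps" and ?C = "real_poly ` set qs"
  note b = int_basis_real[OF assms(1)] int_basis_real[OF assms(2)]
  obtain v where v: "v \<in> W'" "v \<notin> W" using assms(3) by blast
  have "rp.independent (insert v ?B)"
    using b(2,3) v(2) by (intro rp.independent_insertI) auto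
  moreover have "insert v ?B \<subseteq> rp.span ?C"
    using v(1) assms(3) b(3,8) rp.span_superset[of ?B] by auto
  ultimately have "card (insert v ?B) \<le> card ?C"
    using rp.independent_span_bound[of ?C "insert v ?B"] by simp
  moreover have "v \<notin> ?B" using v(2) b(3) rp.span_superset[of ?B] by auto
  ultimately show ?thesis using b(5,10) by simp
qed

lemma poly_real_poly_of_int: "poly (real_poly q) (of_int y) = of_int (poly q y)"
  by (induction q) (simp_all add: map_poly_pCons)

lemma taylor_minor_integer:
  "\<exists>i::int. int_minor r ps (of_int y) = of_int i"
proof -
  obtain n where "\<And>p. p \<in> set ps \<Longrightarrow> degree p \<le> n"
    using that[of "Max (degree ` set ps)"] by auto
  then obtain q where "\<And>x. int_minor r ps x = poly (real_poly q) x"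
    using taylor_minor_int_poly by blast
  then show ?thesis by (intro exI[of _ "poly q y"]) (simp add: poly_real_poly_of_int)
qed

lemma wronskian_nonzero_int:
  assumes "int_basis n ps W"
  obtains y :: int where "int_minor [0..<length ps] ps (of_int y) \<noteq> 0"
proof -
  let ?w = "int_minor [0..<length ps] ps"
  obtain q where q: "\<And>x. ?w x = poly (real_poly q) x"
    using taylor_minor_int_poly[of ps n] int_basis_real(4)[OF assms] by blast
  obtain x where "?w x \<noteq> 0" using wronskian_nonzero[OF int_basis_real(1,2)[OF assms]] by auto
  then have "real_poly q \<noteq> 0" using q by auto
  then have "finite {x. poly (real_poly q) x = 0}" by (rule poly_roots_finite)
  moreover have "infinite (range real_of_int)" by (simp add: infinite_UNIV_int range_inj_infinite inj_def)
  ultimately obtain y where "poly (real_poly q) (of_int y) \<noteq> 0"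
    by (metis (mono_tags, lifting) finite_subset image_subsetI mem_Collect_eq)
  then show ?thesis using that q by metis
qed

text \<open>
  Passing to another integer basis of \<open>W\<close> multiplies all minors, at all points and for all rows, by one
  and the same constant. Thus the bases are ordered by any single nonzero minor, and the Wronskian at a suitable integer \<open>y\<close>
  takes integer values, among which there is a smallest absolute value. A minimal basis plays the role
  of a basis of the primitive lattice of \<open>W\<close>.
\<close>

lemma minimal_int_basis_exists:
  assumes "int_basis n ps0 W"
  shows "\<exists>ps. int_basis n ps W \<and> (\<forall>qs. int_basis n qs W \<longrightarrow> length qs = length ps \<and>
     (\<forall>r x. \<bar>int_minor r ps x\<bar> \<le> \<bar>int_minor r qs x\<bar>))"
proof -
  let ?w = "\<lambda>ps. int_minor [0..<length ps] ps"
  obtain y where y: "?w ps0 (of_int y) \<noteq> 0" by (rule wronskian_nonzero_int[OF assms])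
  have len: "length qs = length ps" if "int_basis n ps W" "int_basis n qs W" for ps qs
  proof -
    have "\<exists>f. bij_betw f (real_poly ` set qs) (real_poly ` set ps)"
      using that by (intro rp.bij_if_span_eq_span_bases) (simp_all add: int_basis_def)
    then have "card (real_poly ` set qs) = card (real_poly ` set ps)"
      using bij_betw_same_card by blast
    then show ?thesis using that int_basis_real(5) by metis
  qed
  have proportional: "\<exists>c. \<forall>r x. int_minor r qs x = int_minor r ps x * c"
    if b: "int_basis n ps W" "int_basis n qs W" for ps qs
  proof -
    note r = int_basis_real[OF b(1)] int_basis_real[OF b(2)]
    have sub: "set (map real_poly qs) \<subseteq> rp.span (set (map real_poly ps))"
      using r(3,8) rp.span_superset[of "set (map real_poly qs)"] by simp
    have l: "length (map real_poly qs) = length (map real_poly ps)"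
      using len[OF b] by simp
    show ?thesis
    proof (rule change_of_basis_matrix[OF r(1) l sub])
      fix A assume A: "A \<in> carrier_mat (length (map real_poly ps)) (length (map real_poly ps))"
        "\<And>b. b < length (map real_poly ps) \<Longrightarrow> map real_poly qs ! b =
         (\<Sum>a<length (map real_poly ps). smult (A $$ (a, b)) (map real_poly ps ! a))"
      show ?thesis
        by (intro exI[of _ "det A"] allI taylor_minor_change_basis[OF l A(2) A(1)])
    qed
  qed
  obtain ps where ps: "int_basis n ps W"
    "\<And>qs. int_basis n qs W \<Longrightarrow> nat \<lfloor>\<bar>?w ps (of_int y)\<bar>\<rfloor> \<le> nat \<lfloor>\<bar>?w qs (of_int y)\<bar>\<rfloor>"
    using ex_has_least_nat[of "\<lambda>ps. int_basis n ps W" ps0 "\<lambda>ps. nat \<lfloor>\<bar>?w ps (of_int y)\<bar>\<rfloor>"] assms by blast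
  have nz: "?w ps (of_int y) \<noteq> 0"
  proof -
    obtain c where c: "\<And>r x. int_minor r ps0 x = int_minor r ps x * c"
      using proportional[OF ps(1) assms] by blast
    then show ?thesis using y len[OF ps(1) assms] by auto
  qed
  have "\<bar>int_minor r ps x\<bar> \<le> \<bar>int_minor r qs x\<bar>"
    if qs: "int_basis n qs W" for qs r x
  proof -
    obtain c where c: "\<And>r x. int_minor r qs x = int_minor r ps x * c"
      using proportional[OF ps(1) qs] by blast
    obtain i j :: int where ij: "?w ps (of_int y) = of_int i" "?w qs (of_int y) = of_int j"
      using taylor_minor_integer by metis
    have "\<bar>i\<bar> \<le> \<bar>j\<bar>" using ps(2)[OF qs] unfolding ij by (simp flip: of_int_abs)
    then have "\<bar>?w ps (of_int y)\<bar> \<le> \<bar>?w qs (of_int y)\<bar>" unfolding ij by linarith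
    also have "\<dots> = \<bar>?w ps (of_int y)\<bar> * \<bar>c\<bar>"
      using c len[OF ps(1) qs] by (simp add: abs_mult)
    finally have "1 \<le> \<bar>c\<bar>" using nz by simp
    then show ?thesis unfolding c by (simp add: abs_mult mult_left_le mult_le_cancel_left1)
  qed
  then show ?thesis using ps(1) len by blast
qed

definition minimal_int_basis :: "nat \<Rightarrow> real poly set \<Rightarrow> int poly list" where
  "minimal_int_basis n W = (SOME ps. int_basis n ps W \<and> (\<forall>qs. int_basis n qs W \<longrightarrow> length qs = length ps \<and>
     (\<forall>r x. \<bar>int_minor r ps x\<bar> \<le> \<bar>int_minor r qs x\<bar>)))"

lemma minimal_int_basis:
  assumes "int_basis n qs W"
  shows "int_basis n (minimal_int_basis n W) W" "length qs = length (minimal_int_basis n W)"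
    "\<bar>int_minor r (minimal_int_basis n W) x\<bar> \<le> \<bar>int_minor r qs x\<bar>"
  using someI_ex[OF minimal_int_basis_exists[OF assms]] assms
  unfolding minimal_int_basis_def[symmetric] by blast+

definition rational_subspaces :: "nat \<Rightarrow> real poly set set" where
  "rational_subspaces n = {W. W \<noteq> {0} \<and> (\<exists>ps. int_basis n ps W)}"

text \<open>
  Dimensions strictly increase along a chain and lie between \<open>1\<close> and \<open>n + 1\<close>.
\<close>

lemma chain_of_rational_subspaces:
  assumes F: "F \<subseteq> rational_subspaces n" "finite F" "is_chain F"
  shows "card F \<le> n + 1"
proof -
  let ?l = "\<lambda>W. length (minimal_int_basis n W)"
  have b: "int_basis n (minimal_int_basis n W) W" if "W \<in> F" for W
    using that F(1) minimal_int_basis(1) unfolding rational_subspaces_def by blast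
  have "inj_on ?l F"
  proof (rule inj_onI)
    fix W W' assume W: "W \<in> F" "W' \<in> F" "?l W = ?l W'"
    then have "W \<subseteq> W' \<or> W' \<subseteq> W" using F(3) by (auto simp: is_chain_def)
    then show "W = W'"
      using int_basis_strict_subset[OF b[OF W(1)] b[OF W(2)]]
        int_basis_strict_subset[OF b[OF W(2)] b[OF W(1)]] W(3) by auto
  qed
  moreover have "?l ` F \<subseteq> {1..n + 1}"
  proof
    fix l assume "l \<in> ?l ` F"
    then obtain W where W: "W \<in> F" "l = ?l W" by blast
    have "minimal_int_basis n W \<noteq> []"
      using b[OF W(1)] W(1) F(1) by (auto simp: int_basis_def rational_subspaces_def)
    then show "l \<in> {1..n + 1}" using int_basis_length_le[OF b[OF W(1)]] W(2)
      by (auto simp: Suc_le_eq)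
  qed
  ultimately show ?thesis using card_inj_on_le[of ?l F "{1..n + 1}"] by simp
qed


section \<open>Covolumes\<close>

definition row_choices :: "nat \<Rightarrow> nat \<Rightarrow> nat list set" where
  "row_choices n k = {r. set r \<subseteq> {..n} \<and> length r = k}"

lemma row_choices_finite_nonempty: "finite (row_choices n k)" "row_choices n k \<noteq> {}"
proof -
  show "finite (row_choices n k)" unfolding row_choices_def by (rule finite_lists_length_eq) simp
  have "replicate k 0 \<in> row_choices n k" by (auto simp: row_choices_def)
  then show "row_choices n k \<noteq> {}" by blast
qed

text \<open>
  The maximum norm of the wedge product of \<open>ps\<close> seen from \<open>x\<close>, with Taylor coefficient \<open>i\<close> measured in the unit
  \<open>\<xi> i\<close>. Repeated rows in \<open>r\<close> are harmless, they give zero minors.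
\<close>

definition wedge_norm :: "nat \<Rightarrow> (nat \<Rightarrow> real) \<Rightarrow> int poly list \<Rightarrow> real \<Rightarrow> real" where
  "wedge_norm n \<xi> ps x =
     Max ((\<lambda>r. \<bar>int_minor r ps x\<bar> / prod_list (map \<xi> r)) ` row_choices n (length ps))"

lemma wedge_norm_ge:
  "r \<in> row_choices n (length ps) \<Longrightarrow>
    \<bar>int_minor r ps x\<bar> / prod_list (map \<xi> r) \<le> wedge_norm n \<xi> ps x"
  unfolding wedge_norm_def using row_choices_finite_nonempty by (intro Max_ge) auto

lemma wedge_norm_attained:
  obtains r where "r \<in> row_choices n (length ps)"
    "wedge_norm n \<xi> ps x = \<bar>int_minor r ps x\<bar> / prod_list (map \<xi> r)"
proof -
  have "wedge_norm n \<xi> ps x \<in>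
     (\<lambda>r. \<bar>int_minor r ps x\<bar> / prod_list (map \<xi> r)) ` row_choices n (length ps)"
    unfolding wedge_norm_def using row_choices_finite_nonempty by (intro Max_in) auto
  then show ?thesis using that by blast
qed

lemma prod_list_pos_on:
  fixes \<xi> :: "nat \<Rightarrow> real"
  assumes "\<And>i. i \<le> n \<Longrightarrow> 0 < \<xi> i" "set r \<subseteq> {..n}"
  shows "0 < prod_list (map \<xi> r)"
  using assms(2) by (induction r) (auto simp: assms(1))

lemma wedge_norm_mono:
  assumes \<xi>: "\<And>i. i \<le> n \<Longrightarrow> 0 < \<xi> i" and len: "length ps = length qs"
    and le: "\<And>r. \<bar>int_minor r ps x\<bar> \<le> \<bar>int_minor r qs x\<bar>"
  shows "wedge_norm n \<xi> ps x \<le> wedge_norm n \<xi> qs x"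
proof -
  obtain r where r: "r \<in> row_choices n (length ps)"
    "wedge_norm n \<xi> ps x = \<bar>int_minor r ps x\<bar> / prod_list (map \<xi> r)"
    by (rule wedge_norm_attained)
  have "0 < prod_list (map \<xi> r)" using r(1) by (intro prod_list_pos_on \<xi>) (auto simp: row_choices_def)
  then have "wedge_norm n \<xi> ps x \<le> \<bar>int_minor r qs x\<bar> / prod_list (map \<xi> r)"
    unfolding r(2) using le by (intro divide_right_mono) auto
  also have "\<dots> \<le> wedge_norm n \<xi> qs x" using r(1) len by (intro wedge_norm_ge) simp
  finally show ?thesis .
qed

lemma wedge_norm_Nil [simp]: "wedge_norm n \<xi> [] x = 1"
proof -
  have "row_choices n 0 = {[]}" by (auto simp: row_choices_def)
  moreover have "taylor_minor [] [] x = 1"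
    unfolding taylor_minor_def by (rule det_dim_zero) (simp add: taylor_mat_def)
  ultimately show ?thesis by (simp add: wedge_norm_def)
qed

text \<open>
  Submultiplicativity in the maximum norm: every term of the Laplace expansion along \<open>v\<close> is at most
  \<open>m\<close> times a coordinate of the old wedge product.
\<close>

lemma wedge_norm_snoc_le:
  assumes \<xi>: "\<And>i. i \<le> n \<Longrightarrow> 0 < \<xi> i" and m: "\<And>i. i \<le> n \<Longrightarrow> \<bar>int_taylor v x i\<bar> \<le> m * \<xi> i"
  shows "wedge_norm n \<xi> (ps @ [v]) x \<le> real (length ps + 1) * m * wedge_norm n \<xi> ps x"
proof -
  obtain r where r: "r \<in> row_choices n (length (ps @ [v]))"
    "wedge_norm n \<xi> (ps @ [v]) x = \<bar>int_minor r (ps @ [v]) x\<bar> / prod_list (map \<xi> r)"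
    by (rule wedge_norm_attained)
  have len: "length r = Suc (length (map real_poly ps))" and sub: "set r \<subseteq> {..n}"
    using r(1) by (auto simp: row_choices_def)
  have W: "0 < prod_list (map \<xi> r)" using sub \<xi> by (rule prod_list_pos_on[rotated])
  have "wedge_norm n \<xi> (ps @ [v]) x \<le> (\<Sum>a<length r. \<bar>int_taylor v x (r ! a)\<bar> *
      \<bar>int_minor (drop_nth a r) ps x\<bar>) / prod_list (map \<xi> r)"
    unfolding r(2) using taylor_minor_snoc_le[OF len] W by (intro divide_right_mono) auto
  also have "\<dots> = (\<Sum>a<length r. \<bar>int_taylor v x (r ! a)\<bar> *
      \<bar>int_minor (drop_nth a r) ps x\<bar> / prod_list (map \<xi> r))"
    by (rule sum_divide_distrib)
  also have "\<dots> \<le> (\<Sum>a<length r. m * wedge_norm n \<xi> ps x)"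
  proof (rule sum_mono)
    fix a assume "a \<in> {..<length r}"
    then have a: "a < length r" by simp
    let ?r = "drop_nth a r"
    have ran: "r ! a \<le> n" using sub a nth_mem by blast
    have r': "?r \<in> row_choices n (length ps)"
      using a len sub set_drop_nth_subset[of a r] by (auto simp: row_choices_def)
    then have W': "0 < prod_list (map \<xi> ?r)"
      by (intro prod_list_pos_on[of n] \<xi>) (auto simp: row_choices_def)
    have "r = take a r @ r ! a # drop (Suc a) r" using a by (rule id_take_nth_drop)
    then have "prod_list (map \<xi> r) = prod_list (map \<xi> (take a r @ r ! a # drop (Suc a) r))" by simp
    then have split: "prod_list (map \<xi> r) = \<xi> (r ! a) * prod_list (map \<xi> ?r)"
      by (simp add: drop_nth_def mult_ac)
    have "\<bar>int_taylor v x (r ! a)\<bar> * \<bar>int_minor ?r ps x\<bar> / prod_list (map \<xi> r)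
       = (\<bar>int_taylor v x (r ! a)\<bar> / \<xi> (r ! a)) *
         (\<bar>int_minor ?r ps x\<bar> / prod_list (map \<xi> ?r))"
      unfolding split by simp
    also have "\<dots> \<le> m * wedge_norm n \<xi> ps x"
    proof (rule mult_mono)
      show "\<bar>int_taylor v x (r ! a)\<bar> / \<xi> (r ! a) \<le> m"
        using m[OF ran] \<xi>[OF ran] by (simp add: pos_divide_le_eq)
      show "0 \<le> m" using m[of 0] \<xi>[of 0] by (smt (verit) le0 mult_neg_pos)
      show "\<bar>int_minor ?r ps x\<bar> / prod_list (map \<xi> ?r) \<le> wedge_norm n \<xi> ps x"
        using r' by (rule wedge_norm_ge)
      show "0 \<le> \<bar>int_minor ?r ps x\<bar> / prod_list (map \<xi> ?r)" using W' by simp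
    qed
    finally show "\<bar>int_taylor v x (r ! a)\<bar> * \<bar>int_minor ?r ps x\<bar> /
      prod_list (map \<xi> r) \<le> m * wedge_norm n \<xi> ps x" .
  qed
  also have "\<dots> = real (length ps + 1) * m * wedge_norm n \<xi> ps x" using len by simp
  finally show ?thesis .
qed

lemma continuous_on_Max_image:
  fixes f :: "'a \<Rightarrow> real \<Rightarrow> real"
  assumes "finite A" "A \<noteq> {}" "\<And>a. a \<in> A \<Longrightarrow> continuous_on S (f a)"
  shows "continuous_on S (\<lambda>x. Max ((\<lambda>a. f a x) ` A))"
  using assms
proof (induction A rule: finite_ne_induct)
  case (insert a A)
  have "continuous_on S (\<lambda>x. max (f a x) (Max ((\<lambda>a. f a x) ` A)))"
    using insert by (intro continuous_on_max) auto
  then show ?case using insert by simp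
qed simp

lemma wedge_norm_relatively_good:
  assumes \<xi>: "\<And>i. i \<le> n \<Longrightarrow> 0 < \<xi> i" and ps: "\<And>p. p \<in> set ps \<Longrightarrow> degree p \<le> n" "length ps \<le> n + 1"
  shows "relatively_good (remez_const (n * (n + 1))) (wedge_norm n \<xi> ps)"
proof -
  have poly: "\<exists>q. degree q \<le> n * (n + 1) \<and> (\<forall>x. int_minor r ps x = poly (real_poly q) x)" for r
  proof -
    obtain q where "degree q \<le> n * length ps" "\<forall>x. int_minor r ps x = poly (real_poly q) x"
      using taylor_minor_int_poly[OF ps(1)] by blast
    moreover have "n * length ps \<le> n * (n + 1)" using ps(2) by (rule mult_le_mono2)
    ultimately show ?thesis using order_trans by blast
  qed
  show ?thesis
    unfolding relatively_good_def
  proof (intro conjI allI impI)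
  have "continuous_on UNIV (\<lambda>x. \<bar>int_minor r ps x\<bar> / prod_list (map \<xi> r))"
    if "r \<in> row_choices n (length ps)" for r
  proof -
    obtain q where q: "\<forall>x. int_minor r ps x = poly (real_poly q) x" using poly by blast
    have "0 < prod_list (map \<xi> r)"
      using that by (intro prod_list_pos_on[of n] \<xi>) (auto simp: row_choices_def)
    then have W: "prod_list (map \<xi> r) \<noteq> 0" by linarith
    show ?thesis unfolding q[rule_format] by (intro continuous_intros ballI W)
  qed
  then show "continuous_on UNIV (wedge_norm n \<xi> ps)"
    unfolding wedge_norm_def using row_choices_finite_nonempty by (intro continuous_on_Max_image)
next
  fix c d y \<eta> :: real assume cd: "c < d" "y \<in> {c..<d}" "0 < \<eta>"
  obtain r where r: "r \<in> row_choices n (length ps)"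
    "wedge_norm n \<xi> ps y = \<bar>int_minor r ps y\<bar> / prod_list (map \<xi> r)"
    by (rule wedge_norm_attained)
  obtain q where q: "degree q \<le> n * (n + 1)" "\<And>x. int_minor r ps x = poly (real_poly q) x"
    using poly by blast
  have W: "0 < prod_list (map \<xi> r)" using r(1) by (intro prod_list_pos_on[of n] \<xi>) (auto simp: row_choices_def)
  obtain N where N: "N \<in> sets lborel" "emeasure lborel N \<le> ennreal (\<eta> * (d - c))"
    "\<forall>x\<in>{c..<d} - N. remez_const (n * (n + 1)) \<eta> * \<bar>poly (real_poly q) y\<bar> \<le> \<bar>poly (real_poly q) x\<bar>"
    using poly_relative_lower_bound[of "real_poly q" "n * (n + 1)" \<eta> c d y] q(1) cd
    unfolding mostly_def by auto
  have "remez_const (n * (n + 1)) \<eta> * wedge_norm n \<xi> ps y \<le> wedge_norm n \<xi> ps x" if x: "x \<in> {c..<d} - N" for x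
  proof -
    have "remez_const (n * (n + 1)) \<eta> * wedge_norm n \<xi> ps y =
       (remez_const (n * (n + 1)) \<eta> * \<bar>poly (real_poly q) y\<bar>) / prod_list (map \<xi> r)"
      unfolding r(2) q(2) by simp
    also have "\<dots> \<le> \<bar>int_minor r ps x\<bar> / prod_list (map \<xi> r)"
      unfolding q(2) using N(3) x W by (intro divide_right_mono) auto
    also have "\<dots> \<le> wedge_norm n \<xi> ps x" using r(1) by (rule wedge_norm_ge)
    finally show ?thesis .
  qed
  then show "mostly \<eta> c d (\<lambda>x. remez_const (n * (n + 1)) \<eta> * wedge_norm n \<xi> ps y \<le> wedge_norm n \<xi> ps x)"
    using N(1,2) unfolding mostly_def by blast
  qed
qed

definition covolume :: "nat \<Rightarrow> (nat \<Rightarrow> real) \<Rightarrow> real poly set \<Rightarrow> real \<Rightarrow> real" where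
  "covolume n \<xi> W x = wedge_norm n \<xi> (minimal_int_basis n W) x"

lemma covolume_le_wedge_norm:
  assumes "\<And>i. i \<le> n \<Longrightarrow> 0 < \<xi> i" "int_basis n ps W"
  shows "covolume n \<xi> W x \<le> wedge_norm n \<xi> ps x"
  unfolding covolume_def using minimal_int_basis[OF assms(2)] assms(1)
  by (intro wedge_norm_mono) auto

text \<open>
  A nonzero integer polynomial of degree at most \<open>D\<close> takes a nonzero integer value at one of
  \<open>0, ..., D\<close>. Since polynomials are rarely small relative to such a value, even a short
  interval elsewhere contains a point where the polynomial is not small.
\<close>

lemma int_poly_lower_bound_on_interval:
  assumes "a < b"
  shows "\<exists>c>0. \<forall>q::int poly. q \<noteq> 0 \<longrightarrow> degree q \<le> D \<longrightarrow> (\<exists>y\<in>{a..<b}. c \<le> \<bar>poly (real_poly q) y\<bar>)"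
proof -
  \<comment> \<open>a larger interval that contains \<open>0, ..., D\<close>; its relative part \<open>\<eta>\<close> is too small to cover \<open>{a..<b}\<close>\<close>
  define A where "A = min a 0"
  define B where "B = max b (real D + 1)"
  define \<eta> where "\<eta> = (b - a) / (2 * (B - A))"
  have AB: "A \<le> a" "A \<le> 0" "b \<le> B" "real D + 1 \<le> B" "A < B" using assms by (auto simp: A_def B_def)
  have \<eta>: "0 < \<eta>" "\<eta> * (B - A) < b - a"
  proof -
    show "0 < \<eta>" using assms AB(5) by (simp add: \<eta>_def)
    have "\<eta> * (B - A) = (b - a) / 2" using AB(5) by (simp add: \<eta>_def field_simps)
    then show "\<eta> * (B - A) < b - a" using assms by simp
  qed
  show ?thesis
  proof (intro exI[of _ "remez_const D \<eta>"] conjI allI impI)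
    show "0 < remez_const D \<eta>" using remez_const_bounds[OF \<eta>(1)] by blast
    fix q :: "int poly" assume q: "q \<noteq> 0" "degree q \<le> D"
    have "\<exists>m\<le>D. poly (real_poly q) (real m) \<noteq> 0"
    proof (rule ccontr)
      assume "\<not> ?thesis"
      then have "real ` {..D} \<subseteq> {x. poly (real_poly q) x = 0}" by auto
      then have "card (real ` {..D}) \<le> card {x. poly (real_poly q) x = 0}"
        using q by (intro card_mono poly_roots_finite) auto
      also have "\<dots> \<le> D" using card_poly_roots_bound[of "real_poly q"] q by simp
      finally show False by (simp add: card_image)
    qed
    then obtain m where m: "m \<le> D" "poly (real_poly q) (real m) \<noteq> 0" by blast
    have "poly (real_poly q) (real m) = of_int (poly q (int m))"
      using poly_real_poly_of_int[of q "int m"] by simp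
    then have ge1: "1 \<le> \<bar>poly (real_poly q) (real m)\<bar>" using m(2)
      by (metis of_int_0_eq_iff of_int_1_le_iff of_int_abs int_one_le_iff_zero_less zero_less_abs_iff)
    have "real m \<in> {A..<B}" using m(1) AB by auto
    then have "mostly \<eta> A B (\<lambda>y. remez_const D \<eta> * \<bar>poly (real_poly q) (real m)\<bar> \<le> \<bar>poly (real_poly q) y\<bar>)"
      using q(2) \<eta>(1) AB(5) by (intro poly_relative_lower_bound) simp_all
    then obtain y where y: "y \<in> {a..<b}"
      "remez_const D \<eta> * \<bar>poly (real_poly q) (real m)\<bar> \<le> \<bar>poly (real_poly q) y\<bar>"
      using mostly_ex[OF _ AB(1,3) assms \<eta>(2)] by blast
    have "remez_const D \<eta> * 1 \<le> remez_const D \<eta> * \<bar>poly (real_poly q) (real m)\<bar>"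
      using ge1 remez_const_bounds[OF \<eta>(1), of D] by (intro mult_left_mono) auto
    also have "\<dots> \<le> \<bar>poly (real_poly q) y\<bar>" by (rule y(2))
    finally show "\<exists>y\<in>{a..<b}. remez_const D \<eta> \<le> \<bar>poly (real_poly q) y\<bar>" using y by auto
  qed
qed


text \<open>
  Passing from coefficients to Taylor coefficients is a unipotent triangular transformation, so the
  full determinant does not depend on the point.
\<close>

lemma full_taylor_minor_eq_det_coeff:
  assumes ps: "length ps = n + 1" "\<And>p. p \<in> set ps \<Longrightarrow> degree p \<le> n"
  shows "taylor_minor [0..<n + 1] ps x = det (mat (n + 1) (n + 1) (\<lambda>(a, b). coeff (ps ! b) a))"
proof -
  define U where "U = mat (n + 1) (n + 1) (\<lambda>(i, j). real (j choose i) * x ^ (j - i))"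
  define C where "C = mat (n + 1) (n + 1) (\<lambda>(a, b). coeff (ps ! b) a)"
  have U: "U \<in> carrier_mat (n + 1) (n + 1)" and C: "C \<in> carrier_mat (n + 1) (n + 1)"
    by (simp_all add: U_def C_def)
  have "taylor_mat [0..<n + 1] ps x = U * C"
  proof (rule eq_matI)
    fix i b assume "i < dim_row (U * C)" "b < dim_col (U * C)"
    then have ib: "i < n + 1" "b < n + 1" using U C by auto
    have "degree (ps ! b) \<le> n" using ps ib by simp
    then have "taylor_coeff (ps ! b) x i = (\<Sum>j\<le>n. coeff (ps ! b) j * (real (j choose i) * x ^ (j - i)))"
      by (rule taylor_coeff_eq)
    also have "\<dots> = (U * C) $$ (i, b)"
      using ib U C by (auto simp: U_def C_def scalar_prod_def atLeast0LessThan lessThan_Suc_atMost mult_ac intro!: sum.cong)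
    finally show "taylor_mat [0..<n + 1] ps x $$ (i, b) = (U * C) $$ (i, b)"
      using ib ps by (simp add: taylor_mat_def del: upt_Suc)
  qed (use U C ps in \<open>simp_all add: taylor_mat_def\<close>)
  then have "taylor_minor [0..<n + 1] ps x = det U * det C"
    unfolding taylor_minor_def using det_mult[OF U C] by simp
  moreover have "det U = 1"
  proof -
    have "upper_triangular U" by (auto simp: U_def binomial_eq_0)
    then have "det U = prod_list (diag_mat U)" using U by (rule det_upper_triangular)
    also have "diag_mat U = replicate (n + 1) 1"
      by (auto simp: diag_mat_def U_def intro!: nth_equalityI simp del: upt_Suc replicate_Suc)
    finally show ?thesis by simp
  qed
  ultimately show ?thesis by (simp add: C_def)
qed

lemma prod_list_map_upt: "prod_list (map \<xi> [0..<k]) = (\<Prod>i<k. \<xi> i :: real)"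
  by (induction k) (auto simp: mult.commute)

text \<open>
  For dimension \<open>k \<le> n\<close> the Wronskian is a nonzero integer polynomial, hence not small on the interval,
  while the units \<open>\<xi> 0, ..., \<xi> (k - 1)\<close> of its rows have a small product. In the top dimension the
  Wronskian is a constant nonzero integer and the units have product \<open>1\<close>.
\<close>

lemma covolume_sup_ge_1:
  assumes W: "W \<in> rational_subspaces n" and \<xi>: "\<And>i. i \<le> n \<Longrightarrow> 0 < \<xi> i" "(\<Prod>i\<le>n. \<xi> i) = 1"
    and ab: "a < b"
    and c: "\<And>q::int poly. q \<noteq> 0 \<Longrightarrow> degree q \<le> n * (n + 1) \<Longrightarrow> \<exists>y\<in>{a..<b}. c \<le> \<bar>poly (real_poly q) y\<bar>"
    and small: "\<And>k. 1 \<le> k \<Longrightarrow> k \<le> n \<Longrightarrow> (\<Prod>i<k. \<xi> i) \<le> c"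
  shows "\<exists>y\<in>{a..<b}. 1 \<le> covolume n \<xi> W y"
proof -
  define ps where "ps = minimal_int_basis n W"
  define k where "k = length ps"
  have b: "int_basis n ps W"
    using W minimal_int_basis(1) unfolding rational_subspaces_def ps_def by blast
  then have "ps \<noteq> []" using W by (auto simp: int_basis_def rational_subspaces_def)
  then have k: "1 \<le> k" "k \<le> n + 1" using int_basis_length_le[OF b] by (auto simp: k_def Suc_le_eq)
  let ?w = "int_minor [0..<k] ps"
  have rows: "[0..<k] \<in> row_choices n (length ps)" using k by (auto simp: row_choices_def k_def)
  have pos: "0 < (\<Prod>i<k. \<xi> i)" using \<xi>(1) k by (intro prod_pos) auto
  have ge: "\<bar>?w y\<bar> / (\<Prod>i<k. \<xi> i) \<le> covolume n \<xi> W y" for y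
    using wedge_norm_ge[OF rows, of y \<xi>] unfolding covolume_def ps_def[symmetric] prod_list_map_upt .
  obtain y0 :: int where y0: "?w (of_int y0) \<noteq> 0"
    using wronskian_nonzero_int[OF b] unfolding k_def by blast
  show ?thesis
  proof (cases "k \<le> n")
    case True
    obtain q where q: "degree q \<le> n * length ps" "\<And>x. ?w x = poly (real_poly q) x"
      using taylor_minor_int_poly[OF int_basis_real(4)[OF b]] by blast
    have "q \<noteq> 0" using y0 q(2) by auto
    moreover have "degree q \<le> n * (n + 1)"
      using q(1) k mult_le_mono2[of k "n + 1" n] unfolding k_def by linarith
    ultimately obtain y where y: "y \<in> {a..<b}" "c \<le> \<bar>?w y\<bar>" using c q(2) by metis
    then have "(\<Prod>i<k. \<xi> i) \<le> \<bar>?w y\<bar>" using small[OF k(1) True] by linarith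
    then have "1 \<le> \<bar>?w y\<bar> / (\<Prod>i<k. \<xi> i)" using pos by simp
    then show ?thesis using ge[of y] y(1) by (meson order_trans)
  next
    case False
    then have kn: "k = n + 1" using k by simp
    have len: "length (map real_poly ps) = n + 1" using kn k_def by simp
    have deg: "degree p \<le> n" if "p \<in> set (map real_poly ps)" for p
      using that int_basis_real(4)[OF b] by auto
    have const: "?w a = ?w (of_int y0)"
      unfolding kn using full_taylor_minor_eq_det_coeff[OF len deg] by simp
    obtain i :: int where i: "?w (of_int y0) = of_int i" using taylor_minor_integer by blast
    have "1 \<le> \<bar>?w a\<bar>" unfolding const i using y0 i by (simp flip: of_int_abs)
    moreover have "(\<Prod>i<k. \<xi> i) = 1" using \<xi>(2) unfolding kn by (simp add: lessThan_Suc_atMost)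
    ultimately show ?thesis using ge[of a] ab by force
  qed
qed

section \<open>Most points admit no short vector\<close>

text \<open>
  Let \<open>W0\<close> be the largest member of the protecting chain that does not contain \<open>v\<close>, or \<open>{0}\<close>. The span of
  \<open>W0\<close> and \<open>v\<close> is comparable with the whole chain, so its covolume is at least \<open>\<epsilon>\<close>; it is at most
  a constant times the size of \<open>v\<close>, since the covolume of \<open>W0\<close> is at most \<open>1\<close>.
\<close>

lemma protected_imp_no_short_vector:
  assumes \<xi>: "\<And>i. i \<le> n \<Longrightarrow> 0 < \<xi> i"
    and prot: "flag_protected (\<lambda>W. covolume n \<xi> W x) (rational_subspaces n) 1 \<epsilon>"
    and v: "v \<noteq> 0" "degree v \<le> n" "\<And>i. i \<le> n \<Longrightarrow> \<bar>int_taylor v x i\<bar> \<le> m * \<xi> i"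
  shows "\<epsilon> \<le> real (n + 1) * m"
proof -
  obtain F where F: "F \<subseteq> rational_subspaces n" "finite F" "is_chain F"
    "\<And>W. W \<in> F \<Longrightarrow> covolume n \<xi> W x < 1"
    "\<And>W. W \<in> rational_subspaces n \<Longrightarrow> (\<And>T. T \<in> F \<Longrightarrow> comparable W T) \<Longrightarrow> \<epsilon> \<le> covolume n \<xi> W x"
    using prot by (rule flag_protectedE) blast
  have m: "0 \<le> m" using v(3)[of 0] \<xi>[of 0] by (smt (verit) le0 mult_neg_pos)
  have sub: "rp.subspace W" if "W \<in> F" for W
    using that F(1) rp.subspace_span by (auto simp: rational_subspaces_def int_basis_def)
  define G where "G = {W \<in> F. real_poly v \<notin> W}"
  have "\<exists>ps W0. int_basis n ps W0 \<and> real_poly v \<notin> W0 \<and> wedge_norm n \<xi> ps x \<le> 1 \<and>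
     (\<forall>T\<in>F. (real_poly v \<notin> T \<longrightarrow> T \<subseteq> W0) \<and> (real_poly v \<in> T \<longrightarrow> W0 \<subseteq> T))"
  proof (cases "G = {}")
    case True
    have "int_basis n [] {0}" by (simp add: int_basis_def rp.independent_empty)
    moreover have "{0} \<subseteq> T" if "T \<in> F" for T using rp.subspace_0[OF sub[OF that]] by simp
    ultimately show ?thesis using True v(1) unfolding G_def
      by (intro exI[of _ "[]"] exI[of _ "{0}"]) auto
  next
    case False
    obtain W0 where W0: "W0 \<in> G" "\<And>T. T \<in> G \<Longrightarrow> W0 \<subseteq> T \<Longrightarrow> T = W0"
      using finite_has_maximal[of G] False F(2) unfolding G_def by auto
    have chain: "comparable W0 T" if "T \<in> F" for T
      using that W0(1) F(3) unfolding G_def is_chain_def by blast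
    have "int_basis n (minimal_int_basis n W0) W0"
      using W0(1) F(1) minimal_int_basis(1) unfolding G_def rational_subspaces_def by blast
    moreover have "wedge_norm n \<xi> (minimal_int_basis n W0) x \<le> 1"
      using F(4)[of W0] W0(1) unfolding G_def covolume_def by simp
    moreover have "T \<subseteq> W0" if "T \<in> F" "real_poly v \<notin> T" for T
      using W0(2)[of T] chain[OF that(1)] that unfolding G_def by blast
    moreover have "W0 \<subseteq> T" if "T \<in> F" "real_poly v \<in> T" for T
      using W0(1) chain[OF that(1)] that unfolding G_def by blast
    ultimately show ?thesis using W0(1) unfolding G_def
      by (intro exI[of _ "minimal_int_basis n W0"] exI[of _ W0]) blast
  qed
  then obtain ps W0 where P: "int_basis n ps W0 \<and> real_poly v \<notin> W0 \<and> wedge_norm n \<xi> ps x \<le> 1 \<and>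
     (\<forall>T\<in>F. (real_poly v \<notin> T \<longrightarrow> T \<subseteq> W0) \<and> (real_poly v \<in> T \<longrightarrow> W0 \<subseteq> T))"
    by (elim exE)
  have ps: "int_basis n ps W0" "real_poly v \<notin> W0" "wedge_norm n \<xi> ps x \<le> 1" using P by simp_all
  have ps': "real_poly v \<notin> T \<Longrightarrow> T \<subseteq> W0" "real_poly v \<in> T \<Longrightarrow> W0 \<subseteq> T" if "T \<in> F" for T
    using P that by simp_all
  define W where "W = rp.span (insert (real_poly v) W0)"
  have basis: "int_basis n (ps @ [v]) W" unfolding W_def by (rule int_basis_snoc[OF ps(1) v(2) ps(2)])
  have memW: "real_poly v \<in> W" "W0 \<subseteq> W" unfolding W_def using rp.span_superset by blast+
  have "W \<noteq> {0}" using memW(1) v(1) by auto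
  then have "W \<in> rational_subspaces n" using basis by (auto simp: rational_subspaces_def)
  moreover have "comparable W T" if T: "T \<in> F" for T
  proof (cases "real_poly v \<in> T")
    case True
    then have "W \<subseteq> T" unfolding W_def using ps'(2)[OF T] sub[OF T] by (intro rp.span_minimal) auto
    then show ?thesis by blast
  next
    case False
    then show ?thesis using ps'(1)[OF T] memW(2) by blast
  qed
  ultimately have "\<epsilon> \<le> covolume n \<xi> W x" by (rule F(5))
  also have "\<dots> \<le> wedge_norm n \<xi> (ps @ [v]) x" using \<xi> basis by (rule covolume_le_wedge_norm)
  also have "\<dots> \<le> real (length ps + 1) * m * wedge_norm n \<xi> ps x"
    using \<xi> v(3) by (rule wedge_norm_snoc_le)
  also have "\<dots> \<le> real (length ps + 1) * m * 1" using ps(3) m by (intro mult_left_mono) auto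
  also have "\<dots> \<le> real (n + 1) * m"
    using int_basis_length_le[OF basis] m by (simp add: mult_right_mono)
  finally show ?thesis .
qed

definition no_short_vector :: "nat \<Rightarrow> real \<Rightarrow> (nat \<Rightarrow> real) \<Rightarrow> real \<Rightarrow> bool" where
  "no_short_vector n \<delta> \<xi> x \<longleftrightarrow>
     (\<forall>v::int poly. v \<noteq> 0 \<longrightarrow> degree v \<le> n \<longrightarrow> (\<exists>i\<le>n. \<delta> * \<xi> i < \<bar>int_taylor v x i\<bar>))"

text \<open>
  The threshold \<open>\<delta>\<close> depends on \<open>n\<close> only; how small the partial products of the units have to be may
  depend on the interval, and this is what makes \<open>Q\<close> large in the end.
\<close>

theorem no_short_vector_mostly:
  "\<exists>\<delta>>0. \<forall>a b. a < b \<longrightarrow> (\<exists>c>0. \<forall>\<xi>. (\<forall>i\<le>n. 0 < \<xi> i) \<longrightarrow> (\<Prod>i\<le>n. \<xi> i) = 1 \<longrightarrow>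
     (\<forall>k. 1 \<le> k \<longrightarrow> k \<le> n \<longrightarrow> (\<Prod>i<k. \<xi> i) \<le> c) \<longrightarrow> mostly (1/4) a b (no_short_vector n \<delta> \<xi>))"
proof -
  let ?D = "n * (n + 1)"
  have "\<exists>\<epsilon>>0. \<forall>(S::real poly set set) \<psi> a b.
     a < b \<longrightarrow> (\<forall>s\<in>S. relatively_good (remez_const ?D) (\<psi> s)) \<longrightarrow>
     (\<forall>F\<subseteq>S. finite F \<longrightarrow> is_chain F \<longrightarrow> card F \<le> n + 1) \<longrightarrow>
     (\<forall>s\<in>S. \<exists>y\<in>{a..<b}. 1 \<le> \<psi> s y) \<longrightarrow>
     mostly (1/4) a b (\<lambda>x. flag_protected (\<lambda>s. \<psi> s x) S 1 \<epsilon>)"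
    by (rule quantitative_nondivergence) (use remez_const_bounds in auto)
  then obtain \<epsilon> where \<epsilon>: "\<epsilon> > 0" and qnd: "\<forall>(S::real poly set set) \<psi> a b.
     a < b \<longrightarrow> (\<forall>s\<in>S. relatively_good (remez_const ?D) (\<psi> s)) \<longrightarrow>
     (\<forall>F\<subseteq>S. finite F \<longrightarrow> is_chain F \<longrightarrow> card F \<le> n + 1) \<longrightarrow>
     (\<forall>s\<in>S. \<exists>y\<in>{a..<b}. 1 \<le> \<psi> s y) \<longrightarrow>
     mostly (1/4) a b (\<lambda>x. flag_protected (\<lambda>s. \<psi> s x) S 1 \<epsilon>)"
    by (elim exE conjE)
  define \<delta> where "\<delta> = \<epsilon> / (2 * real (n + 1))"
  have half: "real (n + 1) * \<delta> = \<epsilon> / 2" unfolding \<delta>_def by (simp del: of_nat_Suc of_nat_add)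
  have \<delta>: "\<delta> > 0" using \<epsilon> unfolding \<delta>_def by simp
  have \<delta>_lt: "real (n + 1) * \<delta> < \<epsilon>" using half \<epsilon> by linarith
  show ?thesis
  proof (rule exI[of _ \<delta>], intro conjI allI impI)
    fix a b :: real assume ab: "a < b"
    obtain c where c: "c > 0"
      "\<forall>q::int poly. q \<noteq> 0 \<longrightarrow> degree q \<le> ?D \<longrightarrow> (\<exists>y\<in>{a..<b}. c \<le> \<bar>poly (real_poly q) y\<bar>)"
      using int_poly_lower_bound_on_interval[OF ab, of ?D] by (elim exE conjE)
    show "\<exists>c>0. \<forall>\<xi>. (\<forall>i\<le>n. 0 < \<xi> i) \<longrightarrow> (\<Prod>i\<le>n. \<xi> i) = 1 \<longrightarrow>
     (\<forall>k. 1 \<le> k \<longrightarrow> k \<le> n \<longrightarrow> (\<Prod>i<k. \<xi> i) \<le> c) \<longrightarrow> mostly (1/4) a b (no_short_vector n \<delta> \<xi>)"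
    proof (intro exI[of _ c] conjI allI impI c(1))
      fix \<xi> :: "nat \<Rightarrow> real"
      assume \<xi>: "\<forall>i\<le>n. 0 < \<xi> i" "(\<Prod>i\<le>n. \<xi> i) = 1" "\<forall>k. 1 \<le> k \<longrightarrow> k \<le> n \<longrightarrow> (\<Prod>i<k. \<xi> i) \<le> c"
      have "relatively_good (remez_const ?D) (covolume n \<xi> W)" if W: "W \<in> rational_subspaces n" for W
      proof -
        have b: "int_basis n (minimal_int_basis n W) W"
          using W minimal_int_basis(1) unfolding rational_subspaces_def by blast
        have "covolume n \<xi> W = wedge_norm n \<xi> (minimal_int_basis n W)"
          by (rule ext) (simp add: covolume_def)
        then show ?thesis
          using wedge_norm_relatively_good[of n \<xi> "minimal_int_basis n W"] \<xi>(1)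
            int_basis_real(4)[OF b] int_basis_length_le[OF b] by simp
      qed
      moreover have "\<exists>y\<in>{a..<b}. 1 \<le> covolume n \<xi> W y" if W: "W \<in> rational_subspaces n" for W
        using W \<xi> ab c(2) by (intro covolume_sup_ge_1[where c = c]) blast+
      ultimately have "mostly (1/4) a b (\<lambda>x. flag_protected (\<lambda>W. covolume n \<xi> W x) (rational_subspaces n) 1 \<epsilon>)"
        using ab chain_of_rational_subspaces by (intro qnd[rule_format]) blast+
      moreover have "no_short_vector n \<delta> \<xi> x"
        if prot: "flag_protected (\<lambda>W. covolume n \<xi> W x) (rational_subspaces n) 1 \<epsilon>" for x
        unfolding no_short_vector_def
      proof (intro allI impI)
        fix v :: "int poly" assume v: "v \<noteq> 0" "degree v \<le> n"
        show "\<exists>i\<le>n. \<delta> * \<xi> i < \<bar>int_taylor v x i\<bar>"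
        proof (rule ccontr)
          assume "\<not> ?thesis"
          then have "\<bar>int_taylor v x i\<bar> \<le> \<delta> * \<xi> i" if "i \<le> n" for i
            using that by force
          then have "\<epsilon> \<le> real (n + 1) * \<delta>"
            using protected_imp_no_short_vector[OF _ prot v] \<xi>(1) by blast
          then show False using \<delta>_lt by linarith
        qed
      qed
      ultimately show "mostly (1/4) a b (no_short_vector n \<delta> \<xi>)"
        unfolding mostly_def by blast
    qed
  qed (rule \<delta>)
qed


section \<open>Bases of short vectors\<close>

lemma taylor_coeff_monom:
  "taylor_coeff (monom c d) x i = c * (real (d choose i) * x ^ (d - i))"
proof -
  have "taylor_coeff (monom c d) x i = (\<Sum>j\<le>d. (if j = d then c else 0) * (real (j choose i) * x ^ (j - i)))"
    by (subst taylor_coeff_eq[of _ d]) (auto simp: degree_monom_le intro!: sum.cong)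
  also have "\<dots> = (\<Sum>j\<le>d. if j = d then c * (real (d choose i) * x ^ (d - i)) else 0)"
    by (intro sum.cong) auto
  finally show ?thesis by simp
qed

text \<open>
  Choose the coefficients from the top degree downwards: a change of the coefficient of \<open>X\<^sup>d\<close> by an integer
  translates the \<open>d\<close>-th Taylor coefficient and leaves the higher ones alone.
\<close>

lemma int_poly_with_given_floors:
  "\<exists>P::int poly. degree P \<le> n \<and> (\<forall>i\<le>n. \<lfloor>int_taylor P x i\<rfloor> = t i)"
proof -
  have "\<exists>P::int poly. degree P \<le> n \<and> (\<forall>i\<le>n. n + 1 - k \<le> i \<longrightarrow> \<lfloor>int_taylor P x i\<rfloor> = t i)"
    if "k \<le> n + 1" for k
    using that
  proof (induction k)
    case 0
    show ?case by (intro exI[of _ 0]) auto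
  next
    case (Suc k)
    then obtain P :: "int poly" where P: "degree P \<le> n"
      "\<And>i. i \<le> n \<Longrightarrow> n + 1 - k \<le> i \<Longrightarrow> \<lfloor>int_taylor P x i\<rfloor> = t i" by auto
    define d where "d = n - k"
    define c where "c = t d - \<lfloor>int_taylor P x d\<rfloor>"
    define P' where "P' = P + monom c d"
    have tc: "taylor_coeff (real_poly P') x i =
       int_taylor P x i + of_int c * (real (d choose i) * x ^ (d - i))" for i
    proof -
      have "real_poly (monom c d) = monom (of_int c) d" by (rule poly_eqI) auto
      then show ?thesis by (simp add: P'_def real_poly_add taylor_coeff_add taylor_coeff_monom)
    qed
    have "\<lfloor>taylor_coeff (real_poly P') x i\<rfloor> = t i" if i: "i \<le> n" "n + 1 - Suc k \<le> i" for i
    proof (cases "i = d")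
      case True
      have "\<lfloor>int_taylor P x d + of_int c\<rfloor> = t d" by (simp add: c_def)
      then show ?thesis using True by (simp add: tc)
    next
      case False
      then have "d < i" "n + 1 - k \<le> i" using i Suc.prems by (auto simp: d_def)
      then show ?thesis using P(2)[of i] i by (simp add: tc binomial_eq_0)
    qed
    moreover have "degree P' \<le> n"
      unfolding P'_def using P(1)
      by (intro degree_add_le order_trans[OF degree_monom_le]) (auto simp: d_def)
    ultimately show ?case by blast
  qed
  from this[of "n + 1"] show ?thesis by auto
qed

text \<open>
  Dirichlet's argument. Where the side \<open>L i\<close> of the box is at least \<open>1\<close>, let the floor of the
  Taylor coefficient run through \<open>T i\<close> values; where it is smaller than \<open>1\<close>, keep the floor at \<open>0\<close> and
  cut the unit interval into \<open>b i\<close> pieces of length at most \<open>L i\<close>. Some cell contains the average number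
  of polynomials, and differences of these lie in the box.
\<close>

lemma many_int_polys_in_a_box:
  assumes \<xi>: "\<And>i. i \<le> n \<Longrightarrow> 0 < \<xi> i" "(\<Prod>i\<le>n. \<xi> i) = 1" and R: "0 < R"
  shows "\<exists>A::int poly set. finite A \<and> (R / 2) ^ (n + 1) \<le> real (card A) \<and> (\<forall>P\<in>A. degree P \<le> n) \<and>
    (\<forall>P\<in>A. \<forall>Q\<in>A. \<forall>i\<le>n. \<bar>int_taylor (P - Q) x i\<bar> \<le> R * \<xi> i)"
proof -
  define L where "L = (\<lambda>i. R * \<xi> i)"
  define T where "T = (\<lambda>i. nat \<lfloor>max 1 (L i)\<rfloor>)"
  define b where "b = (\<lambda>i. nat \<lceil>real (T i) / L i\<rceil>)"
  have L: "0 < L i" if "i \<le> n" for i using \<xi>(1) R that by (simp add: L_def)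
  have T1: "1 \<le> T i" for i by (simp add: T_def le_nat_iff)
  have b1: "1 \<le> b i" if "i \<le> n" for i
  proof -
    have "0 < real (T i) / L i" using T1[of i] L[OF that] by simp
    then have "0 < \<lceil>real (T i) / L i\<rceil>" by (simp only: zero_less_ceiling)
    then show ?thesis unfolding b_def by linarith
  qed
  have cell: "real (T i) / real (b i) \<le> L i" if i: "i \<le> n" for i
  proof -
    have "real (T i) / L i \<le> real (b i)" unfolding b_def by (rule real_nat_ceiling_ge)
    then show ?thesis using L[OF i] b1[OF i] by (simp add: field_simps)
  qed
  have dense: "L i / 2 \<le> real (T i) / real (b i)" if i: "i \<le> n" for i
  proof (cases "1 \<le> L i")
    case True
    have "real (T i) = of_int \<lfloor>L i\<rfloor>" using True by (simp add: T_def)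
    moreover have "1 \<le> real_of_int \<lfloor>L i\<rfloor>" using True by simp
    ultimately have T: "real (T i) \<le> L i" "L i / 2 \<le> real (T i)"
      using of_int_floor_le[of "L i"] floor_correct[of "L i"] by linarith+
    then have "real (T i) / L i \<le> 1" "0 < real (T i) / L i" using L[OF i] T1[of i] by auto
    then have "\<lceil>real (T i) / L i\<rceil> = 1" by (simp add: ceiling_eq_iff)
    then have "b i = 1" by (simp add: b_def)
    then show ?thesis using T by simp
  next
    case False
    then have "T i = 1" by (simp add: T_def)
    then have "real (b i) = of_int \<lceil>1 / L i\<rceil>" using L[OF i] by (simp add: b_def)
    also have "\<dots> \<le> 1 / L i + 1" by linarith
    also have "\<dots> \<le> 2 / L i" using L[OF i] False by (simp add: field_simps)
    finally show ?thesis using L[OF i] b1[OF i] \<open>T i = 1\<close> by (simp add: field_simps)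
  qed
  define \<T> where "\<T> = (\<Pi>\<^sub>E i\<in>{..n}. {0..<int (T i)})"
  define \<B> where "\<B> = (\<Pi>\<^sub>E i\<in>{..n}. {0..<int (b i)})"
  obtain P :: "(nat \<Rightarrow> int) \<Rightarrow> int poly" where P: "\<And>t. degree (P t) \<le> n"
      "\<And>t i. i \<le> n \<Longrightarrow> \<lfloor>int_taylor (P t) x i\<rfloor> = t i"
    using int_poly_with_given_floors[of n x] by metis
  have inj: "inj_on P \<T>"
  proof (rule inj_onI)
    fix s t assume st: "s \<in> \<T>" "t \<in> \<T>" "P s = P t"
    show "s = t"
    proof (rule PiE_ext[OF st(1)[unfolded \<T>_def] st(2)[unfolded \<T>_def]])
      fix i assume "i \<in> {..n}"
      then show "s i = t i" using P(2)[of i s] P(2)[of i t] st(3) by simp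
    qed
  qed
  define f where "f = (\<lambda>t. \<lambda>i\<in>{..n}. \<lfloor>int_taylor (P t) x i * (real (b i) / real (T i))\<rfloor>)"
  have f: "f \<in> \<T> \<rightarrow> \<B>"
  proof
    fix t assume t: "t \<in> \<T>"
    have "\<lfloor>int_taylor (P t) x i * (real (b i) / real (T i))\<rfloor> \<in> {0..<int (b i)}" if i: "i \<le> n" for i
    proof -
      let ?v = "int_taylor (P t) x i"
      have "\<lfloor>?v\<rfloor> \<in> {0..<int (T i)}" using P(2)[OF i] t i by (auto simp: \<T>_def PiE_iff)
      then have v: "0 \<le> ?v" "?v < real (T i)" by (auto simp: floor_less_iff)
      have pos: "0 < real (b i) / real (T i)" using b1[OF i] T1[of i] by simp
      have "?v * (real (b i) / real (T i)) < real (T i) * (real (b i) / real (T i))"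
        using v(2) pos by (rule mult_strict_right_mono)
      also have "\<dots> = real (b i)" using T1[of i] by simp
      finally show ?thesis using v(1) pos by (simp add: floor_less_iff)
    qed
    then show "f t \<in> \<B>" by (auto simp: f_def \<B>_def)
  qed
  have fin: "finite \<T>" "finite \<B>" unfolding \<T>_def \<B>_def by (intro finite_PiE; simp)+
  have T0: "0 < T i" for i using T1[of i] by simp
  have "\<T> \<noteq> {}" by (simp add: \<T>_def PiE_eq_empty_iff T0)
  have cards: "card \<T> = (\<Prod>i\<le>n. T i)" "card \<B> = (\<Prod>i\<le>n. b i)"
    unfolding \<T>_def \<B>_def by (simp_all add: card_PiE)
  have "\<B> \<noteq> {}" using f \<open>\<T> \<noteq> {}\<close> by auto
  then obtain y where y: "card \<T> \<le> card (f -` {y} \<inter> \<T>) * card \<B>"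
    using pigeonhole_card[OF f fin] by blast
  define A where "A = P ` (f -` {y} \<inter> \<T>)"
  have "card A = card (f -` {y} \<inter> \<T>)"
    unfolding A_def by (intro card_image inj_on_subset[OF inj]) auto
  then have "card \<T> \<le> card A * card \<B>" using y by simp
  then have "real (\<Prod>i\<le>n. T i) \<le> real (card A) * real (\<Prod>i\<le>n. b i)"
    unfolding cards by (metis of_nat_le_iff of_nat_mult)
  moreover have "0 < real (\<Prod>i\<le>n. b i)" using b1 by (auto intro!: prod_pos simp: Suc_le_eq)
  ultimately have "(\<Prod>i\<le>n. real (T i) / real (b i)) \<le> real (card A)"
    by (simp add: prod_dividef pos_divide_le_eq)
  moreover have "(\<Prod>i\<le>n. L i / 2) \<le> (\<Prod>i\<le>n. real (T i) / real (b i))"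
    using dense L by (intro prod_mono) (auto intro: less_imp_le)
  moreover have "(\<Prod>i\<le>n. L i / 2) = (R / 2) ^ (n + 1)"
  proof -
    have "(\<Prod>i\<le>n. L i / 2) = (\<Prod>i\<le>n. R / 2) * (\<Prod>i\<le>n. \<xi> i)"
      unfolding L_def prod.distrib[symmetric] by (intro prod.cong) auto
    then show ?thesis using \<xi>(2) by simp
  qed
  ultimately have "(R / 2) ^ (n + 1) \<le> real (card A)" by linarith
  moreover have "\<bar>int_taylor (p - q) x i\<bar> \<le> R * \<xi> i"
    if pq: "p \<in> A" "q \<in> A" and i: "i \<le> n" for p q i
  proof -
    obtain s t where st: "p = P s" "q = P t" "f s = f t" using pq by (auto simp: A_def)
    define c where "c = real (b i) / real (T i)"
    let ?u = "int_taylor p x i" and ?v = "int_taylor q x i"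
    have pos: "0 < c" using b1[OF i] T1[of i] by (simp add: c_def)
    have "\<lfloor>?u * c\<rfloor> = \<lfloor>?v * c\<rfloor>" using fun_cong[OF st(3), of i] i by (simp add: f_def st c_def)
    then have "\<bar>?u * c - ?v * c\<bar> < 1" by linarith
    then have "\<bar>?u - ?v\<bar> * c < 1" using pos by (simp add: left_diff_distrib[symmetric] abs_mult)
    then have "\<bar>?u - ?v\<bar> < 1 / c" using pos by (simp only: pos_less_divide_eq)
    then have "\<bar>?u - ?v\<bar> \<le> real (T i) / real (b i)" by (simp add: c_def)
    also have "\<dots> \<le> R * \<xi> i" using cell[OF i] by (simp add: L_def)
    finally show ?thesis by (simp add: real_poly_diff taylor_coeff_diff)
  qed
  moreover have "\<forall>p\<in>A. degree p \<le> n" using P(1) by (auto simp: A_def)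
  moreover have "finite A" using fin by (auto simp: A_def)
  ultimately show ?thesis by blast
qed

lemma nonzero_functional_vanishing:
  fixes w :: "nat \<Rightarrow> nat \<Rightarrow> real"
  assumes "m \<le> n"
  obtains u where "\<exists>i\<le>n. u i \<noteq> 0" "\<And>j. j < m \<Longrightarrow> (\<Sum>i\<le>n. u i * w j i) = 0"
proof -
  define M where "M = mat (n + 1) (n + 1) (\<lambda>(i, j). if j < m then w j i else 0)"
  have M: "M \<in> carrier_mat (n + 1) (n + 1)" by (simp add: M_def)
  have "M *\<^sub>v unit_vec (n + 1) n = 0\<^sub>v (n + 1)"
    using assms by (intro eq_vecI) (auto simp: M_def scalar_prod_def unit_vec_def)
  moreover have "unit_vec (n + 1) n \<in> carrier_vec (n + 1)" "unit_vec (n + 1) n \<noteq> (0\<^sub>v (n + 1) :: real vec)"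
    by auto
  ultimately have "det M = 0" using det_0_iff_vec_prod_zero_field[OF M] by blast
  then have "det (transpose_mat M) = 0" by (simp add: det_transpose[OF M])
  then obtain v where v: "v \<in> carrier_vec (n + 1)" "v \<noteq> 0\<^sub>v (n + 1)" "transpose_mat M *\<^sub>v v = 0\<^sub>v (n + 1)"
    using det_0_iff_vec_prod_zero_field[of "transpose_mat M" "n + 1"] M by auto
  show ?thesis
  proof (rule that[of "\<lambda>i. v $ i"])
    show "\<exists>i\<le>n. v $ i \<noteq> 0"
    proof (rule ccontr)
      assume "\<not> ?thesis"
      then have "v = 0\<^sub>v (n + 1)" using v(1) by (intro eq_vecI) auto
      then show False using v(2) by simp
    qed
    fix j assume j: "j < m"
    have "(transpose_mat M *\<^sub>v v) $ j = (\<Sum>i\<le>n. v $ i * w j i)"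
      using j assms v(1) M
      by (auto simp: M_def scalar_prod_def atLeast0LessThan lessThan_Suc_atMost mult.commute intro!: sum.cong)
    then show "(\<Sum>i\<le>n. v $ i * w j i) = 0" using v(3) j assms by simp
  qed
qed

text \<open>
  Otherwise the roughly \<open>R ^ (n + 1)\<close> differences \<open>P - P0\<close> obtained from a box of size \<open>R\<close> satisfy one linear relation \<open>u\<close>. If
  \<open>\<bar>u i0\<bar>\<close> is largest, coordinate \<open>i0\<close> is controlled by the others, so the points remain separated
  after projection along \<open>i0\<close>, which leaves room for at most a constant times \<open>R ^ n\<close> of them.
\<close>

lemma short_basis_exists:
  assumes \<delta>: "0 < \<delta>"
  shows "\<exists>R\<ge>1. \<forall>\<xi> x. (\<forall>i\<le>n. 0 < \<xi> i) \<longrightarrow> (\<Prod>i\<le>n. \<xi> i) = 1 \<longrightarrow> no_short_vector n \<delta> \<xi> x \<longrightarrow>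
     (\<exists>ps W. int_basis n ps W \<and> length ps = n + 1 \<and>
        (\<forall>p\<in>set ps. \<forall>i\<le>n. \<bar>int_taylor p x i\<bar> \<le> R * \<xi> i))"
proof -
  \<comment> \<open>the projected points number at most \<open>(R * K) ^ n\<close>, and \<open>R\<close> is chosen to contradict \<open>(R / 2) ^ (n + 1) \<le> (R * K) ^ n\<close>\<close>
  define K where "K = 2 * real (n + 1) / \<delta> + 3"
  define R where "R = 2 ^ (n + 1) * K ^ n + 1"
  have K: "3 \<le> K" using \<delta> by (simp add: K_def)
  then have R: "1 \<le> R" by (simp add: R_def)
  show ?thesis
  proof (intro exI[of _ R] conjI allI impI R)
    fix \<xi> :: "nat \<Rightarrow> real" and x :: real
    assume \<xi>: "\<forall>i\<le>n. 0 < \<xi> i" "(\<Prod>i\<le>n. \<xi> i) = 1" and nsv: "no_short_vector n \<delta> \<xi> x"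
    have \<xi>pos: "0 < \<xi> i" if "i \<le> n" for i using \<xi>(1) that by blast
    obtain A :: "int poly set" where A: "finite A" "(R / 2) ^ (n + 1) \<le> real (card A)"
      "\<And>P. P \<in> A \<Longrightarrow> degree P \<le> n"
      "\<And>P Q i. P \<in> A \<Longrightarrow> Q \<in> A \<Longrightarrow> i \<le> n \<Longrightarrow> \<bar>int_taylor (P - Q) x i\<bar> \<le> R * \<xi> i"
      using many_int_polys_in_a_box[of n \<xi> R x] \<xi> R by force
    have "0 < (R / 2) ^ (n + 1)" using R by simp
    then have "A \<noteq> {}" using A(2) by auto
    then obtain P0 where P0: "P0 \<in> A" by blast
    define D where "D = (\<lambda>P. P - P0) ` A"
    have degD: "degree p \<le> n" if "p \<in> D" for p using that A(3) P0 by (auto simp: D_def intro: degree_diff_le)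
    obtain ps where ps: "int_basis n ps (rp.span (real_poly ` D))" "set ps \<subseteq> D"
      using int_basis_exists[of D n] degD by blast
    have bound: "\<bar>int_taylor p x i\<bar> \<le> R * \<xi> i" if "p \<in> D" "i \<le> n" for p i
      using that A(4)[OF _ P0] by (auto simp: D_def)
    have "length ps = n + 1"
    proof (rule ccontr)
      assume "length ps \<noteq> n + 1"
      then have lps: "length ps \<le> n" using int_basis_length_le[OF ps(1)] by simp
      define w where "w = (\<lambda>p i. taylor_coeff p x i / \<xi> i)"
      obtain u where u: "\<exists>i\<le>n. u i \<noteq> 0" "\<And>j. j < length ps \<Longrightarrow> (\<Sum>i\<le>n. u i * w (real_poly (ps ! j)) i) = 0"
        using nonzero_functional_vanishing[OF lps, of "\<lambda>j. w (real_poly (ps ! j))"] by blast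
      have van: "(\<Sum>i\<le>n. u i * w p i) = 0" if "p \<in> rp.span (real_poly ` set ps)" for p
        using that
      proof (induction rule: rp.span_induct_alt)
        case base
        then show ?case by (simp add: w_def)
      next
        case (step c q p)
        then obtain j where "j < length ps" "q = real_poly (ps ! j)" by (auto simp: in_set_conv_nth)
        then have "(\<Sum>i\<le>n. u i * w q i) = 0" using u(2) by simp
        moreover have "(\<Sum>i\<le>n. u i * w (smult c q + p) i) = c * (\<Sum>i\<le>n. u i * w q i) + (\<Sum>i\<le>n. u i * w p i)"
          by (simp add: w_def taylor_coeff_add taylor_coeff_smult sum_distrib_left sum.distrib[symmetric] add_divide_distrib ring_distribs mult_ac)
        ultimately show ?case using step by simp
      qed
      obtain i0 where i0: "i0 \<le> n" "\<And>i. i \<le> n \<Longrightarrow> \<bar>u i\<bar> \<le> \<bar>u i0\<bar>"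
      proof -
        have "Max ((\<lambda>i. \<bar>u i\<bar>) ` {..n}) \<in> (\<lambda>i. \<bar>u i\<bar>) ` {..n}" by (intro Max_in) auto
        then obtain i0 where "i0 \<le> n" "Max ((\<lambda>i. \<bar>u i\<bar>) ` {..n}) = \<bar>u i0\<bar>"
          by (metis (no_types, lifting) atMost_iff imageE)
        then show ?thesis using that[of i0] by (metis Max_ge atMost_iff finite_atMost finite_imageI image_eqI)
      qed
      have ui0: "0 < \<bar>u i0\<bar>" using u(1) i0(2) by force
      have dominated: "\<bar>w p i0\<bar> \<le> (\<Sum>i\<in>{..n} - {i0}. \<bar>w p i\<bar>)" if p: "p \<in> rp.span (real_poly ` set ps)" for p
      proof -
        have "u i0 * w p i0 + (\<Sum>i\<in>{..n} - {i0}. u i * w p i) = 0"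
          using van[OF p] sum.remove[of "{..n}" i0 "\<lambda>i. u i * w p i"] i0(1) by simp
        then have "u i0 * w p i0 = - (\<Sum>i\<in>{..n} - {i0}. u i * w p i)" by linarith
        then have "\<bar>u i0\<bar> * \<bar>w p i0\<bar> = \<bar>\<Sum>i\<in>{..n} - {i0}. u i * w p i\<bar>" by (metis abs_minus_cancel abs_mult)
        also have "\<dots> \<le> (\<Sum>i\<in>{..n} - {i0}. \<bar>u i * w p i\<bar>)" by (rule sum_abs)
        also have "\<dots> \<le> (\<Sum>i\<in>{..n} - {i0}. \<bar>u i0\<bar> * \<bar>w p i\<bar>)"
          using i0(2) by (intro sum_mono) (auto simp: abs_mult intro!: mult_right_mono)
        also have "\<dots> = \<bar>u i0\<bar> * (\<Sum>i\<in>{..n} - {i0}. \<bar>w p i\<bar>)" by (simp add: sum_distrib_left)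
        finally show ?thesis using ui0 by simp
      qed
      define h where "h = real (n + 1) / \<delta>"
      have h: "0 < h" using \<delta> by (simp add: h_def)
      define g where "g = (\<lambda>P. \<lambda>i\<in>{..n} - {i0}. \<lfloor>w (real_poly (P - P0)) i * h\<rfloor>)"
      define M where "M = \<lceil>R * h\<rceil>"
      have "0 < R * h" using R h by simp
      then have M0: "0 \<le> M" unfolding M_def by linarith
      have inj: "inj_on g A"
      proof (rule inj_onI, rule ccontr)
        fix P Q assume PQ: "P \<in> A" "Q \<in> A" "g P = g Q" "P \<noteq> Q"
        define d where "d = P - Q"
        have d: "d \<noteq> 0" "degree d \<le> n" using PQ A(3) by (auto simp: d_def intro: degree_diff_le)
        have w_d: "w (real_poly d) i = w (real_poly (P - P0)) i - w (real_poly (Q - P0)) i" for i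
          by (simp add: d_def w_def real_poly_diff taylor_coeff_diff diff_divide_distrib)
        have small: "\<bar>w (real_poly d) i\<bar> \<le> 1 / h" if i: "i \<in> {..n} - {i0}" for i
        proof -
          have "\<lfloor>w (real_poly (P - P0)) i * h\<rfloor> = \<lfloor>w (real_poly (Q - P0)) i * h\<rfloor>"
            using fun_cong[OF PQ(3), of i] i by (simp add: g_def)
          then have "\<bar>w (real_poly (P - P0)) i * h - w (real_poly (Q - P0)) i * h\<bar> < 1" by linarith
          then have "\<bar>w (real_poly d) i\<bar> * h < 1"
            using h by (simp add: w_d left_diff_distrib[symmetric] abs_mult)
          then show ?thesis using h by (simp add: pos_le_divide_eq)
        qed
        have "real_poly d = real_poly (P - P0) - real_poly (Q - P0)" by (simp add: d_def real_poly_diff)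
        also have "\<dots> \<in> rp.span (real_poly ` D)"
          using PQ by (intro rp.span_diff rp.span_base) (auto simp: D_def)
        finally have "real_poly d \<in> rp.span (real_poly ` set ps)" using ps(1) by (simp add: int_basis_def)
        then have "\<bar>w (real_poly d) i0\<bar> \<le> (\<Sum>i\<in>{..n} - {i0}. \<bar>w (real_poly d) i\<bar>)" by (rule dominated)
        also have "\<dots> \<le> (\<Sum>i\<in>{..n} - {i0}. 1 / h)" using small by (intro sum_mono)
        also have "\<dots> = real n / h" using i0(1) by (simp add: card_Diff_singleton)
        finally have wi0: "\<bar>w (real_poly d) i0\<bar> \<le> real n / h" .
        have "real n / h \<le> real (n + 1) / h" "1 / h \<le> real (n + 1) / h"
          using h by (intro divide_right_mono; simp)+
        then have "\<bar>w (real_poly d) i\<bar> \<le> real (n + 1) / h" if "i \<le> n" for i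
          using small[of i] wi0 that by (cases "i = i0") (simp, force)
        moreover have "real (n + 1) / h = \<delta>" using \<delta> by (simp add: h_def)
        ultimately have w_le: "\<bar>w (real_poly d) i\<bar> \<le> \<delta>" if "i \<le> n" for i using that by metis
        obtain i where i: "i \<le> n" "\<delta> * \<xi> i < \<bar>int_taylor d x i\<bar>"
          using nsv d unfolding no_short_vector_def by blast
        have "\<bar>int_taylor d x i\<bar> / \<xi> i \<le> \<delta>"
          using w_le[OF i(1)] \<xi>pos[OF i(1)] by (simp add: w_def abs_divide)
        then show False using i(2) \<xi>pos[OF i(1)] by (simp add: pos_divide_le_eq)
      qed
      have g: "g ` A \<subseteq> (\<Pi>\<^sub>E i\<in>{..n} - {i0}. {-M..M})"
      proof
        fix y assume "y \<in> g ` A"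
        then obtain P where P: "P \<in> A" "y = g P" by blast
        have "\<lfloor>w (real_poly (P - P0)) i * h\<rfloor> \<in> {-M..M}" if i: "i \<le> n" for i
        proof -
          have "\<bar>w (real_poly (P - P0)) i\<bar> \<le> R"
            using A(4)[OF P(1) P0 i] \<xi>pos[OF i] by (simp add: w_def abs_divide pos_divide_le_eq)
          then have "\<bar>w (real_poly (P - P0)) i * h\<bar> \<le> R * h" using h by (simp add: abs_mult)
          moreover have "R * h \<le> of_int M" unfolding M_def by (rule le_of_int_ceiling)
          ultimately have z: "\<bar>w (real_poly (P - P0)) i * h\<bar> \<le> of_int M" by linarith
          have "- M \<le> \<lfloor>w (real_poly (P - P0)) i * h\<rfloor>" using z by (simp add: le_floor_iff)
          moreover have "\<lfloor>w (real_poly (P - P0)) i * h\<rfloor> \<le> M" using z by (simp add: floor_le_iff)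
          ultimately show ?thesis by simp
        qed
        then show "y \<in> (\<Pi>\<^sub>E i\<in>{..n} - {i0}. {-M..M})" by (auto simp: P g_def)
      qed
      have "card A \<le> card (\<Pi>\<^sub>E i\<in>{..n} - {i0}. {-M..M})"
        using card_inj_on_le[OF inj g] by (simp add: finite_PiE)
      also have "\<dots> = (nat (2 * M + 1)) ^ n" using i0(1) M0 by (simp add: card_PiE card_Diff_singleton)
      finally have "real (card A) \<le> real (nat (2 * M + 1)) ^ n" by (metis of_nat_le_iff of_nat_power)
      also have "\<dots> \<le> (R * K) ^ n"
      proof (rule power_mono)
        have "real (nat (2 * M + 1)) = 2 * of_int M + 1" using M0 by simp
        also have "real_of_int M \<le> R * h + 1" unfolding M_def by (rule of_int_ceiling_le_add_one)
        finally have "real (nat (2 * M + 1)) \<le> 2 * (R * h + 1) + 1" by simp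
        also have "\<dots> \<le> 2 * (R * h) + 3 * R" using R by simp
        also have "\<dots> = R * K" by (simp add: K_def h_def algebra_simps)
        finally show "real (nat (2 * M + 1)) \<le> R * K" .
      qed simp
      finally have "(R / 2) ^ (n + 1) \<le> (R * K) ^ n" using A(2) by linarith
      then have "R ^ n * R \<le> R ^ n * (2 ^ (n + 1) * K ^ n)"
        by (simp add: power_divide power_mult_distrib divide_le_eq mult_ac)
      then have "R \<le> 2 ^ (n + 1) * K ^ n" using R by (subst (asm) mult_le_cancel_left_pos) auto
      then show False by (simp add: R_def)
    qed
    then show "\<exists>ps W. int_basis n ps W \<and> length ps = n + 1 \<and>
        (\<forall>p\<in>set ps. \<forall>i\<le>n. \<bar>int_taylor p x i\<bar> \<le> R * \<xi> i)"
      using ps bound by (intro exI[of _ ps] exI[of _ "rp.span (real_poly ` D)"]) auto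
  qed
qed


section \<open>Polynomials with prescribed size and residue class\<close>

lemma adjugate_solves:
  fixes A :: "'a::comm_ring_1 mat"
  assumes A: "A \<in> carrier_mat N N"
  shows "\<exists>c. \<forall>i<N. (\<Sum>j<N. A $$ (i, j) * c j) = det A * y i"
proof -
  define v where "v = adj_mat A *\<^sub>v vec N y"
  have adj: "adj_mat A \<in> carrier_mat N N" "A * adj_mat A = det A \<cdot>\<^sub>m 1\<^sub>m N" using adj_mat[OF A] by auto
  have c: "v \<in> carrier_vec N" using adj(1) by (simp add: v_def)
  have "A *\<^sub>v v = (A * adj_mat A) *\<^sub>v vec N y" using A adj(1) by (simp add: v_def)
  also have "\<dots> = (det A \<cdot>\<^sub>m 1\<^sub>m N) *\<^sub>v vec N y" by (simp only: adj(2))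
  finally have eq: "A *\<^sub>v v = (det A \<cdot>\<^sub>m 1\<^sub>m N) *\<^sub>v vec N y" .
  show ?thesis
  proof (intro exI[of _ "\<lambda>j. v $ j"] allI impI)
    fix i assume i: "i < N"
    have "(\<Sum>j<N. A $$ (i, j) * v $ j) = (A *\<^sub>v v) $ i"
      using i A c by (auto simp: scalar_prod_def atLeast0LessThan intro!: sum.cong)
    also have "\<dots> = (\<Sum>j<N. det A * (if j = i then 1 else 0) * y j)"
      unfolding eq using i by (auto simp: scalar_prod_def atLeast0LessThan intro!: sum.cong)
    also have "\<dots> = (\<Sum>j<N. if j = i then det A * y i else 0)" by (intro sum.cong) auto
    also have "\<dots> = det A * y i" using i by simp
    finally show "(\<Sum>j<N. A $$ (i, j) * v $ j) = det A * y i" .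
  qed
qed

lemma abs_det_le:
  fixes A :: "real mat"
  assumes A: "A \<in> carrier_mat N N" and le: "\<And>i j. i < N \<Longrightarrow> j < N \<Longrightarrow> \<bar>A $$ (i, j)\<bar> \<le> B i"
  shows "\<bar>det A\<bar> \<le> fact N * (\<Prod>i<N. B i)"
proof -
  have "\<bar>det A\<bar> \<le> (\<Sum>\<pi>\<in>{\<pi>. \<pi> permutes {0..<N}}. \<bar>signof \<pi> * (\<Prod>i = 0..<N. A $$ (i, \<pi> i))\<bar>)"
    unfolding det_def'[OF A] by (rule sum_abs)
  also have "\<dots> \<le> (\<Sum>\<pi>\<in>{\<pi>. \<pi> permutes {0..<N}}. (\<Prod>i<N. B i))"
  proof (rule sum_mono)
    fix \<pi> assume "\<pi> \<in> {\<pi>. \<pi> permutes {0..<N}}"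
    then have \<pi>: "\<pi> permutes {0..<N}" by simp
    have "\<bar>signof \<pi> * (\<Prod>i = 0..<N. A $$ (i, \<pi> i))\<bar> = (\<Prod>i<N. \<bar>A $$ (i, \<pi> i)\<bar>)"
      by (simp add: abs_mult abs_prod sign_def atLeast0LessThan)
    also have "\<dots> \<le> (\<Prod>i<N. B i)"
      using permutes_in_image[OF \<pi>] le by (intro prod_mono) auto
    finally show "\<bar>signof \<pi> * (\<Prod>i = 0..<N. A $$ (i, \<pi> i))\<bar> \<le> (\<Prod>i<N. B i)" .
  qed
  also have "\<dots> = fact N * (\<Prod>i<N. B i)" by (simp add: card_permutations)
  finally show ?thesis .
qed

text \<open>
  Taylor coefficients at \<open>x\<close> can be prescribed up to an error \<open>E\<close> in the units \<open>\<xi>\<close>, together with a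
  residue class modulo \<open>p\<^sup>2\<close>; \<open>P\<^sub>0\<close> may carry a leading term of higher degree.
\<close>

definition tailorable :: "nat \<Rightarrow> nat \<Rightarrow> real \<Rightarrow> (nat \<Rightarrow> real) \<Rightarrow> real \<Rightarrow> bool" where
  "tailorable n p E \<xi> x \<longleftrightarrow> (\<forall>P\<^sub>0 T t. degree T \<le> n \<longrightarrow>
     (\<exists>P::int poly. degree (P - P\<^sub>0) \<le> n \<and> (\<forall>i. (int p)\<^sup>2 dvd coeff (P - P\<^sub>0 - T) i) \<and>
        (\<forall>i\<le>n. \<bar>int_taylor P x i - t i\<bar> \<le> E * \<xi> i)))"

text \<open>
  Take a basis \<open>ps\<close> of short vectors. Its coefficient determinant is bounded, so a fixed prime \<open>p\<close>
  exceeds it, and \<open>ps\<close> is also a basis modulo \<open>p\<^sup>2\<close>. The real combination of \<open>ps\<close> with Taylor coefficients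
  exactly \<open>t\<close> is then rounded to integers in the residue classes modulo \<open>p\<^sup>2\<close> that represent \<open>T\<close>.
\<close>

lemma tailored_int_poly:
  assumes \<delta>: "0 < \<delta>"
  shows "\<exists>p::nat. \<exists>E\<ge>1. prime p \<and> (\<forall>\<xi> x. (\<forall>i\<le>n. 0 < \<xi> i) \<longrightarrow> (\<Prod>i\<le>n. \<xi> i) = 1 \<longrightarrow>
     no_short_vector n \<delta> \<xi> x \<longrightarrow> tailorable n p E \<xi> x)"
proof -
  let ?N = "n + 1"
  obtain R where R: "1 \<le> R" and short: "\<forall>\<xi> x. (\<forall>i\<le>n. 0 < \<xi> i) \<longrightarrow> (\<Prod>i\<le>n. \<xi> i) = 1 \<longrightarrow> no_short_vector n \<delta> \<xi> x \<longrightarrow>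
     (\<exists>ps W. int_basis n ps W \<and> length ps = ?N \<and>
        (\<forall>p\<in>set ps. \<forall>i\<le>n. \<bar>int_taylor p x i\<bar> \<le> R * \<xi> i))"
    using short_basis_exists[OF \<delta>, of n] by (elim exE conjE)
  obtain p :: nat where p: "prime p" "nat \<lceil>fact ?N * R ^ ?N\<rceil> < p"
    using bigger_prime[of "nat \<lceil>fact ?N * R ^ ?N\<rceil>"] by blast
  define E where "E = real ?N * (real p)\<^sup>2 * R"
  have p1: "1 \<le> real p" using p(1) prime_ge_1_nat of_nat_1 of_nat_le_iff by metis
  have "1 * 1 * 1 \<le> E" unfolding E_def using p1 R
    by (intro mult_mono) (auto simp: one_le_power)
  then have E: "1 \<le> E" by simp
  show ?thesis
    unfolding tailorable_def
  proof (rule exI[of _ p], rule exI[of _ E], intro conjI allI impI E p(1))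
    fix \<xi> :: "nat \<Rightarrow> real" and x :: real and P\<^sub>0 T :: "int poly" and t :: "nat \<Rightarrow> real"
    assume \<xi>: "\<forall>i\<le>n. 0 < \<xi> i" "(\<Prod>i\<le>n. \<xi> i) = 1" and nsv: "no_short_vector n \<delta> \<xi> x" and T: "degree T \<le> n"
    obtain ps W where ps: "int_basis n ps W" "length ps = ?N"
      and bound: "\<forall>p\<in>set ps. \<forall>i\<le>n. \<bar>int_taylor p x i\<bar> \<le> R * \<xi> i"
      using short[rule_format, of \<xi> x] \<xi> nsv by blast
    have mem: "ps ! j \<in> set ps" if "j < ?N" for j using that ps(2) by simp
    define C where "C = mat ?N ?N (\<lambda>(a, b). coeff (ps ! b) a)"
    define M where "M = taylor_mat [0..<?N] (map real_poly ps) x"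
    have C: "C \<in> carrier_mat ?N ?N" by (simp add: C_def)
    have M: "M \<in> carrier_mat ?N ?N"
      using taylor_mat_carrier[of "[0..<?N]" "map real_poly ps" x] ps(2) by (simp add: M_def)
    have M_ij: "M $$ (i, j) = taylor_coeff (real_poly (ps ! j)) x i" if "i < ?N" "j < ?N" for i j
      using that ps(2) by (simp add: M_def taylor_mat_def del: upt_Suc)
    have minor: "int_minor [0..<?N] ps z = of_int (det C)" for z
    proof -
      have "int_minor [0..<?N] ps z =
          det (mat ?N ?N (\<lambda>(a, b). coeff (map real_poly ps ! b) a))"
        using ps(2) int_basis_real(4)[OF ps(1)] by (intro full_taylor_minor_eq_det_coeff) auto
      also have "mat ?N ?N (\<lambda>(a, b). coeff (map real_poly ps ! b) a) = map_mat real_of_int C"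
        using ps(2) by (intro eq_matI) (auto simp: C_def)
      finally show ?thesis by (simp add: of_int_hom.hom_det)
    qed
    have detM: "det M = of_int (det C)" using minor[of x] by (simp add: M_def taylor_minor_def)
    have detC: "det C \<noteq> 0"
      using wronskian_nonzero_int[OF ps(1)] minor ps(2) by (metis of_int_0)
    have "\<bar>det M\<bar> \<le> fact ?N * (\<Prod>i<?N. R * \<xi> i)"
      using bound mem by (intro abs_det_le[OF M]) (auto simp: M_ij)
    also have "(\<Prod>i<?N. R * \<xi> i) = R ^ ?N" using \<xi>(2) by (simp add: prod.distrib lessThan_Suc_atMost)
    finally have "\<bar>det C\<bar> \<le> \<lceil>fact ?N * R ^ ?N\<rceil>" unfolding detM by linarith
    then have "\<bar>det C\<bar> < int p" using p(2) by linarith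
    then have "\<not> int p dvd det C" using detC zdvd_not_zless[of "\<bar>det C\<bar>" "int p"] by auto
    then have "coprime (int p) (det C)" using p(1) by (intro prime_imp_coprime) auto
    then have "coprime (det C) ((int p)\<^sup>2)" by (simp add: coprime_commute)
    then have gcd1: "gcd (det C) ((int p)\<^sup>2) = 1" by simp
    obtain e f where e: "e * det C + f * (int p)\<^sup>2 = 1"
      using bezout_int[of "det C" "(int p)\<^sup>2"] unfolding gcd1 by blast
    obtain b where b: "\<forall>i<?N. (\<Sum>j<?N. M $$ (i, j) * b j) =
        det M * ((t i - taylor_coeff (real_poly P\<^sub>0) x i) / det M)"
      using adjugate_solves[OF M, of "\<lambda>i. (t i - taylor_coeff (real_poly P\<^sub>0) x i) / det M"] by (elim exE)
    obtain c where c: "\<forall>i<?N. (\<Sum>j<?N. C $$ (i, j) * c j) = det C * coeff T i"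
      using adjugate_solves[OF C, of "coeff T"] by (elim exE)
    \<comment> \<open>\<open>s\<close> represents \<open>T\<close> modulo \<open>p\<^sup>2\<close>, and \<open>a j\<close> is congruent to \<open>s j\<close> and within \<open>p\<^sup>2\<close> of \<open>b j\<close>\<close>
    define s where "s = (\<lambda>j. e * c j)"
    define a where "a = (\<lambda>j. s j + (int p)\<^sup>2 * \<lfloor>(b j - of_int (s j)) / (real p)\<^sup>2\<rfloor>)"
    define P where "P = P\<^sub>0 + (\<Sum>j<?N. smult (a j) (ps ! j))"
    have "degree (\<Sum>j<?N. smult (a j) (ps ! j)) \<le> n"
      using int_basis_real(4)[OF ps(1)] mem
      by (intro degree_sum_le finite_lessThan order_trans[OF degree_smult_le]) blast
    then have deg: "degree (P - P\<^sub>0) \<le> n" by (simp add: P_def del: sum.lessThan_Suc)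
    moreover have "(int p)\<^sup>2 dvd coeff (P - P\<^sub>0 - T) i" for i
    proof (cases "i < ?N")
      case True
      have "coeff (P - P\<^sub>0 - T) i = (\<Sum>j<?N. a j * coeff (ps ! j) i) - coeff T i"
        by (simp add: P_def coeff_sum del: sum.lessThan_Suc)
      also have "(\<Sum>j<?N. a j * coeff (ps ! j) i) = (\<Sum>j<?N. s j * coeff (ps ! j) i) +
          (int p)\<^sup>2 * (\<Sum>j<?N. \<lfloor>(b j - of_int (s j)) / (real p)\<^sup>2\<rfloor> * coeff (ps ! j) i)"
        unfolding sum_distrib_left sum.distrib[symmetric] by (intro sum.cong) (auto simp: a_def algebra_simps)
      also have "(\<Sum>j<?N. s j * coeff (ps ! j) i) = e * (\<Sum>j<?N. C $$ (i, j) * c j)"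
        unfolding sum_distrib_left using True by (intro sum.cong) (auto simp: s_def C_def)
      also have "\<dots> = e * (det C * coeff T i)" using c True by simp
      finally have "coeff (P - P\<^sub>0 - T) i = (det C * e - 1) * coeff T i +
          (int p)\<^sup>2 * (\<Sum>j<?N. \<lfloor>(b j - of_int (s j)) / (real p)\<^sup>2\<rfloor> * coeff (ps ! j) i)"
        by (simp add: algebra_simps)
      moreover have "(int p)\<^sup>2 dvd det C * e - 1" 
        by (rule dvdI[of _ _ "- f"]) (use e in \<open>simp add: algebra_simps\<close>)
      ultimately show ?thesis by simp
    next
      case False
      then have "coeff (P - P\<^sub>0) i = 0" "coeff T i = 0" using deg T
        by (intro coeff_eq_0; linarith)+
      then show ?thesis by (simp only: coeff_diff[of _ T] diff_0_right dvd_0_right)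
    qed
    moreover have "\<bar>int_taylor P x i - t i\<bar> \<le> E * \<xi> i" if i: "i \<le> n" for i
    proof -
      have iN: "i < ?N" using i by simp
      have dM: "det M \<noteq> 0" using detM detC by simp
      have "t i = taylor_coeff (real_poly P\<^sub>0) x i + (\<Sum>j<?N. M $$ (i, j) * b j)"
        using b iN dM by simp
      moreover have "int_taylor P x i = taylor_coeff (real_poly P\<^sub>0) x i +
          (\<Sum>j<?N. M $$ (i, j) * of_int (a j))"
        unfolding P_def real_poly_add real_poly_sum real_poly_smult taylor_coeff_add taylor_coeff_sum taylor_coeff_smult
        using iN by (auto simp: M_ij mult.commute intro!: sum.cong)
      ultimately have "\<bar>int_taylor P x i - t i\<bar> = \<bar>\<Sum>j<?N. M $$ (i, j) * (of_int (a j) - b j)\<bar>"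
        by (simp add: sum_subtractf right_diff_distrib del: sum.lessThan_Suc)
      also have "\<dots> \<le> (\<Sum>j<?N. \<bar>M $$ (i, j) * (of_int (a j) - b j)\<bar>)" by (rule sum_abs)
      also have "\<dots> \<le> (\<Sum>j<?N. R * \<xi> i * (real p)\<^sup>2)"
      proof (rule sum_mono)
        fix j assume "j \<in> {..<?N}"
        then have j: "j < ?N" by simp
        have pp: "0 < (real p)\<^sup>2" using p1 by simp
        define z where "z = (b j - of_int (s j)) / (real p)\<^sup>2"
        have "of_int (a j) - b j = (real p)\<^sup>2 * (of_int \<lfloor>z\<rfloor> - z)"
          using pp by (simp add: a_def z_def right_diff_distrib)
        then have "\<bar>of_int (a j) - b j\<bar> = (real p)\<^sup>2 * \<bar>of_int \<lfloor>z\<rfloor> - z\<bar>" using pp by (simp add: abs_mult)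
        also have "\<bar>of_int \<lfloor>z\<rfloor> - z\<bar> \<le> 1" by linarith
        finally have "\<bar>of_int (a j) - b j\<bar> \<le> (real p)\<^sup>2" using pp by simp
        moreover have "\<bar>M $$ (i, j)\<bar> \<le> R * \<xi> i" using bound mem[OF j] i M_ij[OF iN j] by simp
        ultimately show "\<bar>M $$ (i, j) * (of_int (a j) - b j)\<bar> \<le> R * \<xi> i * (real p)\<^sup>2"
          unfolding abs_mult using R \<xi>(1) i by (intro mult_mono) auto
      qed
      also have "\<dots> = E * \<xi> i" by (simp add: E_def algebra_simps)
      finally show ?thesis .
    qed
    ultimately show "\<exists>P::int poly. degree (P - P\<^sub>0) \<le> n \<and> (\<forall>i. (int p)\<^sup>2 dvd coeff (P - P\<^sub>0 - T) i) \<and>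
        (\<forall>i\<le>n. \<bar>int_taylor P x i - t i\<bar> \<le> E * \<xi> i)" by blast
  qed
qed


section \<open>Eisenstein's criterion\<close>

text \<open>
  If \<open>k\<close> is the first index with \<open>p\<close> not dividing the coefficient of \<open>f\<close>, then modulo \<open>p\<close> the \<open>k\<close>-th
  coefficient of \<open>f * g\<close> is that of \<open>f\<close> times the constant term of \<open>g\<close>; so \<open>k\<close> is the full degree.
\<close>

lemma eisenstein_factor:
  fixes f g :: "int poly"
  assumes p: "prime p" and inner: "\<And>i. i < degree (f * g) \<Longrightarrow> p dvd coeff (f * g) i"
    and f0: "p dvd coeff f 0" and g0: "\<not> p dvd coeff g 0" and lead: "\<not> p dvd lead_coeff f"
    and nz: "f \<noteq> 0" "g \<noteq> 0"
  shows "degree g = 0"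
proof -
  define k where "k = (LEAST k. \<not> p dvd coeff f k)"
  have k: "\<not> p dvd coeff f k" unfolding k_def by (rule LeastI[of "\<lambda>k. \<not> p dvd coeff f k", OF lead])
  have below: "p dvd coeff f i" if "i < k" for i
    using not_less_Least[of i "\<lambda>k. \<not> p dvd coeff f k"] that unfolding k_def by blast
  have "k \<le> degree f" unfolding k_def by (rule Least_le[of "\<lambda>k. \<not> p dvd coeff f k", OF lead])
  have "coeff (f * g) k = (\<Sum>i\<le>k. coeff f i * coeff g (k - i))" by (rule coeff_mult)
  also have "\<dots> = (\<Sum>i<k. coeff f i * coeff g (k - i)) + coeff f k * coeff g 0"
    by (simp add: lessThan_Suc_atMost[symmetric])
  finally have "coeff (f * g) k = (\<Sum>i<k. coeff f i * coeff g (k - i)) + coeff f k * coeff g 0" .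
  moreover have "p dvd (\<Sum>i<k. coeff f i * coeff g (k - i))"
    using below by (intro dvd_sum dvd_mult2) auto
  moreover have "\<not> p dvd coeff f k * coeff g 0"
    using k g0 p by (simp add: prime_dvd_mult_iff)
  ultimately have "\<not> p dvd coeff (f * g) k" by (simp add: dvd_add_right_iff)
  then have "degree (f * g) \<le> k" using inner not_le by blast
  then show ?thesis using \<open>k \<le> degree f\<close> degree_mult_eq[OF nz] by simp
qed

lemma eisenstein:
  fixes P f g :: "int poly"
  assumes p: "prime p" and lead: "\<not> p dvd lead_coeff P"
    and inner: "\<And>i. i < degree P \<Longrightarrow> p dvd coeff P i" and const: "\<not> p\<^sup>2 dvd coeff P 0"
    and deg: "0 < degree P" and fact: "P = f * g"
  shows "degree f = 0 \<or> degree g = 0"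
proof -
  have nz: "f \<noteq> 0" "g \<noteq> 0" using fact deg by auto
  have c0: "coeff P 0 = coeff f 0 * coeff g 0" by (simp add: fact coeff_mult)
  have lf: "\<not> p dvd lead_coeff f" "\<not> p dvd lead_coeff g"
    using lead unfolding fact lead_coeff_mult by (auto intro: dvd_mult dvd_mult2)
  have "p dvd coeff f 0 * coeff g 0" using inner[OF deg] c0 by simp
  moreover have "\<not> (p dvd coeff f 0 \<and> p dvd coeff g 0)"
    using const unfolding c0 power2_eq_square by (auto intro: mult_dvd_mono)
  ultimately consider "p dvd coeff f 0" "\<not> p dvd coeff g 0" | "p dvd coeff g 0" "\<not> p dvd coeff f 0"
    using p by (auto simp: prime_dvd_mult_iff)
  then show ?thesis
  proof cases
    case 1
    have "degree g = 0"
      by (rule eisenstein_factor[OF p inner[unfolded fact] 1 lf(1) nz])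
    then show ?thesis ..
  next
    case 2
    have "degree f = 0"
      by (rule eisenstein_factor[OF p _ 2 lf(2) nz(2,1)])
        (use inner in \<open>simp add: fact mult.commute[of g f]\<close>)
    then show ?thesis ..
  qed
qed

text \<open>
  The constant \<open>c\<close> is the content up to sign. It has to be kept, because the height refers to \<open>q\<close>.
\<close>

lemma eisenstein_min_int_poly:
  fixes P :: "int poly"
  assumes p: "prime p" and lead: "\<not> p dvd lead_coeff P"
    and inner: "\<And>i. i < degree P \<Longrightarrow> p dvd coeff P i" and const: "\<not> p\<^sup>2 dvd coeff P 0"
    and deg: "0 < degree P"
  obtains c q where "c \<noteq> 0" "P = smult c q" "irreducible (map_poly rat_of_int q)" "content q = 1" "0 < lead_coeff q"
proof -
  define q0 where "q0 = primitive_part P"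
  have P0: "P \<noteq> 0" using deg by auto
  have Pq: "P = smult (content P) q0" unfolding q0_def by simp
  have cP: "content P \<noteq> 0" using P0 by simp
  have cq: "content q0 = 1" unfolding q0_def using P0 by simp
  have dq: "degree q0 = degree P" by (simp add: q0_def)
  have irr: "irreducible q0"
  proof (rule irreducibleI)
    show "q0 \<noteq> 0" using dq deg by auto
    show "\<not> q0 dvd 1" using dq deg by (auto elim!: is_unit_polyE)
    fix f g assume fg: "q0 = f * g"
    then have "P = smult (content P) f * g" using Pq by simp
    from eisenstein[OF p lead inner const deg this] have "degree f = 0 \<or> degree g = 0"
      using cP by simp
    moreover have unit: "h dvd 1" if h: "degree h = 0" "h dvd q0" for h :: "int poly"
    proof -
      obtain a where a: "h = [:a:]" using h(1) by (rule degree_eq_zeroE)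
      then have "a dvd content q0" using h(2) by (simp add: const_poly_dvd_iff_dvd_content)
      then show ?thesis using cq a by (simp add: is_unit_const_poly_iff)
    qed
    ultimately show "f dvd 1 \<or> g dvd 1" using fg by (metis dvd_triv_left dvd_triv_right)
  qed
  define s where "s = sgn (lead_coeff q0)"
  have "q0 \<noteq> 0" using P0 Pq by auto
  then have lq: "lead_coeff q0 \<noteq> 0" by (simp only: leading_coeff_0_iff not_False_eq_True)
  then have s: "s = 1 \<or> s = -1" "s * s = 1" by (auto simp: s_def sgn_if)
  define q where "q = smult s q0"
  have "irreducible q"
  proof -
    have "q = q0 \<or> q = - q0" using s(1) by (auto simp: q_def)
    then show ?thesis using irr irreducible_mult_unit_left[of "- 1" q0] by auto
  qed
  moreover have "degree q = degree P" using s dq by (auto simp: q_def)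
  ultimately have "irreducible (map_poly rat_of_int q)"
    using deg by (intro irreducible_int_imp_irreducible_rat) auto
  moreover have "content q = 1" using cq s by (auto simp: q_def)
  moreover have "0 < lead_coeff q"
  proof -
    have "lead_coeff q = s * lead_coeff q0" by (simp add: q_def)
    also have "\<dots> = \<bar>lead_coeff q0\<bar>" by (simp only: s_def abs_sgn mult.commute)
    finally show ?thesis using lq by (simp only: zero_less_abs_iff not_False_eq_True)
  qed
  moreover have "smult (content P * s) q = smult (content P) q0"
    using s(2) by (simp add: q_def mult.assoc)
  then have "P = smult (content P * s) q" using Pq by simp
  moreover have "content P * s \<noteq> 0" using cP s by auto
  ultimately show ?thesis using that by blast
qed

lemma min_int_poly_eqI:
  assumes "is_min_int_poly q \<alpha>" shows "min_int_poly \<alpha> = q"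
  unfolding min_int_poly_def using assms is_min_int_poly_unique by (intro the_equality) blast+

section \<open>Two close roots\<close>

text \<open>
  In the variable \<open>y\<close> with \<open>X = x + q y\<close>, the polynomial divided by \<open>A\<close> is \<open>f0 + f1 y + f2 y\<^sup>2\<close> up to a
  small error, with \<open>\<bar>f0\<bar> \<le> E w\<close>, \<open>7 E \<le> f1 \<le> 9 E\<close> and \<open>E \<le> f2 \<le> 3 E\<close>. It is positive at \<open>w / 2\<close>, negative at
  \<open>- w / 2\<close> and at \<open>- 1\<close>, and positive at \<open>- 11\<close>; the two sign changes give the two roots.
\<close>

lemma two_close_roots:
  fixes F :: "real poly" and A q w E x :: real
  defines "c \<equiv> taylor_coeff F x"
  assumes m: "2 \<le> m" "degree F \<le> m" and A: "0 < A" and q: "0 < q" "q \<le> 1" "real m * 11 ^ m * q \<le> 1/11"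
    and w: "0 < w" "w \<le> 1" and E: "0 < E"
    and c0: "\<bar>c 0\<bar> \<le> E * (A * w)"
    and c1: "\<bar>c 1 - 8 * E * (A / q)\<bar> \<le> E * (A / q)"
    and c2: "\<bar>c 2 - 2 * E * (A / q\<^sup>2)\<bar> \<le> E * (A / q\<^sup>2)"
    and c3: "\<And>i. 3 \<le> i \<Longrightarrow> i \<le> m \<Longrightarrow> \<bar>c i\<bar> \<le> E * (A / q\<^sup>2)"
  obtains u v where "poly F u = 0" "poly F v = 0" "\<bar>u - x\<bar> < q * w"
    "q / 2 \<le> \<bar>u - v\<bar>" "\<bar>u - v\<bar> \<le> 12 * q"
proof -
  define f0 where "f0 = c 0 / A"
  define f1 where "f1 = c 1 * q / A"
  define f2 where "f2 = c 2 * q\<^sup>2 / A"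
  have AA: "0 < A / q" "0 < A / q\<^sup>2" using A q by auto
  have f0: "\<bar>f0\<bar> \<le> E * w" using c0 A by (simp add: f0_def abs_divide pos_divide_le_eq mult_ac)
  have f1: "7 * E \<le> f1" "f1 \<le> 9 * E"
  proof -
    define B where "B = E * (A / q)"
    have "7 * B \<le> c 1" "c 1 \<le> 9 * B" using c1 unfolding B_def[symmetric] mult.assoc by linarith+
    then show "7 * E \<le> f1" "f1 \<le> 9 * E" using A q by (simp_all add: f1_def B_def field_simps)
  qed
  have f2: "E \<le> f2" "f2 \<le> 3 * E"
  proof -
    define B where "B = E * (A / q\<^sup>2)"
    have "B \<le> c 2" "c 2 \<le> 3 * B" using c2 unfolding B_def[symmetric] mult.assoc by linarith+
    then show "E \<le> f2" "f2 \<le> 3 * E" using A q by (simp_all add: f2_def B_def field_simps)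
  qed
  define rem where "rem = (\<lambda>y. (\<Sum>i = 3..m. c i * (q * y) ^ i) / A)"
  have shifted: "poly F (x + q * y) = A * (f0 + f1 * y + f2 * y\<^sup>2 + rem y)" for y
  proof -
    have "{..m} = {0, 1, 2} \<union> {3..m}" using m(1) by auto
    then have "poly F (x + q * y) = (\<Sum>i\<in>{0, 1, 2} \<union> {3..m}. c i * (q * y) ^ i)"
      using poly_taylor[OF m(2), of x "q * y"] by (simp add: c_def)
    also have "\<dots> = (\<Sum>i\<in>{0, 1, 2}. c i * (q * y) ^ i) + (\<Sum>i = 3..m. c i * (q * y) ^ i)"
      by (rule sum.union_disjoint) auto
    also have "\<dots> = A * (f0 + f1 * y + f2 * y\<^sup>2 + rem y)"
      using A by (simp add: f0_def f1_def f2_def rem_def power_mult_distrib distrib_left mult_ac)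
    finally show ?thesis .
  qed
  have rem_le: "\<bar>rem y\<bar> \<le> E * \<bar>y\<bar> / 11" if y: "\<bar>y\<bar> \<le> 11" for y
  proof -
    have summand: "\<bar>c i * (q * y) ^ i\<bar> \<le> E * A * (\<bar>y\<bar> * 11 ^ m * q)" if i: "i \<in> {3..m}" for i
    proof -
      have "\<bar>c i * (q * y) ^ i\<bar> = \<bar>c i\<bar> * (q ^ i * \<bar>y\<bar> ^ i)"
        using q by (simp add: abs_mult power_abs power_mult_distrib)
      also have "\<dots> \<le> E * (A / q\<^sup>2) * (q ^ i * \<bar>y\<bar> ^ i)"
        using c3[of i] i q by (intro mult_right_mono) auto
      also have "\<dots> = E * A * (q ^ (i - 2) * \<bar>y\<bar> ^ i)"
      proof -
        have "3 \<le> i" using i by simp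
        then have "i = 2 + (i - 2)" by linarith
        then have "q ^ i = q\<^sup>2 * q ^ (i - 2)" by (metis power_add)
        then show ?thesis using q by simp
      qed
      also have "\<dots> \<le> E * A * (q * (\<bar>y\<bar> * 11 ^ m))"
      proof (intro mult_left_mono mult_mono)
        have "q ^ (i - 2) \<le> q ^ 1" using i q by (intro power_decreasing) auto
        then show "q ^ (i - 2) \<le> q" by simp
        have "\<bar>y\<bar> ^ i = \<bar>y\<bar> * \<bar>y\<bar> ^ (i - 1)" using i by (cases i) auto
        also have "\<bar>y\<bar> ^ (i - 1) \<le> 11 ^ (i - 1)" using y by (intro power_mono) auto
        also have "(11::real) ^ (i - 1) \<le> 11 ^ m" using i by (intro power_increasing) auto
        finally show "\<bar>y\<bar> ^ i \<le> \<bar>y\<bar> * 11 ^ m" by (simp add: mult_left_mono)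
      qed (use E A q in auto)
      finally show ?thesis by (simp add: mult_ac)
    qed
    have "\<bar>\<Sum>i = 3..m. c i * (q * y) ^ i\<bar> \<le> (\<Sum>i = 3..m. \<bar>c i * (q * y) ^ i\<bar>)" by (rule sum_abs)
    also have "\<dots> \<le> (\<Sum>i = 3..m. E * A * (\<bar>y\<bar> * 11 ^ m * q))" by (rule sum_mono[OF summand])
    also have "\<dots> = real (m - 2) * (E * A * (\<bar>y\<bar> * 11 ^ m * q))" by simp
    also have "\<dots> \<le> real m * (E * A * (\<bar>y\<bar> * 11 ^ m * q))"
      using E A q by (intro mult_right_mono) auto
    also have "\<dots> = E * A * \<bar>y\<bar> * (real m * 11 ^ m * q)" by (simp add: mult_ac)
    also have "\<dots> \<le> E * A * \<bar>y\<bar> * (1/11)" using E A q(3) by (intro mult_left_mono) auto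
    finally show ?thesis using A by (simp add: rem_def abs_divide pos_divide_le_eq mult_ac)
  qed
  have Ew: "E * w \<le> E" "0 < E * w" using E w by (auto simp: mult_le_cancel_left1)
  have sq: "0 \<le> f2 * y\<^sup>2" "f2 * y\<^sup>2 \<le> 3 * E * y\<^sup>2" "E * y\<^sup>2 \<le> f2 * y\<^sup>2" for y
    using f2 E by (auto intro: mult_right_mono)
  have lin: "7 * E * y \<le> f1 * y" "f1 * y \<le> 9 * E * y" if "0 \<le> y" for y
    using f1 that by (auto intro: mult_right_mono)
  have f1w: "7 / 2 * (E * w) \<le> f1 * (w / 2)"
    using lin(1)[of "w / 2"] w by (simp add: mult.assoc)
  have remw: "- (E * w) / 22 \<le> rem y" "rem y \<le> E * w / 22" if "\<bar>y\<bar> = w / 2" for y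
  proof -
    have "\<bar>rem y\<bar> \<le> E * \<bar>y\<bar> / 11" using that w by (intro rem_le) linarith
    then have "\<bar>rem y\<bar> \<le> E * w / 22" unfolding that by simp
    then show "- (E * w) / 22 \<le> rem y" "rem y \<le> E * w / 22" by linarith+
  qed
  have f0': "- (E * w) \<le> f0" "f0 \<le> E * w" using f0 by linarith+
  have pos1: "0 < poly F (x + q * (w / 2))"
  proof -
    have "0 < f0 + f1 * (w / 2) + f2 * (w / 2)\<^sup>2 + rem (w / 2)"
      using f1w remw(1)[of "w / 2"] f0'(1) sq(1)[of "w / 2"] Ew(2) w by linarith
    then show ?thesis unfolding shifted using A by simp
  qed
  have neg1: "poly F (x + q * (- (w / 2))) < 0"
  proof -
    have "f2 * (- (w / 2))\<^sup>2 \<le> 3 / 4 * (E * w)"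
    proof -
      have "f2 * (- (w / 2))\<^sup>2 \<le> 3 * E * (- (w / 2))\<^sup>2" by (rule sq(2))
      also have "\<dots> = 3 / 4 * (E * w) * w" by (simp add: power2_eq_square)
      also have "\<dots> \<le> 3 / 4 * (E * w) * 1" using w Ew(2) by (intro mult_left_mono) auto
      finally show ?thesis by simp
    qed
    moreover have "f1 * (- (w / 2)) = - (f1 * (w / 2))" by simp
    ultimately have "f0 + f1 * (- (w / 2)) + f2 * (- (w / 2))\<^sup>2 + rem (- (w / 2)) < 0"
      using f1w remw(2)[of "- (w / 2)"] f0'(2) Ew(2) w by linarith
    then show ?thesis unfolding shifted using A by (simp add: mult_pos_neg)
  qed
  have neg2: "poly F (x + q * (- 1)) < 0"
  proof -
    have "\<bar>rem (- 1)\<bar> \<le> E / 11" using rem_le[of "- 1"] by simp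
    then have "f0 - f1 + f2 + rem (- 1) < 0"
      using f0'(2) f1(1) f2(2) Ew(1) E by linarith
    then show ?thesis unfolding shifted using A by (simp add: mult_pos_neg)
  qed
  have pos2: "0 < poly F (x + q * (- 11))"
  proof -
    have "\<bar>rem (- 11)\<bar> \<le> E" using rem_le[of "- 11"] by simp
    then have "0 < f0 - 11 * f1 + 121 * f2 + rem (- 11)"
      using f0'(1) f1(2) f2(1) Ew(1) E by linarith
    moreover have "f0 + f1 * (- 11) + f2 * (- 11)\<^sup>2 + rem (- 11) = f0 - 11 * f1 + 121 * f2 + rem (- 11)"
      by simp
    ultimately show ?thesis unfolding shifted using A by (simp only: mult_pos_pos)
  qed
  have qw: "q * (- (w / 2)) < q * (w / 2)" "q * (- 11) < q * (- 1)" using q w by auto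
  obtain u where a1: "x + q * (- (w / 2)) < u" "u < x + q * (w / 2)" "poly F u = 0"
    using poly_IVT_pos[OF _ neg1 pos1] qw by auto
  obtain v where a2: "x + q * (- 11) < v" "v < x + q * (- 1)" "poly F v = 0"
    using poly_IVT_neg[OF _ pos2 neg2] qw by auto
  have qwq: "q * w \<le> q" "0 < q * w" using q w by (auto simp: mult_le_cancel_left1)
  have a1': "x - q * w / 2 < u" "u < x + q * w / 2" using a1(1,2) by simp_all
  have a2': "x - 11 * q < v" "v < x - q" using a2(1,2) by simp_all
  have "\<bar>u - x\<bar> < q * w" using a1' qwq by linarith
  moreover have "q / 2 \<le> \<bar>u - v\<bar>" using a1' a2' qwq by linarith
  moreover have "\<bar>u - v\<bar> \<le> 12 * q" using a1' a2' qwq q by linarith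
  ultimately show ?thesis using that a1(3) a2(3) by blast
qed

lemma binomial_le_two_power: "i \<le> m \<Longrightarrow> real (i choose j) \<le> 2 ^ m"
proof -
  assume "i \<le> m"
  have "real (i choose j) \<le> real (2 ^ i)" by (rule of_nat_mono) (rule binomial_le_pow2)
  also have "\<dots> \<le> 2 ^ m" using \<open>i \<le> m\<close> by (simp add: power_increasing)
  finally show ?thesis .
qed

lemma abs_binomial_power_le:
  assumes "\<bar>x\<bar> \<le> (1::real)" "i \<le> m"
  shows "\<bar>real (i choose j) * x ^ k\<bar> \<le> 2 ^ m"
proof -
  have "\<bar>x ^ k\<bar> \<le> 1" using assms(1) by (simp add: power_abs power_le_one)
  then have "\<bar>real (i choose j) * x ^ k\<bar> \<le> 2 ^ m * 1"
    unfolding abs_mult using binomial_le_two_power[OF assms(2), of j] by (intro mult_mono) auto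
  then show ?thesis by simp
qed

lemma coeff_le_taylor:
  assumes "degree p \<le> m" "\<bar>x\<bar> \<le> 1" "\<And>i. i \<le> m \<Longrightarrow> \<bar>taylor_coeff p x i\<bar> \<le> B"
  shows "\<bar>coeff p j\<bar> \<le> real (m + 1) * 2 ^ m * B"
proof -
  have B: "0 \<le> B" using assms(3)[of 0] by simp
  have "\<bar>coeff p j\<bar> \<le> (\<Sum>i\<le>m. \<bar>taylor_coeff p x i * (real (i choose j) * (- x) ^ (i - j))\<bar>)"
    unfolding coeff_eq_taylor[OF assms(1), of j x] by (rule sum_abs)
  also have "\<dots> \<le> (\<Sum>i\<le>m. B * 2 ^ m)"
    unfolding abs_mult[of "taylor_coeff p x _"] using assms B
    by (intro sum_mono mult_mono abs_binomial_power_le) auto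
  finally show ?thesis by (simp add: mult_ac)
qed

lemma taylor_le_coeff:
  assumes "degree p \<le> m" "\<bar>x\<bar> \<le> 1" "\<And>j. j \<le> m \<Longrightarrow> \<bar>coeff p j\<bar> \<le> B"
  shows "\<bar>taylor_coeff p x i\<bar> \<le> real (m + 1) * 2 ^ m * B"
proof -
  have B: "0 \<le> B" using assms(3)[of 0] by simp
  have "\<bar>taylor_coeff p x i\<bar> \<le> (\<Sum>j\<le>m. \<bar>coeff p j * (real (j choose i) * x ^ (j - i))\<bar>)"
    unfolding taylor_coeff_eq[OF assms(1)] by (rule sum_abs)
  also have "\<dots> \<le> (\<Sum>j\<le>m. B * 2 ^ m)"
    unfolding abs_mult[of "coeff p _"] using assms B
    by (intro sum_mono mult_mono abs_binomial_power_le) auto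
  finally show ?thesis by (simp add: mult_ac)
qed


section \<open>Close conjugates near a given point\<close>

definition taylor_scale :: "nat \<Rightarrow> real \<Rightarrow> real \<Rightarrow> nat \<Rightarrow> real" where
  "taylor_scale n \<mu> Q i = (if i = 0 then Q powr (\<mu> - real n) else if i = 1 then Q powr (1 - \<mu>) else Q)"

lemma taylor_scale_pos: "0 < Q \<Longrightarrow> 0 < taylor_scale n \<mu> Q i"
  by (simp add: taylor_scale_def)

lemma prod_taylor_scale:
  assumes "0 < Q" "2 \<le> k"
  shows "(\<Prod>i<k. taylor_scale n \<mu> Q i) = Q powr (real k - 1 - real n)"
  using assms(2)
proof (induction k rule: dec_induct)
  case base
  have "(\<Prod>i<2. taylor_scale n \<mu> Q i) = Q powr (\<mu> - real n) * Q powr (1 - \<mu>)"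
    by (simp add: taylor_scale_def numeral_2_eq_2)
  then show ?case by (simp add: powr_add[symmetric])
next
  case (step k)
  have "(\<Prod>i<Suc k. taylor_scale n \<mu> Q i) = Q powr (real k - 1 - real n) * taylor_scale n \<mu> Q k"
    using step.IH by simp
  also have "taylor_scale n \<mu> Q k = Q powr 1" using step.hyps(1) assms(1) by (simp add: taylor_scale_def)
  also have "Q powr (real k - 1 - real n) * Q powr 1 = Q powr (real k - 1 - real n + 1)"
    by (rule powr_add[symmetric])
  finally show ?case by simp
qed

text \<open>
  The targets \<open>8 E \<xi> 1\<close> and \<open>2 E \<xi> 2\<close> for the first and second Taylor coefficients dominate the rounding
  error \<open>E \<xi> i\<close>. The height of the root is that of \<open>P\<close> divided by the content \<open>c\<close>. If \<open>m = n + 1\<close>, the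
  polynomial is monic and \<open>c\<close> is a unit; if \<open>m = n\<close>, the primitive part is a nonzero lattice vector, so it is
  not short, which bounds \<open>c\<close>.
\<close>

lemma close_conjugates_near:
  fixes n m p :: nat and \<delta> E \<mu> Q x :: real
  assumes n: "2 \<le> n" and m: "m = n \<or> m = n + 1" and p: "prime p" and E: "1 \<le> E" and \<delta>: "0 < \<delta>"
    and tailor: "tailorable n p E (taylor_scale n \<mu> Q) x"
    and nsv: "no_short_vector n \<delta> (taylor_scale n \<mu> Q) x"
    and \<mu>: "0 < \<mu>" "\<mu> \<le> (real n + 1) / 3" and Q: "1 < Q"
    and large: "real (n + 1) * 11 ^ (n + 1) * Q powr (- \<mu>) \<le> 1/11"
    and x: "\<bar>x\<bar> \<le> 1"
  defines "\<nu> \<equiv> 1 / (108 * (real (n + 2) * 2 ^ (n + 1)) * E * max 1 (9 * E / \<delta>))"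
  shows "\<exists>\<alpha>. \<bar>\<alpha> - x\<bar> < Q powr (- real n - 1 + 2 * \<mu>) \<and> algebraic \<alpha> \<and> (m = n + 1 \<longrightarrow> algebraic_int \<alpha>) \<and>
     alg_degree \<alpha> = m \<and> height_and_conjugate_cond \<nu> Q \<mu> \<alpha>"
proof -
  let ?\<xi> = "taylor_scale n \<mu> Q"
  define P\<^sub>0 :: "int poly" where "P\<^sub>0 = (if m = n then 0 else monom 1 m)"
  define T :: "int poly" where "T = [:int p:] + (if m = n then monom 1 n else 0)"
  define t where "t = (\<lambda>i::nat. if i = 1 then 8 * E * ?\<xi> 1 else if i = 2 then 2 * E * ?\<xi> 2 else 0)"
  have degT: "degree T \<le> n" unfolding T_def by (auto intro!: degree_add_le order_trans[OF degree_monom_le])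
  obtain P where P: "degree (P - P\<^sub>0) \<le> n" "\<And>i. (int p)\<^sup>2 dvd coeff (P - P\<^sub>0 - T) i"
    "\<And>i. i \<le> n \<Longrightarrow> \<bar>int_taylor P x i - t i\<bar> \<le> E * ?\<xi> i"
    using tailor[unfolded tailorable_def, THEN spec, of P\<^sub>0, THEN spec, of T, THEN spec, of t, THEN mp, OF degT]
    by blast
  have mn: "2 \<le> m" "n \<le> m" "m \<le> n + 1" using m n by auto
  have pp: "prime (int p)" "1 < int p" using p prime_gt_1_nat by auto
  have "degree P\<^sub>0 \<le> m" by (simp add: P\<^sub>0_def degree_monom_le)
  then have "degree ((P - P\<^sub>0) + P\<^sub>0) \<le> m" using P(1) mn by (intro degree_add_le) auto
  then have degP_le: "degree P \<le> m" by simp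
  have coeff_PT: "coeff (P\<^sub>0 + T) i = (if i = m then 1 else if i = 0 then int p else 0)" for i
    using m mn by (auto simp: P\<^sub>0_def T_def coeff_pCons split: nat.splits)
  have congr: "(int p)\<^sup>2 dvd coeff P i - (if i = m then 1 else if i = 0 then int p else 0)" for i
    using P(2)[of i] unfolding coeff_PT[symmetric] by (simp add: algebra_simps)
  have p_dvd: "int p dvd (int p)\<^sup>2" by (simp add: power2_eq_square)
  have lead: "\<not> int p dvd coeff P m"
  proof
    assume "int p dvd coeff P m"
    moreover have "int p dvd coeff P m - 1" using dvd_trans[OF p_dvd congr[of m]] by simp
    ultimately have "int p dvd coeff P m - (coeff P m - 1)" by (rule dvd_diff)
    then show False using pp by simp
  qed
  then have "coeff P m \<noteq> 0" by auto
  then have "m \<le> degree P" by (rule le_degree)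
  then have degP: "degree P = m" using degP_le by (rule le_antisym[rotated])
  have inner: "int p dvd coeff P i" if "i < degree P" for i
  proof -
    have "int p dvd coeff P i - (if i = 0 then int p else 0)"
      using dvd_trans[OF p_dvd congr[of i]] that degP by simp
    then show ?thesis by (cases "i = 0") (auto simp: dvd_diff_right_iff dvd_diff_left_iff)
  qed
  have const: "\<not> (int p)\<^sup>2 dvd coeff P 0"
  proof
    assume "(int p)\<^sup>2 dvd coeff P 0"
    moreover have "(int p)\<^sup>2 dvd coeff P 0 - int p" using congr[of 0] mn by simp
    ultimately have "(int p)\<^sup>2 dvd coeff P 0 - (coeff P 0 - int p)" by (rule dvd_diff)
    then have "int p * int p dvd int p * 1" by (simp add: power2_eq_square)
    then have "int p dvd 1" using pp by (simp only: dvd_mult_cancel_left) auto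
    then show False using pp by simp
  qed
  obtain c q where cq: "c \<noteq> 0" "P = smult c q" "irreducible (map_poly rat_of_int q)" "content q = 1" "0 < lead_coeff q"
    using eisenstein_min_int_poly[of "int p" P] pp lead inner const degP mn by auto
  have degq: "degree q = m" using cq degP by auto
  have monic: "lead_coeff P = 1" if "m = n + 1"
  proof -
    have "coeff (P - P\<^sub>0) m = 0" using P(1) that by (intro coeff_eq_0) simp
    then show ?thesis using that degP by (simp add: P\<^sub>0_def)
  qed
  \<comment> \<open>\<open>A\<close>, \<open>s\<close>, \<open>w\<close> turn the three units into \<open>A w\<close>, \<open>A / s\<close>, \<open>A / s\<^sup>2\<close>; the bound on \<open>\<mu>\<close> gives \<open>w \<le> 1\<close>\<close>
  define A where "A = Q powr (1 - 2 * \<mu>)"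
  define s where "s = Q powr (- \<mu>)"
  define w where "w = Q powr (3 * \<mu> - real n - 1)"
  have Apos: "0 < A" "0 < s" "0 < w" using Q by (auto simp: A_def s_def w_def)
  have s1: "s \<le> 1" unfolding s_def using Q \<mu> powr_mono[of "- \<mu>" 0 Q] by simp
  have w1: "w \<le> 1" unfolding w_def using Q \<mu> powr_mono[of "3 * \<mu> - real n - 1" 0 Q] by simp
  have \<xi>0: "?\<xi> 0 = A * w" unfolding A_def w_def taylor_scale_def by (simp add: powr_add[symmetric] algebra_simps)
  have \<xi>1: "?\<xi> 1 = A / s" unfolding A_def s_def taylor_scale_def by (simp add: powr_diff[symmetric])
  have \<xi>2: "?\<xi> 2 = A / s\<^sup>2"
  proof -
    have "s\<^sup>2 = Q powr (- 2 * \<mu>)" unfolding s_def power2_eq_square powr_add[symmetric] by simp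
    then have "A / s\<^sup>2 = Q powr 1" unfolding A_def by (simp add: powr_diff[symmetric])
    then show ?thesis using Q by (simp add: taylor_scale_def)
  qed
  have QA: "Q = A / s\<^sup>2" using \<xi>2 by (simp add: taylor_scale_def)
  have \<xi>Q: "?\<xi> i = Q" if "2 \<le> i" for i using that by (simp add: taylor_scale_def)
  have \<xi>leQ: "?\<xi> i \<le> Q" for i
  proof -
    have "Q powr (\<mu> - real n) \<le> Q powr 1" using Q \<mu> n by (intro powr_mono) auto
    moreover have "Q powr (1 - \<mu>) \<le> Q powr 1" using Q \<mu> by (intro powr_mono) auto
    ultimately show ?thesis using Q by (simp add: taylor_scale_def)
  qed
  let ?tc = "int_taylor P x"
  have top: "\<bar>?tc m\<bar> \<le> E * Q" if "m = n + 1"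
  proof -
    have "?tc m = (\<Sum>j\<le>m. coeff (real_poly P) j * (real (j choose m) * x ^ (j - m)))"
      by (rule taylor_coeff_eq) (simp add: degP)
    also have "\<dots> = (\<Sum>j\<le>m. if j = m then coeff (real_poly P) m else 0)"
      by (intro sum.cong) (auto simp: binomial_eq_0)
    also have "\<dots> = 1" using monic[OF that] degP by simp
    finally have "\<bar>?tc m\<bar> = 1" by simp
    moreover have "1 * 1 \<le> E * Q" using E Q by (intro mult_mono) auto
    ultimately show ?thesis by simp
  qed
  have tc_high: "\<bar>?tc i\<bar> \<le> E * Q" if "3 \<le> i" "i \<le> m" for i
  proof (cases "i \<le> n")
    case True
    then show ?thesis using P(3)[of i] that by (simp add: t_def \<xi>Q)
  next
    case False
    then have "m = n + 1" "i = m" using that m by auto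
    then show ?thesis using top by simp
  qed
  have tc_le: "\<bar>?tc i\<bar> \<le> 9 * E * ?\<xi> i" if i: "i \<le> n" for i
  proof -
    have "0 \<le> E * ?\<xi> i" "\<bar>t i\<bar> \<le> 8 * (E * ?\<xi> i)"
      using E Q taylor_scale_pos[of Q n \<mu>] by (auto simp: t_def abs_mult less_imp_le)
    then show ?thesis using P(3)[OF i] by (simp add: abs_le_iff)
  qed
  have tc_le_Q: "\<bar>?tc i\<bar> \<le> 9 * E * Q" if "i \<le> m" for i
  proof (cases "i \<le> n")
    case True
    have "9 * E * ?\<xi> i \<le> 9 * E * Q" using \<xi>leQ E by (intro mult_left_mono) auto
    then show ?thesis using tc_le[OF True] by linarith
  next
    case False
    have "E * Q \<le> 9 * E * Q" using E Q by simp
    then show ?thesis using tc_high[of i] that False n by linarith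
  qed
  have "real m * 11 ^ m * s \<le> real (n + 1) * 11 ^ (n + 1) * s"
    using mn Apos by (intro mult_right_mono mult_mono power_increasing) auto
  then have small: "real m * 11 ^ m * s \<le> 1/11" using large by (simp add: s_def)
  have tc0: "\<bar>?tc 0\<bar> \<le> E * (A * w)" 
    using P(3)[of 0] unfolding \<xi>0[symmetric] t_def by simp
  have tc1: "\<bar>?tc 1 - 8 * E * (A / s)\<bar> \<le> E * (A / s)" 
    using P(3)[of 1] n unfolding \<xi>1[symmetric] t_def by simp
  have tc2: "\<bar>?tc 2 - 2 * E * (A / s\<^sup>2)\<bar> \<le> E * (A / s\<^sup>2)" 
    using P(3)[of 2] n unfolding \<xi>2[symmetric] t_def by simp
  obtain u v where \<alpha>: "poly (real_poly P) u = 0" "poly (real_poly P) v = 0" "\<bar>u - x\<bar> < s * w"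
    "s / 2 \<le> \<bar>u - v\<bar>" "\<bar>u - v\<bar> \<le> 12 * s"
    using two_close_roots[OF mn(1) _ Apos(1,2) s1 small Apos(3) w1 _ tc0 tc1 tc2] tc_high E degP QA
    by auto
  have sw: "s * w = Q powr (- real n - 1 + 2 * \<mu>)"
    unfolding s_def w_def powr_add[symmetric] by (simp add: algebra_simps)
  have root_q: "poly (real_poly q) \<alpha> = 0" if "poly (real_poly P) \<alpha> = 0" for \<alpha>
    using that cq(1) unfolding cq(2) real_poly_smult by simp
  have minpoly: "is_min_int_poly q u"
    using cq root_q[OF \<alpha>(1)] by (simp add: is_min_int_poly_def)
  then have mp: "min_int_poly u = q" by (rule min_int_poly_eqI)
  define C where "C = max 1 (9 * E / \<delta>)"
  define B where "B = real (n + 2) * 2 ^ (n + 1)"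
  have C: "1 \<le> C" and B: "1 \<le> B"
  proof -
    show "1 \<le> C" by (simp add: C_def)
    have "1 * 1 \<le> real (n + 2) * 2 ^ (n + 1)" by (intro mult_mono one_le_power) auto
    then show "1 \<le> B" by (simp add: B_def)
  qed
  have Bm: "real (m + 1) * 2 ^ m \<le> B" unfolding B_def using mn by (intro mult_mono power_increasing) auto
  have c_le: "\<bar>real_of_int c\<bar> \<le> C"
  proof (cases "m = n + 1")
    case True
    then have "c * lead_coeff q = 1" using monic cq by simp
    then have "\<bar>c\<bar> = 1" by (metis zmult_eq_1_iff abs_1 abs_minus_cancel)
    then show ?thesis using C by simp
  next
    case False
    then have "degree q \<le> n" "q \<noteq> 0" using m degq mn by auto
    then obtain i where i: "i \<le> n" "\<delta> * ?\<xi> i < \<bar>int_taylor q x i\<bar>"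
      using nsv unfolding no_short_vector_def by blast
    have "\<bar>real_of_int c\<bar> * (\<delta> * ?\<xi> i) \<le> \<bar>real_of_int c\<bar> * \<bar>int_taylor q x i\<bar>"
      using i by (intro mult_left_mono) auto
    also have "\<dots> = \<bar>?tc i\<bar>" unfolding cq(2) real_poly_smult taylor_coeff_smult by (simp add: abs_mult)
    also have "\<dots> \<le> 9 * E * ?\<xi> i" by (rule tc_le[OF i(1)])
    finally have "(\<bar>real_of_int c\<bar> * \<delta>) * ?\<xi> i \<le> (9 * E) * ?\<xi> i" by (simp add: mult_ac)
    then have "\<bar>real_of_int c\<bar> * \<delta> \<le> 9 * E" using taylor_scale_pos[of Q n \<mu> i] Q by simp
    then have "\<bar>real_of_int c\<bar> \<le> 9 * E / \<delta>" using \<delta> by (simp add: pos_le_divide_eq)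
    then show ?thesis by (simp add: C_def)
  qed
  have c1: "1 \<le> \<bar>real_of_int c\<bar>" using cq(1) by (simp flip: of_int_abs)
  define H where "H = real_of_int (alg_height u)"
  have coeff_c: "\<bar>coeff (real_poly P) j\<bar> = \<bar>real_of_int c\<bar> * \<bar>real_of_int (coeff q j)\<bar>" for j
    unfolding cq(2) by (simp add: abs_mult)
  have H_ge: "\<bar>real_of_int (coeff q j)\<bar> \<le> H" if "j \<le> m" for j
  proof -
    have "\<bar>coeff q j\<bar> \<le> alg_height u"
      unfolding alg_height_def mp using that degq by (intro Max_ge) auto
    then show ?thesis unfolding H_def by linarith
  qed
  have H_att: "\<exists>j. H = \<bar>real_of_int (coeff q j)\<bar>"
  proof -
    have "alg_height u \<in> (\<lambda>i. \<bar>coeff q i\<bar>) ` {..degree q}"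
      unfolding alg_height_def mp by (intro Max_in) auto
    then show ?thesis unfolding H_def by auto
  qed
  have H_le: "H \<le> B * (9 * E * Q)"
  proof -
    obtain j where j: "H = \<bar>real_of_int (coeff q j)\<bar>" using H_att by blast
    have "H \<le> \<bar>coeff (real_poly P) j\<bar>"
      unfolding coeff_c j using c1 by (simp add: mult_le_cancel_right1)
    also have "\<dots> \<le> real (m + 1) * 2 ^ m * (9 * E * Q)"
      using degP x tc_le_Q by (intro coeff_le_taylor) auto
    also have "\<dots> \<le> B * (9 * E * Q)" using Bm E Q by (intro mult_right_mono) auto
    finally show ?thesis .
  qed
  have H0: "0 \<le> H" using H_ge[of 0] by linarith
  have H_lower: "E * Q \<le> B * (C * H)"
  proof -
    have "E * Q \<le> ?tc 2" using tc2 unfolding QA[symmetric] by linarith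
    also have "\<dots> \<le> \<bar>?tc 2\<bar>" by simp
    also have "\<dots> \<le> real (m + 1) * 2 ^ m * (C * H)"
    proof (rule taylor_le_coeff)
      fix j assume "j \<le> m"
      then show "\<bar>coeff (real_poly P) j\<bar> \<le> C * H"
        unfolding coeff_c using c_le H_ge C by (intro mult_mono) auto
    qed (use degP x in auto)
    also have "\<dots> \<le> B * (C * H)" using Bm C H0 by (intro mult_right_mono) auto
    finally show ?thesis .
  qed
  have \<nu>_eq: "\<nu> = 1 / (108 * B * E * C)" by (simp add: \<nu>_def B_def C_def)
  have inv_\<nu>: "inverse \<nu> = 108 * B * E * C" by (simp add: \<nu>_eq)
  have BEC: "1 \<le> B * E * C" using B E C by (intro mult_ge1_I) auto
  have \<nu>pos: "0 < \<nu>" using BEC B E C by (simp add: \<nu>_eq)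
  have \<nu>_mult: "\<nu> * (108 * B * E * C) = 1" using BEC B E C by (simp add: \<nu>_eq)
  have cond: "height_and_conjugate_cond \<nu> Q \<mu> u"
    unfolding height_and_conjugate_cond_def H_def[symmetric] s_def[symmetric]
  proof (intro conjI exI[of _ "v"])
    have "1 * (E * Q) \<le> (108 * E * E) * (B * (C * H))"
    proof (rule mult_mono[OF _ H_lower])
      have "1 * 1 \<le> E * E" using E by (intro mult_mono) auto
      then show "1 \<le> 108 * E * E" by simp
    qed (use E Q in auto)
    then have "E * Q \<le> E * ((108 * B * E * C) * H)" by (simp add: mult_ac)
    then have QH: "Q \<le> (108 * B * E * C) * H" using E by simp
    have "\<nu> * Q \<le> \<nu> * ((108 * B * E * C) * H)" using QH \<nu>pos by (intro mult_left_mono) auto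
    then show "\<nu> * Q \<le> H" using \<nu>_mult by (simp only: mult.assoc[symmetric] mult_1_left)
    have "1 * (9 * B * E * Q) \<le> (12 * C) * (9 * B * E * Q)"
      using B E C Q by (intro mult_right_mono) auto
    then show "H \<le> inverse \<nu> * Q" using H_le unfolding inv_\<nu> by (simp add: mult_ac)
    show "alg_conjugate u v" unfolding alg_conjugate_def
      using cq(3) root_q[OF \<alpha>(1)] root_q[OF \<alpha>(2)] by blast
    have big: "12 \<le> 108 * B * E * C" using BEC unfolding mult.assoc by linarith
    then have "\<nu> * 2 \<le> \<nu> * (108 * B * E * C)" using \<nu>pos by (intro mult_left_mono) auto
    then have "\<nu> \<le> 1 / 2" unfolding \<nu>_mult by simp
    then have "\<nu> * s \<le> 1 / 2 * s" using Apos by (intro mult_right_mono) auto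
    then show "\<nu> * s \<le> \<bar>u - v\<bar>" using \<alpha>(4) by simp
    have "12 * s \<le> inverse \<nu> * s" unfolding inv_\<nu> using big Apos by (intro mult_right_mono) auto
    then show "\<bar>u - v\<bar> \<le> inverse \<nu> * s" using \<alpha>(5) by linarith
  qed
  have P0: "P \<noteq> 0" using degP mn by auto
  have "algebraic u"
    using P0 \<alpha>(1) by (intro algebraicI'[of "real_poly P"]) auto
  moreover have "algebraic_int u" if "m = n + 1"
    using \<alpha>(1) monic[OF that] by (intro algebraic_int.intros[of "real_poly P"]) auto
  moreover have "alg_degree u = m" by (simp add: alg_degree_def mp degq)
  ultimately show ?thesis using \<alpha>(3) cond unfolding sw by blast
qed


section \<open>The measure of the union\<close>

lemma prod_taylor_scale_small:
  assumes Q: "1 < Q" and n: "2 \<le> n" and c: "Q powr (\<mu> - real n) \<le> c" "Q powr (- 1) \<le> c"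
    and k: "1 \<le> k" "k \<le> n"
  shows "(\<Prod>i<k. taylor_scale n \<mu> Q i) \<le> c"
proof (cases "k = 1")
  case True
  then show ?thesis using c(1) by (simp add: taylor_scale_def)
next
  case False
  then have "(\<Prod>i<k. taylor_scale n \<mu> Q i) = Q powr (real k - 1 - real n)" using Q k by (intro prod_taylor_scale) auto
  also have "\<dots> \<le> Q powr (- 1)" using Q k by (intro powr_mono) auto
  finally show ?thesis using c(2) by simp
qed

lemma eventually_powr_neg_le:
  fixes e c :: real
  assumes "e < 0" "0 < c"
  shows "\<forall>\<^sub>F Q in at_top. Q powr e \<le> c"
proof -
  have "((\<lambda>Q::real. Q powr e) \<longlongrightarrow> 0) at_top"
    by (rule tendsto_neg_powr[OF assms(1) filterlim_ident])
  then have "\<forall>\<^sub>F Q in at_top. Q powr e < c" using assms(2) by (rule order_tendstoD(2))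
  then show ?thesis by (rule eventually_mono) simp
qed

text \<open>
  Only the open interval between the infimum and the supremum of \<open>J\<close> matters, the end points are null.
\<close>

lemma measure_ge_of_mostly:
  fixes J U :: "real set"
  assumes J: "is_interval J" "bounded J" "J \<noteq> {}" and U: "open U"
    and mostly: "Inf J < Sup J \<Longrightarrow> mostly (1/4) (Inf J) (Sup J) (\<lambda>x. x \<in> J \<longrightarrow> x \<in> U)"
  shows "3 / 4 * measure lborel J \<le> measure lborel (U \<inter> J)"
proof -
  define a where "a = Inf J"
  define b where "b = Sup J"
  have bdd: "bdd_below J" "bdd_above J" using J(2) by (auto intro: bounded_imp_bdd_below bounded_imp_bdd_above)
  have sub: "J \<subseteq> {a..b}" using bdd by (auto simp: a_def b_def cInf_lower cSup_upper)
  have sup: "{a<..<b} \<subseteq> J"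
  proof
    fix x assume x: "x \<in> {a<..<b}"
    obtain u where u: "u \<in> J" "u < x" using x cInf_lessD[OF J(3), of x] by (auto simp: a_def)
    obtain v where v: "v \<in> J" "x < v" using x less_cSupD[OF J(3), of x] by (auto simp: b_def)
    show "x \<in> J" using J(1) u v unfolding is_interval_1 by (meson less_imp_le)
  qed
  have "J = {a<..<b} \<union> (J \<inter> {a, b})" using sub sup by (auto simp: less_le)
  then have Jb: "J \<in> sets borel" by (metis finite.intros finite_Int sets.Un borel_open open_greaterThanLessThan sets_borel_eq_count_space borel_closed finite_imp_closed)
  have ab: "a \<le> b" using sub J(3) by auto
  have fin: "S \<in> fmeasurable lborel" if "S \<subseteq> {a..b}" "S \<in> sets borel" for S
  proof (rule fmeasurableI)
    have "emeasure lborel S \<le> emeasure lborel {a..b}" using that by (intro emeasure_mono) auto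
    then show "emeasure lborel S < \<infinity>" using ab by (auto intro: le_less_trans)
  qed (use that in simp)
  have "measure lborel J \<le> measure lborel {a..b}" using sub Jb fin by (intro measure_mono_fmeasurable) auto
  then have mJ: "measure lborel J \<le> b - a" using ab by simp
  show ?thesis
  proof (cases "a < b")
    case False
    then have "measure lborel J = 0" using mJ measure_nonneg[of lborel J] ab by linarith
    then show ?thesis by simp
  next
    case True
    then obtain N where N: "N \<in> sets lborel" "emeasure lborel N \<le> ennreal (1/4 * (b - a))"
      "\<forall>x\<in>{a..<b} - N. x \<in> J \<longrightarrow> x \<in> U"
      using mostly unfolding mostly_def a_def b_def by blast
    have Nm: "measure lborel N \<le> 1/4 * (b - a)"
      unfolding measure_def using N(2) True by (intro enn2real_leI) auto
    have Nf: "N \<in> fmeasurable lborel"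
      using N(1,2) by (intro fmeasurableI) (auto intro: le_less_trans)
    define D where "D = {a<..<b} - N"
    have Df: "D \<in> fmeasurable lborel" unfolding D_def using N(1) by (intro fin) auto
    have "b - a = measure lborel {a<..<b}" using True by simp
    also have "\<dots> \<le> measure lborel (D \<union> N)"
      by (intro measure_mono_fmeasurable fmeasurable.Un Df Nf) (auto simp: D_def)
    also have "\<dots> \<le> measure lborel D + measure lborel N"
      using Df Nf by (intro measure_Un_le) auto
    finally have tot: "b - a \<le> measure lborel D + measure lborel N" .
    have arith: "z - 1 / 4 * z \<le> u" if "z \<le> u + v" "v \<le> 1 / 4 * z" for u v z :: real
      using that by linarith
    have "3 / 4 * measure lborel J \<le> 3 / 4 * (b - a)" using mJ by (intro mult_left_mono) auto
    also have "\<dots> = (b - a) - 1 / 4 * (b - a)" by (simp add: field_simps)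
    also have "\<dots> \<le> measure lborel D" using tot Nm by (rule arith)
    also have "measure lborel D \<le> measure lborel (U \<inter> J)"
      using Df U Jb sub N(3) sup by (intro measure_mono_fmeasurable fin) (auto simp: D_def borel_open)
    finally show ?thesis .
  qed
qed

theorem theorem2:
  fixes n :: nat
  assumes "n \<ge> 2"
  shows "\<exists>\<nu>::real. 0 < \<nu> \<and> \<nu> < 1 \<and>
    (\<forall>\<A> \<in> {close_conj_numbers n \<nu>, close_conj_integers n \<nu>}.
     \<forall>\<mu>::real. \<forall>J::real set.
       0 < \<mu> \<and> \<mu> \<le> (real n + 1) / 3 \<and> is_interval J \<and> J \<subseteq> {-1/2..1/2} \<longrightarrow>
       (\<forall>\<^sub>F Q in at_top.
          measure lborel ((\<Union>\<alpha>\<^sub>1 \<in> \<A> Q \<mu>. ball \<alpha>\<^sub>1 (Q powr (- real n - 1 + 2 * \<mu>))) \<inter> J)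
            \<ge> 3 / 4 * measure lborel J))"
proof -
  obtain \<delta> where \<delta>: "0 < \<delta>" and nsv: "\<forall>a b. a < b \<longrightarrow> (\<exists>c>0. \<forall>\<xi>. (\<forall>i\<le>n. 0 < \<xi> i) \<longrightarrow> (\<Prod>i\<le>n. \<xi> i) = 1 \<longrightarrow>
     (\<forall>k. 1 \<le> k \<longrightarrow> k \<le> n \<longrightarrow> (\<Prod>i<k. \<xi> i) \<le> c) \<longrightarrow> mostly (1/4) a b (no_short_vector n \<delta> \<xi>))"
    using no_short_vector_mostly[of n] by (elim exE conjE)
  obtain p :: nat and E :: real where E: "1 \<le> E" "prime p" and tailor: "\<forall>\<xi> x. (\<forall>i\<le>n. 0 < \<xi> i) \<longrightarrow> (\<Prod>i\<le>n. \<xi> i) = 1 \<longrightarrow>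
     no_short_vector n \<delta> \<xi> x \<longrightarrow> tailorable n p E \<xi> x"
    using tailored_int_poly[OF \<delta>, of n] by (elim exE conjE)
  define \<nu> where "\<nu> = 1 / (108 * (real (n + 2) * 2 ^ (n + 1)) * E * max 1 (9 * E / \<delta>))"
  have "1 * 1 * 1 * 1 \<le> (real (n + 2) * 2 ^ (n + 1)) * E * max 1 (9 * E / \<delta>)"
    using E(1) by (intro mult_mono one_le_power) auto
  then have "1 < 108 * (real (n + 2) * 2 ^ (n + 1)) * E * max 1 (9 * E / \<delta>)"
    unfolding mult.assoc by linarith
  then have \<nu>: "0 < \<nu>" "\<nu> < 1" 
  proof -
    have "0 < 1 / z \<and> 1 / z < 1" if "1 < z" for z :: real using that by simp
    then show "0 < \<nu>" "\<nu> < 1"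
      using \<open>1 < 108 * (real (n + 2) * 2 ^ (n + 1)) * E * max 1 (9 * E / \<delta>)\<close> unfolding \<nu>_def by blast+
  qed
  have main: "\<forall>\<^sub>F Q in at_top. 3 / 4 * measure lborel J \<le>
      measure lborel ((\<Union>\<alpha>\<^sub>1 \<in> \<A> Q \<mu>. ball \<alpha>\<^sub>1 (Q powr (- real n - 1 + 2 * \<mu>))) \<inter> J)"
    if \<A>: "\<A> = close_conj_numbers n \<nu> \<or> \<A> = close_conj_integers n \<nu>"
      and \<mu>: "0 < \<mu>" "\<mu> \<le> (real n + 1) / 3" and J: "is_interval J" "J \<subseteq> {-1/2..1/2}" for \<A> \<mu> J
  proof (cases "J \<noteq> {} \<and> Inf J < Sup J")
    case False
    have "bounded J" using J(2) bounded_closed_interval bounded_subset by blast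
    then have "3 / 4 * measure lborel J \<le> measure lborel (U \<inter> J)" if "open U" for U
      using measure_ge_of_mostly[OF J(1) _ _ that] False by (cases "J = {}") auto
    then show ?thesis by (intro always_eventually allI) (simp add: open_UN)
  next
    case True
    then have Jne: "J \<noteq> {}" and ab: "Inf J < Sup J" by auto
    have Jb: "bounded J" using J(2) bounded_closed_interval bounded_subset by blast
    obtain c where c: "0 < c" and nsv_c: "\<forall>\<xi>. (\<forall>i\<le>n. 0 < \<xi> i) \<longrightarrow> (\<Prod>i\<le>n. \<xi> i) = 1 \<longrightarrow>
       (\<forall>k. 1 \<le> k \<longrightarrow> k \<le> n \<longrightarrow> (\<Prod>i<k. \<xi> i) \<le> c) \<longrightarrow> mostly (1/4) (Inf J) (Sup J) (no_short_vector n \<delta> \<xi>)"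
      using nsv[rule_format, OF ab] by (elim exE conjE)
    \<comment> \<open>chosen so that \<open>Q powr (- \<mu>) \<le> d\<close> makes the terms of order at least three negligible\<close>
    define d where "d = 1 / 11 / (real (n + 1) * 11 ^ (n + 1))"
    have d: "0 < d" by (simp add: d_def)
    have "\<mu> - real n < 0" using \<mu>(2) assms by simp
    then have "\<forall>\<^sub>F Q in at_top. Q powr (\<mu> - real n) \<le> c" using c by (rule eventually_powr_neg_le)
    moreover have "\<forall>\<^sub>F Q::real in at_top. Q powr (- 1) \<le> c" using c by (intro eventually_powr_neg_le) auto
    moreover have "\<forall>\<^sub>F Q in at_top. Q powr (- \<mu>) \<le> d" using d \<mu> by (intro eventually_powr_neg_le) auto
    moreover have "\<forall>\<^sub>F Q::real in at_top. 1 < Q" by (rule eventually_gt_at_top)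
    ultimately show ?thesis
    proof eventually_elim
      case (elim Q)
      let ?U = "\<Union>\<alpha>\<^sub>1 \<in> \<A> Q \<mu>. ball \<alpha>\<^sub>1 (Q powr (- real n - 1 + 2 * \<mu>))"
      have pos: "0 < taylor_scale n \<mu> Q i" for i using elim by (intro taylor_scale_pos) simp
      have "(\<Prod>i\<le>n. taylor_scale n \<mu> Q i) = Q powr (real (n + 1) - 1 - real n)"
        using prod_taylor_scale[of Q "n + 1" n \<mu>] elim assms by (simp add: lessThan_Suc_atMost)
      then have prod1: "(\<Prod>i\<le>n. taylor_scale n \<mu> Q i) = 1" using elim by simp
      have "mostly (1/4) (Inf J) (Sup J) (no_short_vector n \<delta> (taylor_scale n \<mu> Q))"
        using nsv_c[rule_format, of "taylor_scale n \<mu> Q"] pos prod1 prod_taylor_scale_small[OF elim(4) assms elim(1,2)] by blast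
      moreover have "x \<in> ?U" if x: "no_short_vector n \<delta> (taylor_scale n \<mu> Q) x" "x \<in> J" for x
      proof -
        have "x \<in> {-1/2..1/2}" using x(2) J(2) by blast
        then have x1: "\<bar>x\<bar> \<le> 1" by (auto simp: abs_le_iff)
        have large: "real (n + 1) * 11 ^ (n + 1) * Q powr (- \<mu>) \<le> 1 / 11"
        proof -
          have "real (n + 1) * 11 ^ (n + 1) * Q powr (- \<mu>) \<le> real (n + 1) * 11 ^ (n + 1) * d"
            using elim(3) by (intro mult_left_mono) auto
          also have "\<dots> = 1 / 11" by (simp add: d_def del: of_nat_Suc of_nat_add power_Suc)
          finally show ?thesis .
        qed
        have near: "\<exists>\<alpha>. \<bar>\<alpha> - x\<bar> < Q powr (- real n - 1 + 2 * \<mu>) \<and> algebraic \<alpha> \<and> (m = n + 1 \<longrightarrow> algebraic_int \<alpha>) \<and>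
            alg_degree \<alpha> = m \<and> height_and_conjugate_cond \<nu> Q \<mu> \<alpha>" if m: "m = n \<or> m = n + 1" for m
          unfolding \<nu>_def
          by (rule close_conjugates_near[OF assms m E(2,1) \<delta> _ x(1) \<mu> elim(4) large x1])
            (use tailor pos prod1 x(1) in blast)
        have "\<exists>\<alpha>\<in>\<A> Q \<mu>. \<bar>\<alpha> - x\<bar> < Q powr (- real n - 1 + 2 * \<mu>)"
          using \<A>
        proof
          assume "\<A> = close_conj_numbers n \<nu>"
          then show ?thesis using near[of n] unfolding close_conj_numbers_def by blast
        next
          assume "\<A> = close_conj_integers n \<nu>"
          then show ?thesis using near[of "n + 1"] unfolding close_conj_integers_def by blast
        qed
        then show ?thesis by (auto simp: dist_real_def)
      qed
      ultimately have "mostly (1/4) (Inf J) (Sup J) (\<lambda>x. x \<in> J \<longrightarrow> x \<in> ?U)"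
        unfolding mostly_def by blast
      then show ?case using J(1) Jb Jne by (intro measure_ge_of_mostly) auto
    qed
  qed
  show ?thesis
    by (intro exI[of _ \<nu>] conjI ballI allI impI \<nu>) (use main in auto)
qed

end
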